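(* Let $\mathfrak g=X(n)$ with $X\in\{W,\bar S,\bar H,\overline{CH}\}$. Then any proper parabolic subalgebra of $\mathfrak g$ (i.e. any $\mathsf P_h\neq\mathfrak g$ associated with a strongly regular element $h$) coincides with either $\mathsf P_{\max}=\mathfrak g_0\oplus\bigoplus_{i>0}\mathfrak g_i$ or $\mathsf P_{\min}=\mathfrak g_0\oplus\mathfrak g_{-1}$.
   Context: Ground field $\mathbb C$. $\Lambda(n)$ is the Grassmann superalgebra on odd generators $\xi_1,\dots,\xi_n$ with $\deg\xi_i=1$. $W(n)=\{\sum_i f_iD_i: f_i\in\Lambda(n)\}$ is the Lie superalgebra of superderivations, $D_i(\xi_j)=\delta_{ij}$, $\mathbb Z$-graded by $W(n)_j=\{\sum f_iD_i: f_i\in\Lambda(n)_{j+1}\}$. $S(n)=\{\sum f_iD_i\in W(n):\sum D_i(f_i)=0\}$. For $n=2r$ or $2r+1$ put $i'=i+r$ ($1\le i\le r$), $i'=i-r$ ($r<i\le 2r$), $i'=i$ if $i=2r+1$, $D_H(f)=\sum_i(-1)^{|f|}D_i(f)D_{i'}$; $CH(n)=\{D_H(f):f\in\Lambda(n)\}$, $H(n)=\{D_H(f): f\in\sum_{i\le n-1}\Lambda(n)_i\}$. Put $\mathsf d=\sum_i\xi_iD_i$, $\bar S(n)=S(n)\oplus\mathbb C\mathsf d$, $\bar H(n)=H(n)\oplus\mathbb C\mathsf d$, $\overline{CH}(n)=CH(n)\oplus\mathbb C\mathsf d$. Here $n\ge3$ for $W$, $n\ge4$ for $\bar S$, $n\ge5$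 for $\bar H,\overline{CH}$. Each is a graded subalgebra $\mathfrak g=\bigoplus_{i\ge-1}\mathfrak g_i$ of $W(n)$, with $\mathfrak g_0\cong\mathfrak{gl}(n)$ for $W,\bar S$ and $\mathfrak{so}(n)\oplus\mathbb C\mathsf d$ for $\bar H,\overline{CH}$. $\bar{\mathfrak h}\subset\mathfrak g_0$ is the Cartan subalgebra with standard basis $\{\xi_iD_i\}_{1\le i\le n}$ for $W,\bar S$, and $\{\xi_iD_i-\xi_{i+r}D_{i+r}\ (1\le i\le r),\mathsf d\}$ for $\bar H,\overline{CH}$. Fix the standard triangular decomposition $\mathfrak g_0=\mathfrak n^-\oplus\bar{\mathfrak h}\oplus\mathfrak n^+$ and $\mathfrak b=\bar{\mathfrak h}\oplus\mathfrak n^+$. $\Phi=\Phi(\mathfrak g)\subset\bar{\mathfrak h}^*$ is the root system and $\mathfrak g=\bar{\mathfrak h}\oplus\bigoplus_{\alpha\in\Phi}\mathfrak g_\alpha$. $\bar{\mathfrak h}_{\mathbb R}$ is the real span of the standard basis of $\bar{\mathfrak h}$. An element $h\in\bar{\mathfrak h}_{\mathbb R}$ is regular if $\alpha(h)\ne0$ for all $\alpha\in\Phi$; then $\Phi_h^{+}=\{\alpha\in\Phi:\alpha(h)>0\}$ and the associated Borel subalgebra is $\mathfrak B_h=\bar{\mathfrak h}\oplus\bigoplus_{\alpha\in\Phi_h^+}\mathfrak g_\alpha$. A regular $h$ is strongly regular if $\mathfrak B_h\supseteq\mathfrak b$. A subset $\Psi\subseteq\Phi$ is closed if $\alpha,\beta\in\Psi$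 and $\alpha+\beta\in\Phi$ imply $\alpha+\beta\in\Psi$; a subalgebra is closed if it equals $\bar{\mathfrak h}+\sum_{\alpha\in\Psi}\mathfrak g_\alpha$ for some closed $\Psi$. For strongly regular $h$, the parabolic subalgebra $\mathsf P_h$ is the closed subalgebra generated by $\mathfrak g_0$ and $\mathfrak B_h$ (the smallest closed subalgebra containing both). *)

theory Defs
  imports Complex_Main "HOL-Library.Function_Algebras"
begin

section \<open>The Grassmann superalgebra\<close>

text \<open>
  A function \<open>f :: nat set \<Rightarrow> complex\<close> stands for \<open>\<Sum>I. f I \<xi>\<^sub>I\<close>, where
  \<open>\<xi>\<^sub>I\<close> is the product of the generators \<open>\<xi>\<^sub>i\<close>, \<open>i \<in> I\<close>, in increasing order of
  the indices. The generators of \<open>\<Lambda>(n)\<close> are \<open>\<xi>\<^sub>1, \<dots>, \<xi>\<^sub>n\<close>. Addition of coefficient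
  functions, and below of operators and of linear functionals, is pointwise.
\<close>

type_synonym grass = "nat set \<Rightarrow> complex"

definition Lambda :: "nat \<Rightarrow> grass set" where
  "Lambda n = {f. \<forall>I. f I \<noteq> 0 \<longrightarrow> I \<subseteq> {1..n}}"

definition Lambda_hom :: "nat \<Rightarrow> int \<Rightarrow> grass set" where
  "Lambda_hom n k = {f \<in> Lambda n. \<forall>I. f I \<noteq> 0 \<longrightarrow> int (card I) = k}"

definition xi :: "nat \<Rightarrow> grass" where
  "xi i = (\<lambda>I. if I = {i} then 1 else 0)"

text \<open>
  \<open>\<xi>\<^sub>I \<xi>\<^sub>J = (-1)\<^sup>s \<xi>\<^sub>K\<close> for disjoint \<open>I\<close>, \<open>J\<close> with union \<open>K\<close>, where \<open>s\<close> is
  the number of inversions, that is of pairs \<open>(i, j) \<in> I \<times> J\<close> with \<open>j < i\<close>.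
\<close>

definition gmult :: "grass \<Rightarrow> grass \<Rightarrow> grass" where
  "gmult f g = (\<lambda>K. \<Sum>I\<in>Pow K.
     (-1) ^ card {(i, j). i \<in> I \<and> j \<in> K - I \<and> j < i} * f I * g (K - I))"

text \<open>
  The odd superderivation \<open>D\<^sub>i\<close>: for \<open>i \<in> J\<close> it maps \<open>\<xi>\<^sub>J\<close> to
  \<open>(-1)\<^sup>s \<xi>\<^sub>I\<close>, where \<open>I = J - {i}\<close> and \<open>s\<close> is the number of \<open>j \<in> J\<close> with \<open>j < i\<close>; it
  maps the other monomials to 0.
\<close>

definition gderiv :: "nat \<Rightarrow> grass \<Rightarrow> grass" where
  "gderiv i f = (\<lambda>I. if i \<in> I then 0 else (-1) ^ card {j \<in> I. j < i} * f (insert i I))"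

text \<open>\<open>f\<close> is mapped to \<open>(-1)\<^bsup>|f|\<^esup> f\<close>, extended linearly to inhomogeneous \<open>f\<close>.\<close>

definition parity_sign :: "grass \<Rightarrow> grass" where
  "parity_sign f = (\<lambda>I. (-1) ^ card I * f I)"

definition parity_part :: "nat \<Rightarrow> grass \<Rightarrow> grass" where
  "parity_part p f = (\<lambda>I. if even (card I + p) then f I else 0)"


section \<open>Operators and their supercommutator\<close>

type_synonym oper = "grass \<Rightarrow> grass"

definition op_scale :: "complex \<Rightarrow> oper \<Rightarrow> oper" where
  "op_scale c X = (\<lambda>f I. c * X f I)"

global_interpretation opv: vector_space op_scale
  by unfold_locales (simp_all add: op_scale_def fun_eq_iff algebra_simps)

text \<open>The component of parity \<open>p\<close> (\<open>0\<close> even, \<open>1\<close> odd) of an operator.\<close>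

definition op_part :: "nat \<Rightarrow> oper \<Rightarrow> oper" where
  "op_part p X = (\<lambda>f. \<Sum>q\<in>{0,1}. parity_part (p + q) (X (parity_part q f)))"

text \<open>\<open>XY - (-1)\<^bsup>|X||Y|\<^esup> YX\<close>, extended bilinearly to inhomogeneous \<open>X\<close>, \<open>Y\<close>.\<close>

definition superbracket :: "oper \<Rightarrow> oper \<Rightarrow> oper" where
  "superbracket X Y = (\<Sum>p\<in>{0,1}. \<Sum>q\<in>{0,1}.
     (op_part p X \<circ> op_part q Y) - op_scale ((-1) ^ (p * q)) (op_part q Y \<circ> op_part p X))"


section \<open>The Lie superalgebras of Cartan type\<close>

text \<open>
  The operator \<open>f D\<^sub>i\<close>. An operator \<open>\<Sum>i. f\<^sub>i D\<^sub>i\<close> acts on all coefficient functions,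
  not only on \<open>\<Lambda>(n)\<close>; this does not affect equality of such operators, as
  \<open>f\<^sub>j\<close> is the value at \<open>\<xi>\<^sub>j\<close>.
\<close>

definition fD :: "grass \<Rightarrow> nat \<Rightarrow> oper" where
  "fD f i = (\<lambda>g. gmult f (gderiv i g))"

definition W_alg :: "nat \<Rightarrow> oper set" where
  "W_alg n = {\<Sum>i=1..n. fD (f i) i |f. \<forall>i\<in>{1..n}. f i \<in> Lambda n}"

definition W_deg :: "nat \<Rightarrow> int \<Rightarrow> oper set" where
  "W_deg n k = {\<Sum>i=1..n. fD (f i) i |f. \<forall>i\<in>{1..n}. f i \<in> Lambda_hom n (k + 1)}"

definition S_alg :: "nat \<Rightarrow> oper set" where
  "S_alg n = {\<Sum>i=1..n. fD (f i) i |f.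
     (\<forall>i\<in>{1..n}. f i \<in> Lambda n) \<and> (\<Sum>i=1..n. gderiv i (f i)) = 0}"

text \<open>The involution \<open>i \<mapsto> i'\<close> of \<open>{1..n}\<close>, with \<open>r = n div 2\<close>.\<close>

definition conj_index :: "nat \<Rightarrow> nat \<Rightarrow> nat" where
  "conj_index n i = (let r = n div 2 in
     if i \<le> r then i + r else if i \<le> 2 * r then i - r else i)"

definition D_H :: "nat \<Rightarrow> grass \<Rightarrow> oper" where
  "D_H n f = (\<Sum>i=1..n. fD (gderiv i (parity_sign f)) (conj_index n i))"

definition CH_alg :: "nat \<Rightarrow> oper set" where
  "CH_alg n = D_H n ` Lambda n"

definition H_alg :: "nat \<Rightarrow> oper set" where
  "H_alg n = D_H n ` {f \<in> Lambda n. \<forall>I. f I \<noteq> 0 \<longrightarrow> card I \<le> n - 1}"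

definition d_elt :: "nat \<Rightarrow> oper" where
  "d_elt n = (\<Sum>i=1..n. fD (xi i) i)"

definition adjoin_d :: "nat \<Rightarrow> oper set \<Rightarrow> oper set" where
  "adjoin_d n L = {x + op_scale c (d_elt n) |x c. x \<in> L}"

datatype cartan_type = W | S_bar | H_bar | CH_bar

fun min_n :: "cartan_type \<Rightarrow> nat" where
  "min_n W = 3"
| "min_n S_bar = 4"
| "min_n H_bar = 5"
| "min_n CH_bar = 5"

fun lie_alg :: "cartan_type \<Rightarrow> nat \<Rightarrow> oper set" where
  "lie_alg W n = W_alg n"
| "lie_alg S_bar n = adjoin_d n (S_alg n)"
| "lie_alg H_bar n = adjoin_d n (H_alg n)"
| "lie_alg CH_bar n = adjoin_d n (CH_alg n)"

definition lie_deg :: "cartan_type \<Rightarrow> nat \<Rightarrow> int \<Rightarrow> oper set" where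
  "lie_deg X n k = lie_alg X n \<inter> W_deg n k"


section \<open>Cartan subalgebra and roots\<close>

definition gl_cartan_basis :: "nat \<Rightarrow> oper set" where
  "gl_cartan_basis n = (\<lambda>i. fD (xi i) i) ` {1..n}"

definition so_cartan_basis :: "nat \<Rightarrow> oper set" where
  "so_cartan_basis n = (let r = n div 2 in
     insert (d_elt n) ((\<lambda>i. fD (xi i) i - fD (xi (i + r)) (i + r)) ` {1..r}))"

fun cartan_basis :: "cartan_type \<Rightarrow> nat \<Rightarrow> oper set" where
  "cartan_basis W n = gl_cartan_basis n"
| "cartan_basis S_bar n = gl_cartan_basis n"
| "cartan_basis H_bar n = so_cartan_basis n"
| "cartan_basis CH_bar n = so_cartan_basis n"

definition cartan :: "cartan_type \<Rightarrow> nat \<Rightarrow> oper set" where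
  "cartan X n = opv.span (cartan_basis X n)"

definition cartan_real :: "cartan_type \<Rightarrow> nat \<Rightarrow> oper set" where
  "cartan_real X n =
     {\<Sum>b\<in>cartan_basis X n. op_scale (complex_of_real (c b)) b |c. True}"

text \<open>
  Linear functionals on the Cartan subalgebra, extended by 0 so that equality and addition
  of functionals are those of HOL functions.
\<close>

definition cartan_dual :: "cartan_type \<Rightarrow> nat \<Rightarrow> (oper \<Rightarrow> complex) set" where
  "cartan_dual X n = {\<alpha>.
     (\<forall>x\<in>cartan X n. \<forall>y\<in>cartan X n. \<alpha> (x + y) = \<alpha> x + \<alpha> y) \<and>
     (\<forall>c. \<forall>x\<in>cartan X n. \<alpha> (op_scale c x) = c * \<alpha> x) \<and>
     (\<forall>x. x \<notin> cartan X n \<longrightarrow> \<alpha> x = 0)}"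

definition root_space :: "cartan_type \<Rightarrow> nat \<Rightarrow> (oper \<Rightarrow> complex) \<Rightarrow> oper set" where
  "root_space X n \<alpha> =
     {x \<in> lie_alg X n. \<forall>h\<in>cartan X n. superbracket h x = op_scale (\<alpha> h) x}"

definition roots :: "cartan_type \<Rightarrow> nat \<Rightarrow> (oper \<Rightarrow> complex) set" where
  "roots X n = {\<alpha> \<in> cartan_dual X n. \<alpha> \<noteq> 0 \<and> root_space X n \<alpha> \<noteq> {0}}"


section \<open>Borel and parabolic subalgebras\<close>

text \<open>
  The nilpotent radical of the standard Borel subalgebra of \<open>\<gg>\<^sub>0\<close>. In the orthogonal case
  let \<open>\<epsilon>\<^sub>i\<close> be the weight of \<open>\<xi>\<^sub>i\<close> for \<open>1 \<le> i \<le> r\<close>; then \<open>\<xi>\<^bsub>i+r\<^esub>\<close> has weight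
  \<open>-\<epsilon>\<^sub>i\<close> and the three families below span the root spaces of the standard positive
  roots \<open>\<epsilon>\<^sub>i + \<epsilon>\<^sub>j\<close> and \<open>\<epsilon>\<^sub>i - \<epsilon>\<^sub>j\<close> (\<open>i < j\<close>) and, for odd \<open>n\<close>, \<open>\<epsilon>\<^sub>i\<close>.
\<close>

definition gl_n_plus :: "nat \<Rightarrow> oper set" where
  "gl_n_plus n = opv.span {fD (xi i) j |i j. 1 \<le> i \<and> i < j \<and> j \<le> n}"

definition so_n_plus :: "nat \<Rightarrow> oper set" where
  "so_n_plus n = (let r = n div 2 in opv.span (
     {D_H n (gmult (xi i) (xi j)) |i j. 1 \<le> i \<and> i < j \<and> j \<le> r} \<union>
     {D_H n (gmult (xi i) (xi (j + r))) |i j. 1 \<le> i \<and> i < j \<and> j \<le> r} \<union>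
     {D_H n (gmult (xi i) (xi n)) |i. odd n \<and> 1 \<le> i \<and> i \<le> r}))"

fun n_plus :: "cartan_type \<Rightarrow> nat \<Rightarrow> oper set" where
  "n_plus W n = gl_n_plus n"
| "n_plus S_bar n = gl_n_plus n"
| "n_plus H_bar n = so_n_plus n"
| "n_plus CH_bar n = so_n_plus n"

definition std_borel :: "cartan_type \<Rightarrow> nat \<Rightarrow> oper set" where
  "std_borel X n = opv.span (cartan X n \<union> n_plus X n)"

definition regular :: "cartan_type \<Rightarrow> nat \<Rightarrow> oper \<Rightarrow> bool" where
  "regular X n h \<longleftrightarrow> h \<in> cartan_real X n \<and> (\<forall>\<alpha>\<in>roots X n. \<alpha> h \<noteq> 0)"

definition pos_roots :: "cartan_type \<Rightarrow> nat \<Rightarrow> oper \<Rightarrow> (oper \<Rightarrow> complex) set" where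
  "pos_roots X n h = {\<alpha> \<in> roots X n. \<alpha> h \<in> \<real> \<and> Re (\<alpha> h) > 0}"

definition root_sum :: "cartan_type \<Rightarrow> nat \<Rightarrow> (oper \<Rightarrow> complex) set \<Rightarrow> oper set" where
  "root_sum X n \<Psi> = opv.span (cartan X n \<union> (\<Union>\<alpha>\<in>\<Psi>. root_space X n \<alpha>))"

definition borel :: "cartan_type \<Rightarrow> nat \<Rightarrow> oper \<Rightarrow> oper set" where
  "borel X n h = root_sum X n (pos_roots X n h)"

definition strongly_regular :: "cartan_type \<Rightarrow> nat \<Rightarrow> oper \<Rightarrow> bool" where
  "strongly_regular X n h \<longleftrightarrow> regular X n h \<and> std_borel X n \<subseteq> borel X n h"

definition closed_roots :: "cartan_type \<Rightarrow> nat \<Rightarrow> (oper \<Rightarrow> complex) set \<Rightarrow> bool" where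
  "closed_roots X n \<Psi> \<longleftrightarrow> \<Psi> \<subseteq> roots X n \<and>
     (\<forall>\<alpha>\<in>\<Psi>. \<forall>\<beta>\<in>\<Psi>. \<alpha> + \<beta> \<in> roots X n \<longrightarrow> \<alpha> + \<beta> \<in> \<Psi>)"

text \<open>Subalgebras of a Lie superalgebra are \<open>\<int>\<^sub>2\<close>-graded subspaces by definition.\<close>

definition subalgebra :: "cartan_type \<Rightarrow> nat \<Rightarrow> oper set \<Rightarrow> bool" where
  "subalgebra X n L \<longleftrightarrow> L \<subseteq> lie_alg X n \<and> opv.subspace L \<and>
     (\<forall>x\<in>L. op_part 0 x \<in> L \<and> op_part 1 x \<in> L) \<and>
     (\<forall>x\<in>L. \<forall>y\<in>L. superbracket x y \<in> L)"

definition closed_subalgebra :: "cartan_type \<Rightarrow> nat \<Rightarrow> oper set \<Rightarrow> bool" where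
  "closed_subalgebra X n L \<longleftrightarrow> subalgebra X n L \<and>
     (\<exists>\<Psi>. closed_roots X n \<Psi> \<and> L = root_sum X n \<Psi>)"

definition parabolic :: "cartan_type \<Rightarrow> nat \<Rightarrow> oper \<Rightarrow> oper set" where
  "parabolic X n h =
     \<Inter>{L. closed_subalgebra X n L \<and> lie_deg X n 0 \<subseteq> L \<and> borel X n h \<subseteq> L}"

definition P_max :: "cartan_type \<Rightarrow> nat \<Rightarrow> oper set" where
  "P_max X n = opv.span (lie_deg X n 0 \<union> (\<Union>k\<in>{0<..}. lie_deg X n k))"

definition P_min :: "cartan_type \<Rightarrow> nat \<Rightarrow> oper set" where
  "P_min X n = opv.span (lie_deg X n 0 \<union> lie_deg X n (-1))"

end

theory Submission
  imports Defs
begin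

text \<open>
  Every element of \<open>W(n)\<close> is a combination of monomials \<open>\<xi>\<^sub>I D\<^sub>k\<close>, and the Cartan subalgebras act
  diagonally on them: \<open>h = \<Sum>i. c\<^sub>i \<xi>\<^sub>i D\<^sub>i\<close> multiplies \<open>\<xi>\<^sub>I D\<^sub>k\<close> by \<open>(\<Sum>i\<in>I. c\<^sub>i) - c\<^sub>k\<close>. Each of the
  four algebras \<open>\<gg>\<close> is stable under the projections onto the spans of the monomials of a given
  weight. Hence \<open>\<gg>\<close> is the sum of its Cartan subalgebra and its root spaces, the roots can be
  listed by finite index sets, and the sum of the root spaces for a set \<open>\<Psi>\<close> of roots consists of
  the elements of \<open>\<gg>\<close> whose monomials all have weight 0 or weight in \<open>\<Psi>\<close> (\<open>root_sum_iff\<close>). As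
  \<open>d_elt n\<close> lies in the Cartan subalgebra, a root has a degree, namely its value at \<open>d_elt n\<close>, and
  \<open>\<gg>\<^sub>j\<close> is the sum of the root spaces of degree \<open>j\<close>. The question becomes one about closed sets
  \<open>\<Psi>\<close> of roots that contain all roots of degree 0.

  Adding a root of degree 0 to a root amounts to exchanging one index of its monomial for another,
  and by such exchanges one gets from any root of degree \<open>j \<noteq> 0\<close> to any other. So \<open>\<Psi>\<close> is a union
  of full degrees (\<open>deg_roots_connected\<close>). In the orthogonal case the exchange of \<open>i\<close> for \<open>i'\<close> would
  need \<open>\<plusminus>2\<epsilon>\<^sub>i\<close>, which is not a root; a third index serves as an intermediate stop. If \<open>\<Psi>\<close>
  contains the degree -1 and some positive degree, then adding roots of degree -1 leads down to
  degree 1, adding roots of degree 1 leads up to the top degree, and \<open>\<Psi>\<close> is the set of all roots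
  (\<open>closed_roots_full\<close>).

  Now let \<open>\<Psi>\<close> moreover contain the roots that are positive on a regular \<open>h = \<Sum>i. c\<^sub>i \<xi>\<^sub>i D\<^sub>i\<close>. The
  weights of degree -1 are the \<open>-c\<^sub>i\<close>. If none of them is positive, then all \<open>c\<^sub>i\<close> are positive and
  every positive degree has a positive root (\<open>pos_roots_each_degree\<close>); so \<open>\<Psi>\<close> contains all degrees
  \<open>\<ge> 0\<close>, and it gives \<open>P_max\<close> or \<open>\<gg>\<close>. Otherwise \<open>\<Psi>\<close> contains the degree -1, and it gives \<open>P_min\<close>
  or \<open>\<gg>\<close>. In either case all closed subalgebras above \<open>\<gg>\<^sub>0\<close> and the Borel subalgebra are \<open>\<gg>\<close> or one
  and the same proper subspace, and \<open>\<gg>\<close> is one of them, so that their intersection is \<open>\<gg>\<close> or this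
  subspace.

  That \<open>\<gg>\<close> itself is a closed subalgebra has to be shown (\<open>lie_alg_subalgebra\<close>). It rests on the
  formula for the superbracket of two vector fields (\<open>superbracket_vf\<close>), on the behaviour of the
  divergence under it (\<open>divergence_bracket\<close>), and on the Poisson bracket of Hamiltonian functions
  (\<open>hfield_bracket\<close>).
\<close>

lemma sum_apply: "(\<Sum>i\<in>A. f i) x = (\<Sum>i\<in>A. f i x)"
  by (induction A rule: infinite_finite_induct) auto

section \<open>The Grassmann algebra\<close>

definition gscale :: "complex \<Rightarrow> grass \<Rightarrow> grass" where
  "gscale c f = (\<lambda>I. c * f I)"

text \<open>
  The sign in \<open>\<xi>\<^sub>A \<xi>\<^sub>B = \<plusminus>\<xi>\<^bsub>A \<union> B\<^esub>\<close>. Both the product and the derivations \<open>D\<^sub>i\<close> are expressed by it,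
  so that all sign computations reduce to its bimultiplicativity and its behaviour under a swap.
\<close>

definition inv_sign :: "nat set \<Rightarrow> nat set \<Rightarrow> complex" where
  "inv_sign A B = (-1) ^ card {(i, j). i \<in> A \<and> j \<in> B \<and> j < i}"

lemma finite_inversions:
  fixes A B :: "nat set"
  assumes "finite A"
  shows "finite {(i, j). i \<in> A \<and> j \<in> B \<and> j < i}"
proof (rule finite_subset)
  show "{(i, j). i \<in> A \<and> j \<in> B \<and> j < i} \<subseteq> (SIGMA i:A. {..<i})" by auto
  show "finite (SIGMA i:A. {..<i})" using assms by auto
qed

lemma inv_sign_Un_left:
  assumes "finite A" "finite B" "A \<inter> B = {}"
  shows "inv_sign (A \<union> B) C = inv_sign A C * inv_sign B C"
proof -
  have eq: "{(i, j). i \<in> A \<union> B \<and> j \<in> C \<and> j < i} =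
     {(i, j). i \<in> A \<and> j \<in> C \<and> j < i} \<union> {(i, j). i \<in> B \<and> j \<in> C \<and> j < i}" by auto
  show ?thesis unfolding inv_sign_def eq
    by (subst card_Un_disjoint) (use assms finite_inversions in \<open>auto simp: power_add\<close>)
qed

lemma inv_sign_Un_right:
  assumes "finite A" "B \<inter> C = {}"
  shows "inv_sign A (B \<union> C) = inv_sign A B * inv_sign A C"
proof -
  have eq: "{(i, j). i \<in> A \<and> j \<in> B \<union> C \<and> j < i} =
     {(i, j). i \<in> A \<and> j \<in> B \<and> j < i} \<union> {(i, j). i \<in> A \<and> j \<in> C \<and> j < i}" by auto
  show ?thesis unfolding inv_sign_def eq
    by (subst card_Un_disjoint) (use assms finite_inversions in \<open>auto simp: power_add\<close>)
qed

lemma inv_sign_insert_left: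
  assumes "finite A" "i \<notin> A"
  shows "inv_sign (insert i A) C = inv_sign {i} C * inv_sign A C"
  using inv_sign_Un_left[of "{i}" A C] assms by auto

lemma inv_sign_insert_right:
  assumes "finite A" "i \<notin> B"
  shows "inv_sign A (insert i B) = inv_sign A {i} * inv_sign A B"
  using inv_sign_Un_right[of A "{i}" B] assms by auto

lemma inv_sign_square [simp]: "inv_sign A B * inv_sign A B = 1"
  unfolding inv_sign_def by (simp flip: power_mult_distrib)

lemma inv_sign_empty [simp]: "inv_sign {} A = 1" "inv_sign A {} = 1"
  by (simp_all add: inv_sign_def)

lemma inv_sign_nonzero [simp]: "inv_sign A B \<noteq> 0"
  by (simp add: inv_sign_def)

lemma inv_sign_self [simp]: "inv_sign {i} {i} = 1"
proof -
  have "{(a, b). a \<in> {i} \<and> b \<in> {i} \<and> b < a} = {}" by auto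
  thus ?thesis unfolding inv_sign_def by (metis card.empty power_0)
qed

text \<open>
  Each pair in \<open>A \<times> B\<close> is an inversion of exactly one of the two orders.
\<close>

lemma inv_sign_swap:
  assumes "finite A" "finite B" "A \<inter> B = {}"
  shows "inv_sign A B * inv_sign B A = (-1) ^ (card A * card B)"
proof -
  let ?S = "{(i, j). i \<in> A \<and> j \<in> B \<and> j < i}"
  let ?T = "{(i, j). i \<in> B \<and> j \<in> A \<and> j < i}"
  have "A \<times> B = ?S \<union> (\<lambda>(x, y). (y, x)) ` ?T"
  proof -
    have "(x, y) \<in> ?S \<union> (\<lambda>(x, y). (y, x)) ` ?T" if "x \<in> A" "y \<in> B" for x y
    proof (cases "y < x")
      case False
      hence "(y, x) \<in> ?T" using that assms(3) by (auto simp: not_less le_less)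
      thus ?thesis by force
    qed (use that in auto)
    thus ?thesis by auto
  qed
  hence "card A * card B = card (?S \<union> (\<lambda>(x, y). (y, x)) ` ?T)"
    by (metis card_cartesian_product)
  also have "\<dots> = card ?S + card ((\<lambda>(x, y). (y, x)) ` ?T)"
    by (rule card_Un_disjoint) (use assms finite_inversions in auto)
  also have "card ((\<lambda>(x, y). (y, x)) ` ?T) = card ?T"
    by (rule card_image) (auto simp: inj_on_def)
  finally show ?thesis unfolding inv_sign_def by (simp add: power_add)
qed

lemma inv_sign_swap_singleton:
  assumes "finite A" "i \<notin> A"
  shows "inv_sign A {i} = (-1) ^ card A * inv_sign {i} A"
proof -
  have "inv_sign A {i} * inv_sign {i} A * inv_sign {i} A = (-1) ^ card A * inv_sign {i} A"
    using inv_sign_swap[of A "{i}"] assms by simp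
  thus ?thesis by (simp add: mult.assoc inv_sign_square)
qed

lemma gderiv_inv_sign: "gderiv i f I = (if i \<in> I then 0 else inv_sign {i} I * f (insert i I))"
proof -
  have "card {(a, b). a \<in> {i} \<and> b \<in> I \<and> b < a} = card (Pair i ` {j \<in> I. j < i})"
    by (rule arg_cong[of _ _ card]) auto
  also have "\<dots> = card {j \<in> I. j < i}" by (rule card_image) (auto simp: inj_on_def)
  finally show ?thesis by (simp add: gderiv_def inv_sign_def)
qed

lemma gmult_inv_sign: "gmult f g K = (\<Sum>I\<in>Pow K. inv_sign I (K - I) * f I * g (K - I))"
  by (simp add: gmult_def inv_sign_def)

lemma gmult_infinite: "infinite K \<Longrightarrow> gmult f g K = 0"
  by (simp add: gmult_def)

text \<open>
  Products vanish on infinite sets, so only the values of the factors on finite sets matter. Several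
  identities for \<open>D\<^sub>i\<close> and parities hold only there, since an infinite set has cardinality 0.
\<close>

lemma gmult_cong:
  assumes "\<And>I. finite I \<Longrightarrow> f I = f' I" "\<And>I. finite I \<Longrightarrow> g I = g' I"
  shows "gmult f g = gmult f' g'"
proof
  fix K
  show "gmult f g K = gmult f' g' K"
  proof (cases "finite K")
    case True
    hence "finite I" "finite (K - I)" if "I \<in> Pow K" for I
      using that finite_subset[of I K] by auto
    thus ?thesis unfolding gmult_def by (intro sum.cong refl) (simp add: assms)
  qed (simp add: gmult_infinite)
qed

lemma gmult_linear:
  "gmult (f + f') g = gmult f g + gmult f' g"
  "gmult f (g + g') = gmult f g + gmult f g'"
  "gmult (f - f') g = gmult f g - gmult f' g"
  "gmult f (g - g') = gmult f g - gmult f g'"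
  "gmult (gscale c f) g = gscale c (gmult f g)"
  "gmult f (gscale c g) = gscale c (gmult f g)"
  "gmult 0 g = 0" "gmult f 0 = 0"
  by (auto simp: fun_eq_iff gmult_def gscale_def algebra_simps sum.distrib sum_subtractf sum_distrib_left)

lemma gderiv_linear:
  "gderiv i (f + f') = gderiv i f + gderiv i f'"
  "gderiv i (f - f') = gderiv i f - gderiv i f'"
  "gderiv i (gscale c f) = gscale c (gderiv i f)"
  "gderiv i 0 = 0"
  by (auto simp: fun_eq_iff gderiv_def gscale_def algebra_simps)

lemma parity_sign_linear:
  "parity_sign (f + f') = parity_sign f + parity_sign f'"
  "parity_sign (gscale c f) = gscale c (parity_sign f)"
  "parity_sign 0 = 0"
  by (auto simp: fun_eq_iff parity_sign_def gscale_def algebra_simps)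

lemma gscale_linear:
  "gscale c (f + f') = gscale c f + gscale c f'"
  "gscale c (f - f') = gscale c f - gscale c f'"
  "gscale c (gscale d f) = gscale (c * d) f"
  "gscale c 0 = 0" "gscale 1 f = f" "gscale 0 f = 0"
  by (auto simp: fun_eq_iff gscale_def algebra_simps)

lemma gmult_sum:
  "gmult (\<Sum>i\<in>A. f i) g = (\<Sum>i\<in>A. gmult (f i) g)"
  "gmult g (\<Sum>i\<in>A. f i) = (\<Sum>i\<in>A. gmult g (f i))"
  using additive.sum[of "\<lambda>f. gmult f g" f A] additive.sum[of "gmult g" f A]
  by (simp_all add: additive_def gmult_linear)

lemma gderiv_sum: "gderiv k (\<Sum>i\<in>A. f i) = (\<Sum>i\<in>A. gderiv k (f i))"
  using additive.sum[of "gderiv k" f A] by (simp add: additive_def gderiv_linear)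

lemma gscale_sum: "gscale c (\<Sum>i\<in>A. f i) = (\<Sum>i\<in>A. gscale c (f i))"
  using additive.sum[of "gscale c" f A] by (simp add: additive_def gscale_linear)

text \<open>
  Both sides are sums over the ordered partitions of \<open>K\<close> into three parts, with the same sign because
  \<open>inv_sign\<close> is multiplicative in either argument.
\<close>

lemma gmult_assoc: "gmult (gmult f g) h = gmult f (gmult g h)"
proof
  fix K
  show "gmult (gmult f g) h K = gmult f (gmult g h) K"
  proof (cases "finite K")
    case True
    have fin: "finite A" if "A \<subseteq> K" for A using that True finite_subset by auto
    have "gmult (gmult f g) h K = (\<Sum>A\<in>Pow K. \<Sum>I\<in>Pow A.
        inv_sign A (K - A) * inv_sign I (A - I) * f I * g (A - I) * h (K - A))"
      by (simp add: gmult_inv_sign sum_distrib_left sum_distrib_right mult.assoc)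
    also have "\<dots> = (\<Sum>(A, I)\<in>(SIGMA A:Pow K. Pow A).
        inv_sign A (K - A) * inv_sign I (A - I) * f I * g (A - I) * h (K - A))"
      by (rule sum.Sigma) (use True fin in auto)
    also have "\<dots> = (\<Sum>(I, J)\<in>(SIGMA I:Pow K. Pow (K - I)).
        inv_sign I (K - I) * inv_sign J (K - I - J) * f I * g J * h (K - I - J))"
    proof (rule sum.reindex_bij_witness[where i="\<lambda>(I, J). (I \<union> J, I)" and j="\<lambda>(A, I). (I, A - I)"], goal_cases)
      case (5 a)
      then obtain A I where a: "a = (A, I)" "I \<subseteq> A" "A \<subseteq> K" by auto
      have 1: "A = I \<union> (A - I)" "K - I = (A - I) \<union> (K - A)" using a by auto
      have "inv_sign A (K - A) = inv_sign I (K - A) * inv_sign (A - I) (K - A)"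
        by (subst 1(1), subst inv_sign_Un_left) (use a fin in \<open>auto intro: finite_subset\<close>)
      moreover have "inv_sign I (K - I) = inv_sign I (A - I) * inv_sign I (K - A)"
        by (subst 1(2), subst inv_sign_Un_right) (use a fin in auto)
      moreover have "K - I - (A - I) = K - A" using a by auto
      ultimately show ?case by (simp add: a)
    qed auto
    also have "\<dots> = (\<Sum>I\<in>Pow K. \<Sum>J\<in>Pow (K - I).
        inv_sign I (K - I) * inv_sign J (K - I - J) * f I * g J * h (K - I - J))"
      by (rule sum.Sigma[symmetric]) (use True fin in auto)
    also have "\<dots> = gmult f (gmult g h) K"
      by (simp add: gmult_inv_sign sum_distrib_left mult_ac)
    finally show ?thesis .
  qed (simp add: gmult_infinite)
qed

text \<open>
  Parities are natural numbers modulo 2.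
\<close>

definition has_parity :: "nat \<Rightarrow> grass \<Rightarrow> bool" where
  "has_parity a f \<longleftrightarrow> (\<forall>I. f I \<noteq> 0 \<longrightarrow> even (card I + a))"

lemma neg_one_power_cong: "even (a + b) \<Longrightarrow> (-1::complex) ^ a = (-1) ^ b"
  by (cases "even a") (auto simp: minus_one_power_iff)

lemma parity_sign_has_parity: "has_parity a f \<Longrightarrow> parity_sign f = gscale ((-1) ^ a) f"
  unfolding fun_eq_iff parity_sign_def gscale_def has_parity_def by (metis mult_zero_right neg_one_power_cong)

lemma gmult_supercommute:
  assumes "has_parity a f" "has_parity b g"
  shows "gmult g f = gscale ((-1) ^ (a * b)) (gmult f g)"
proof
  fix K
  show "gmult g f K = gscale ((-1) ^ (a * b)) (gmult f g) K"
  proof (cases "finite K")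
    case True
    have "gmult g f K = (\<Sum>I\<in>Pow K. inv_sign I (K - I) * g I * f (K - I))"
      by (simp add: gmult_inv_sign)
    also have "\<dots> = (\<Sum>I\<in>Pow K. inv_sign (K - I) I * g (K - I) * f I)"
      by (rule sum.reindex_bij_witness[where i="\<lambda>I. K - I" and j="\<lambda>I. K - I"])
        (auto simp: double_diff)
    also have "\<dots> = (\<Sum>I\<in>Pow K. (-1) ^ (a * b) * (inv_sign I (K - I) * f I * g (K - I)))"
    proof (rule sum.cong[OF refl])
      fix I assume "I \<in> Pow K"
      hence I: "I \<subseteq> K" "finite I" using True finite_subset by auto
      have "inv_sign (K - I) I = (-1) ^ (a * b) * inv_sign I (K - I)" if "f I \<noteq> 0" "g (K - I) \<noteq> 0"
      proof -
        have "even (card I + a)" "even (card (K - I) + b)" using assms that by (auto simp: has_parity_def)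
        hence "(-1::complex) ^ (card I * card (K - I)) = (-1) ^ (a * b)"
          by (intro neg_one_power_cong) auto
        moreover have "inv_sign I (K - I) * inv_sign (K - I) I = (-1) ^ (card I * card (K - I))"
          by (rule inv_sign_swap) (use I True in auto)
        ultimately show ?thesis
          by (metis inv_sign_square mult.assoc mult.commute mult_1)
      qed
      thus "inv_sign (K - I) I * g (K - I) * f I =
          (-1) ^ (a * b) * (inv_sign I (K - I) * f I * g (K - I))"
        by (cases "f I = 0 \<or> g (K - I) = 0") auto
    qed
    also have "\<dots> = gscale ((-1) ^ (a * b)) (gmult f g) K"
      by (simp add: gmult_inv_sign gscale_def sum_distrib_left)
    finally show ?thesis .
  qed (simp add: gmult_infinite gscale_def)
qed

text \<open>
  The Leibniz rule for the odd derivation \<open>D\<^sub>i\<close>.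
\<close>

lemma gderiv_gmult:
  "gderiv i (gmult f g) = gmult (gderiv i f) g + gmult (parity_sign f) (gderiv i g)"
proof
  fix K
  consider "infinite K" | "finite K" "i \<notin> K" | "finite K" "i \<in> K" by auto
  thus "gderiv i (gmult f g) K = (gmult (gderiv i f) g + gmult (parity_sign f) (gderiv i g)) K"
  proof cases
    case 1
    thus ?thesis by (simp add: gmult_infinite gderiv_def)
  next
    case 2
    have fin: "finite A" if "A \<subseteq> K" for A using that 2 finite_subset by auto
    have sq: "inv_sign {i} A * (inv_sign {i} A * x) = x" for A x
      by (metis inv_sign_square mult.assoc mult_1)
    let ?t = "\<lambda>A. inv_sign {i} K * (inv_sign A (insert i K - A) * f A * g (insert i K - A))"
    have "gderiv i (gmult f g) K = (\<Sum>A\<in>Pow (insert i K). ?t A)"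
      using 2 by (simp add: gderiv_inv_sign gmult_inv_sign sum_distrib_left)
    also have "\<dots> = (\<Sum>A\<in>Pow K. ?t A) + (\<Sum>A\<in>insert i ` Pow K. ?t A)"
      unfolding Pow_insert by (rule sum.union_disjoint) (use 2 in auto)
    also have "(\<Sum>A\<in>insert i ` Pow K. ?t A) = (\<Sum>A\<in>Pow K. ?t (insert i A))"
    proof (subst sum.reindex)
      show "inj_on (insert i) (Pow K)" using 2 by (auto simp: inj_on_def)
    qed simp
    also have "(\<Sum>A\<in>Pow K. ?t (insert i A)) = gmult (gderiv i f) g K"
      unfolding gmult_inv_sign
    proof (rule sum.cong[OF refl])
      fix A assume A: "A \<in> Pow K"
      have e: "insert i K - insert i A = K - A" using 2 A by auto
      have "inv_sign {i} K = inv_sign {i} A * inv_sign {i} (K - A)"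
        using inv_sign_Un_right[of "{i}" A "K - A"] A by (auto simp: Un_absorb1)
      moreover have "inv_sign (insert i A) (K - A) = inv_sign {i} (K - A) * inv_sign A (K - A)"
        by (rule inv_sign_insert_left) (use A 2 fin in auto)
      ultimately show "?t (insert i A) = inv_sign A (K - A) * gderiv i f A * g (K - A)"
        using A 2 by (auto simp: e gderiv_inv_sign sq mult_ac)
    qed
    also have "(\<Sum>A\<in>Pow K. ?t A) = gmult (parity_sign f) (gderiv i g) K"
      unfolding gmult_inv_sign
    proof (rule sum.cong[OF refl])
      fix A assume A: "A \<in> Pow K"
      have e: "insert i K - A = insert i (K - A)" using 2 A by auto
      have "inv_sign {i} K = inv_sign {i} A * inv_sign {i} (K - A)"
        using inv_sign_Un_right[of "{i}" A "K - A"] A by (auto simp: Un_absorb1)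
      moreover have "inv_sign A (insert i (K - A)) = inv_sign A {i} * inv_sign A (K - A)"
        by (rule inv_sign_insert_right) (use A 2 fin in auto)
      moreover have "inv_sign A {i} = (-1) ^ card A * inv_sign {i} A"
        by (rule inv_sign_swap_singleton) (use A 2 fin in auto)
      ultimately show "?t A = inv_sign A (K - A) * parity_sign f A * gderiv i g (K - A)"
        using A 2 by (auto simp: e gderiv_inv_sign parity_sign_def sq mult_ac)
    qed
    finally show ?thesis by simp
  next
    case 3
    then obtain L where K: "K = insert i L" "i \<notin> L" "finite L"
      by (metis finite_insert mk_disjoint_insert)
    have fin: "finite A" if "A \<subseteq> L" for A using that K finite_subset by auto
    \<comment> \<open>Here the left-hand side vanishes. On the right, the term of \<open>A\<close> in the first product cancels
      the term of \<open>insert i A\<close> in the second.\<close>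
    have sum_split: "(\<Sum>A\<in>Pow K. t A) = (\<Sum>A\<in>Pow L. t A) + (\<Sum>A\<in>Pow L. t (insert i A))"
      for t :: "nat set \<Rightarrow> complex"
    proof -
      have "(\<Sum>A\<in>Pow K. t A) = (\<Sum>A\<in>Pow L. t A) + (\<Sum>A\<in>insert i ` Pow L. t A)"
        unfolding K(1) Pow_insert by (rule sum.union_disjoint) (use K in auto)
      also have "(\<Sum>A\<in>insert i ` Pow L. t A) = (\<Sum>A\<in>Pow L. t (insert i A))"
        by (subst sum.reindex) (use K in \<open>auto simp: inj_on_def\<close>)
      finally show ?thesis .
    qed
    let ?a = "\<lambda>A. inv_sign A (K - A) * gderiv i f A * g (K - A)"
    let ?b = "\<lambda>A. inv_sign A (K - A) * parity_sign f A * gderiv i g (K - A)"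
    have a0: "(\<Sum>A\<in>Pow L. ?a (insert i A)) = 0" by (simp add: gderiv_def)
    have b0: "(\<Sum>A\<in>Pow L. ?b A) = 0"
      by (rule sum.neutral) (use K in \<open>auto simp: gderiv_def\<close>)
    have "?a A = - ?b (insert i A)" if A: "A \<in> Pow L" for A
    proof -
      have e: "K - A = insert i (L - A)" "K - insert i A = L - A" "i \<notin> A" "finite A"
        "card (insert i A) = Suc (card A)"
        using K A fin[of A] by (auto simp: card_insert_if)
      have "inv_sign A (insert i (L - A)) = inv_sign A {i} * inv_sign A (L - A)"
        by (rule inv_sign_insert_right) (use A e K fin in auto)
      moreover have "inv_sign A {i} = (-1) ^ card A * inv_sign {i} A"
        by (rule inv_sign_swap_singleton) (use e in auto)
      moreover have "inv_sign (insert i A) (L - A) = inv_sign {i} (L - A) * inv_sign A (L - A)"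
        by (rule inv_sign_insert_left) (use e in auto)
      moreover have sq: "inv_sign {i} B * (inv_sign {i} B * x) = x" for B x
        by (metis inv_sign_square mult.assoc mult_1)
      ultimately show ?thesis
        using K e by (auto simp: gderiv_inv_sign parity_sign_def mult_ac)
    qed
    hence "(\<Sum>A\<in>Pow L. ?a A) + (\<Sum>A\<in>Pow L. ?b (insert i A)) = 0"
      by (simp add: sum_negf)
    hence "gmult (gderiv i f) g K + gmult (parity_sign f) (gderiv i g) K = 0"
      unfolding gmult_inv_sign sum_split a0 b0 by simp
    thus ?thesis using 3 by (simp add: gderiv_def)
  qed
qed

lemma gderiv_anticommute: "gderiv i (gderiv j f) = - gderiv j (gderiv i f)"
proof
  fix I
  show "gderiv i (gderiv j f) I = (- gderiv j (gderiv i f)) I"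
  proof (cases "i = j \<or> i \<in> I \<or> j \<in> I")
    case False
    have "inv_sign {j} (insert i I) = inv_sign {j} {i} * inv_sign {j} I"
      "inv_sign {i} (insert j I) = inv_sign {i} {j} * inv_sign {i} I"
      using False by (auto intro: inv_sign_insert_right)
    moreover have "inv_sign {j} {i} = - inv_sign {i} {j}"
      using inv_sign_swap_singleton[of "{j}" i] False by auto
    ultimately show ?thesis using False
      by (auto simp: gderiv_inv_sign insert_commute)
  qed (auto simp: gderiv_def)
qed

section \<open>Vector fields and their superbracket\<close>

text \<open>
  The vector field \<open>\<Sum>i. F\<^sub>i D\<^sub>i\<close>. Only the coefficients with index in \<open>{1..n}\<close> matter.
\<close>

definition vf :: "nat \<Rightarrow> (nat \<Rightarrow> grass) \<Rightarrow> oper" where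
  "vf n F = (\<Sum>i=1..n. fD (F i) i)"

text \<open>
  \<open>D\<^sub>i\<close> is odd, so the part of parity \<open>p\<close> of \<open>\<Sum>i. F\<^sub>i D\<^sub>i\<close> has coefficients of the opposite parity.
\<close>

definition coeff_part :: "nat \<Rightarrow> (nat \<Rightarrow> grass) \<Rightarrow> nat \<Rightarrow> grass" where
  "coeff_part p F = (\<lambda>i. parity_part (Suc p) (F i))"

lemma vf_apply: "vf n F u = (\<Sum>i=1..n. gmult (F i) (gderiv i u))"
  by (simp add: vf_def sum_apply fD_def)

lemma vf_cong: "(\<And>i. i \<in> {1..n} \<Longrightarrow> F i = G i) \<Longrightarrow> vf n F = vf n G"
  unfolding vf_def by (rule sum.cong) auto

lemma op_scale_apply: "op_scale c X u = gscale c (X u)"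
  by (simp add: op_scale_def gscale_def)

lemma vf_coeff_linear:
  "vf n (\<lambda>i. F i + G i) = vf n F + vf n G"
  "vf n (\<lambda>i. F i - G i) = vf n F - vf n G"
  "vf n (\<lambda>i. gscale c (F i)) = op_scale c (vf n F)"
  "vf n (\<lambda>i. 0) = 0"
  by (auto simp: fun_eq_iff[of "vf n _"] vf_apply op_scale_apply gmult_linear sum.distrib
      sum_subtractf gscale_sum)

lemma vf_zero: "vf n 0 = 0"
  using vf_coeff_linear(4)[of n] by (simp add: zero_fun_def[symmetric])

lemma vf_coeff_sum: "vf n (\<lambda>i. \<Sum>a\<in>A. F a i) = (\<Sum>a\<in>A. vf n (F a))"
proof
  fix u
  have "vf n (\<lambda>i. \<Sum>a\<in>A. F a i) u = (\<Sum>i=1..n. \<Sum>a\<in>A. gmult (F a i) (gderiv i u))"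
    by (simp only: vf_apply gmult_sum)
  also have "\<dots> = (\<Sum>a\<in>A. \<Sum>i=1..n. gmult (F a i) (gderiv i u))"
    by (rule sum.swap)
  finally show "vf n (\<lambda>i. \<Sum>a\<in>A. F a i) u = (\<Sum>a\<in>A. vf n (F a)) u"
    by (simp only: sum_apply vf_apply)
qed

lemma vf_arg_linear:
  "vf n F (u + v) = vf n F u + vf n F v"
  "vf n F (u - v) = vf n F u - vf n F v"
  "vf n F (gscale c u) = gscale c (vf n F u)"
  "vf n F 0 = 0"
  by (simp_all add: vf_apply gmult_linear gderiv_linear sum.distrib sum_subtractf gscale_sum)

lemma vf_arg_sum: "vf n F (\<Sum>a\<in>A. u a) = (\<Sum>a\<in>A. vf n F (u a))"
  using additive.sum[of "vf n F" u A] by (simp add: additive_def vf_arg_linear)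

lemma parity_part_linear:
  "parity_part p (f + g) = parity_part p f + parity_part p g"
  "parity_part p (gscale c f) = gscale c (parity_part p f)"
  "parity_part p 0 = 0"
  by (auto simp: fun_eq_iff parity_part_def gscale_def)

lemma parity_part_sum: "parity_part p (\<Sum>a\<in>A. u a) = (\<Sum>a\<in>A. parity_part p (u a))"
  using additive.sum[of "parity_part p" u A] by (simp add: additive_def parity_part_linear)

lemma parity_part_cong: "even (p + q) \<Longrightarrow> parity_part p f = parity_part q f"
  by (auto simp: parity_part_def fun_eq_iff)

lemma parity_part_sum_both: "parity_part (Suc 0) f + parity_part 0 f = f"
  by (auto simp: parity_part_def fun_eq_iff)

lemma has_parity_parity_part [intro]: "has_parity p (parity_part p f)"
  by (auto simp: has_parity_def parity_part_def)

lemma has_parity_cong: "even (a + b) \<Longrightarrow> has_parity a f \<Longrightarrow> has_parity b f"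
  unfolding has_parity_def by (metis even_add)

lemma has_parity_linear:
  "has_parity a 0" "has_parity a f \<Longrightarrow> has_parity a g \<Longrightarrow> has_parity a (f + g)" "has_parity a f \<Longrightarrow> has_parity a (gscale c f)"
proof -
  show "has_parity a (f + g)" if "has_parity a f" "has_parity a g"
    unfolding has_parity_def
  proof (intro allI impI)
    fix I assume "(f + g) I \<noteq> 0"
    hence "f I \<noteq> 0 \<or> g I \<noteq> 0" by auto
    thus "even (card I + a)" using that unfolding has_parity_def by blast
  qed
qed (auto simp: has_parity_def gscale_def)

lemma has_parity_sum: "(\<And>i. i \<in> A \<Longrightarrow> has_parity a (f i)) \<Longrightarrow> has_parity a (\<Sum>i\<in>A. f i)"
  unfolding has_parity_def sum_apply by (blast elim: sum.not_neutral_contains_not_neutral)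

lemma has_parity_gderiv: "has_parity a f \<Longrightarrow> finite I \<Longrightarrow> gderiv i f I \<noteq> 0 \<Longrightarrow> even (card I + Suc a)"
  unfolding has_parity_def gderiv_def by (auto split: if_splits)

lemma has_parity_gmult:
  assumes "has_parity a f" "has_parity b g"
  shows "has_parity (a + b) (gmult f g)"
  unfolding has_parity_def
proof (intro allI impI)
  fix K assume nz: "gmult f g K \<noteq> 0"
  hence K: "finite K" using gmult_infinite by blast
  obtain I where I: "I \<subseteq> K" "f I \<noteq> 0" "g (K - I) \<noteq> 0"
    using nz unfolding gmult_def by (metis (no_types, lifting) PowD mult_eq_0_iff sum.neutral)
  hence "even (card I + a)" "even (card (K - I) + b)" using assms by (auto simp: has_parity_def)
  moreover have "card K = card I + card (K - I)"
    using I K by (simp add: card_Diff_subset card_mono finite_subset)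
  ultimately show "even (card K + (a + b))" by presburger
qed

lemma parity_part_gmult:
  "parity_part r (gmult f (parity_part s g)) = gmult (parity_part (r + s) f) (parity_part s g)"
proof
  fix K
  show "parity_part r (gmult f (parity_part s g)) K = gmult (parity_part (r + s) f) (parity_part s g) K"
  proof (cases "finite K")
    case True
    have "(if even (card K + r) then f I * parity_part s g (K - I) else 0) =
        parity_part (r + s) f I * parity_part s g (K - I)" if "I \<in> Pow K" for I
    proof -
      have "card K = card I + card (K - I)"
        using that True by (simp add: card_Diff_subset card_mono finite_subset)
      thus ?thesis by (auto simp: parity_part_def)
    qed
    thus ?thesis
      unfolding gmult_inv_sign parity_part_def[of r]
      by (cases "even (card K + r)") (auto simp: mult.assoc intro!: sum.cong sum.neutral)
  qed (simp add: gmult_infinite parity_part_def)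
qed

lemma gmult_gderiv_parity_part:
  "gmult f (gderiv i (parity_part q u)) = gmult f (parity_part (Suc q) (gderiv i u))"
  by (rule gmult_cong) (auto simp: gderiv_def parity_part_def)

lemma op_part_vf: "op_part p (vf n F) = vf n (coeff_part p F)"
proof
  fix u
  have "parity_part (p + q) (vf n F (parity_part q u)) =
      (\<Sum>i=1..n. gmult (parity_part (Suc p) (F i)) (parity_part (Suc q) (gderiv i u)))" for q
  proof -
    have "parity_part (p + q + Suc q) (F i) = parity_part (Suc p) (F i)" for i
      by (rule parity_part_cong) auto
    thus ?thesis
      by (simp only: vf_apply parity_part_sum gmult_gderiv_parity_part parity_part_gmult)
  qed
  hence "op_part p (vf n F) u = (\<Sum>q\<in>{0,1}. \<Sum>i=1..n.
      gmult (parity_part (Suc p) (F i)) (parity_part (Suc q) (gderiv i u)))"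
    by (simp only: op_part_def)
  also have "\<dots> = (\<Sum>i=1..n. \<Sum>q\<in>{0,1}.
      gmult (parity_part (Suc p) (F i)) (parity_part (Suc q) (gderiv i u)))"
    by (rule sum.swap)
  also have "\<dots> = (\<Sum>i=1..n. gmult (parity_part (Suc p) (F i))
      (parity_part (Suc 0) (gderiv i u) + parity_part (Suc (Suc 0)) (gderiv i u)))"
    by (simp add: gmult_linear)
  also have "\<dots> = vf n (coeff_part p F) u"
    by (simp add: vf_apply coeff_part_def parity_part_cong[of "Suc (Suc 0)" 0] parity_part_sum_both)
  finally show "op_part p (vf n F) u = vf n (coeff_part p F) u" .
qed

text \<open>
  By the Leibniz rule, a composition of vector fields is a vector field plus a second-order part.
\<close>

lemma vf_comp:
  "vf n F (vf n G u) = vf n (\<lambda>j. vf n F (G j)) u +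
     (\<Sum>i=1..n. \<Sum>j=1..n. gmult (gmult (F i) (parity_sign (G j))) (gderiv i (gderiv j u)))"
proof -
  have "vf n F (vf n G u) = (\<Sum>i=1..n. \<Sum>j=1..n. gmult (gmult (F i) (gderiv i (G j))) (gderiv j u)) +
     (\<Sum>i=1..n. \<Sum>j=1..n. gmult (gmult (F i) (parity_sign (G j))) (gderiv i (gderiv j u)))"
    by (simp add: vf_apply gderiv_sum gmult_sum gderiv_gmult gmult_linear gmult_assoc sum.distrib)
  also have "(\<Sum>i=1..n. \<Sum>j=1..n. gmult (gmult (F i) (gderiv i (G j))) (gderiv j u)) =
     (\<Sum>j=1..n. \<Sum>i=1..n. gmult (gmult (F i) (gderiv i (G j))) (gderiv j u))"
    by (rule sum.swap)
  also have "\<dots> = vf n (\<lambda>j. vf n F (G j)) u"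
    by (simp add: vf_apply gmult_sum)
  finally show ?thesis .
qed

definition vf_bracket ::
  "nat \<Rightarrow> nat \<Rightarrow> nat \<Rightarrow> (nat \<Rightarrow> grass) \<Rightarrow> (nat \<Rightarrow> grass) \<Rightarrow> nat \<Rightarrow> grass" where
  "vf_bracket n p q F G k = vf n F (G k) - gscale ((-1) ^ (p * q)) (vf n G (F k))"

definition has_parity_vf :: "nat \<Rightarrow> nat \<Rightarrow> (nat \<Rightarrow> grass) \<Rightarrow> bool" where
  "has_parity_vf n p F \<longleftrightarrow> (\<forall>i\<in>{1..n}. has_parity (Suc p) (F i))"

text \<open>
  The second-order parts of the two compositions cancel, because the \<open>D\<^sub>i\<close> anticommute and the
  coefficients supercommute. Thus the bracket is of first order.
\<close>

lemma vf_bracket_has_parity: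
  assumes F: "has_parity_vf n p F" and G: "has_parity_vf n q G"
  shows "vf n F (vf n G u) - gscale ((-1) ^ (p * q)) (vf n G (vf n F u)) =
    vf n (vf_bracket n p q F G) u"
proof -
  let ?R = "\<lambda>F G. \<Sum>i=1..n. \<Sum>j=1..n. gmult (gmult (F i) (parity_sign (G j))) (gderiv i (gderiv j u))"
  have "?R F G = (\<Sum>j=1..n. \<Sum>i=1..n. gmult (gmult (F i) (parity_sign (G j))) (gderiv i (gderiv j u)))"
    by (rule sum.swap)
  also have "\<dots> = (\<Sum>j=1..n. \<Sum>i=1..n.
      gscale ((-1) ^ (p * q)) (gmult (gmult (G j) (parity_sign (F i))) (gderiv j (gderiv i u))))"
  proof (intro sum.cong refl)
    fix i j assume ij: "i \<in> {1..n}" "j \<in> {1..n}"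
    hence h: "has_parity (Suc p) (F i)" "has_parity (Suc q) (G j)" using F G by (auto simp: has_parity_vf_def)
    have sG: "parity_sign (G j) = gscale ((-1) ^ Suc q) (G j)" and
      sF: "F i = gscale ((-1) ^ Suc p) (parity_sign (F i))"
      by (simp_all only: parity_sign_has_parity[OF h(1)] parity_sign_has_parity[OF h(2)] gscale_linear
          flip: power_add) (simp add: gscale_linear)
    have com: "gmult (F i) (G j) = gscale ((-1) ^ (Suc q * Suc p)) (gmult (G j) (F i))"
      by (rule gmult_supercommute[OF h(2,1)])
    have anti: "gderiv i (gderiv j u) = gscale (-1) (gderiv j (gderiv i u))"
      using gderiv_anticommute[of i j u] by (simp add: gscale_def fun_eq_iff)
    have "gmult (gmult (F i) (parity_sign (G j))) (gderiv i (gderiv j u)) =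
        gscale ((-1) ^ Suc q * ((-1) ^ (Suc q * Suc p) * (-1)))
          (gmult (gmult (G j) (F i)) (gderiv j (gderiv i u)))"
      unfolding sG com anti gmult_linear gscale_linear by (simp only: mult_ac)
    also have "gmult (G j) (F i) = gscale ((-1) ^ Suc p) (gmult (G j) (parity_sign (F i)))"
      by (subst sF) (simp only: gmult_linear)
    finally have "gmult (gmult (F i) (parity_sign (G j))) (gderiv i (gderiv j u)) =
      gscale ((-1) ^ Suc q * ((-1) ^ (Suc q * Suc p) * (-1)) * (-1) ^ Suc p)
        (gmult (gmult (G j) (parity_sign (F i))) (gderiv j (gderiv i u)))"
      unfolding gmult_linear gscale_linear .
    also have "(-1) ^ Suc q * ((-1) ^ (Suc q * Suc p) * (-1)) * (-1) ^ Suc p = ((-1::complex) ^ (p * q))"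
      by (cases "even p"; cases "even q") (auto simp: minus_one_power_iff)
    finally show "gmult (gmult (F i) (parity_sign (G j))) (gderiv i (gderiv j u)) =
      gscale ((-1) ^ (p * q)) (gmult (gmult (G j) (parity_sign (F i))) (gderiv j (gderiv i u)))" .
  qed
  also have "\<dots> = gscale ((-1) ^ (p * q)) (?R G F)"
    by (simp add: gscale_sum)
  finally have R: "?R F G = gscale ((-1) ^ (p * q)) (?R G F)" .
  have "vf n (vf_bracket n p q F G) = vf n (\<lambda>k. vf n F (G k)) - op_scale ((-1) ^ (p * q)) (vf n (\<lambda>k. vf n G (F k)))"
    unfolding vf_bracket_def vf_coeff_linear ..
  thus ?thesis
    unfolding vf_comp R by (simp add: gscale_linear op_scale_apply)
qed

lemma has_parity_coeff_part: "has_parity_vf n p (coeff_part p F)"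
  by (auto simp: has_parity_vf_def coeff_part_def)

lemma superbracket_vf:
  "superbracket (vf n F) (vf n G) =
     vf n (\<lambda>k. \<Sum>p\<in>{0,1}. \<Sum>q\<in>{0,1}. vf_bracket n p q (coeff_part p F) (coeff_part q G) k)"
proof -
  have "(vf n (coeff_part p F) \<circ> vf n (coeff_part q G)) -
      op_scale ((-1) ^ (p * q)) (vf n (coeff_part q G) \<circ> vf n (coeff_part p F)) =
    vf n (vf_bracket n p q (coeff_part p F) (coeff_part q G))" for p q
  proof
    fix u
    show "((vf n (coeff_part p F) \<circ> vf n (coeff_part q G)) -
        op_scale ((-1) ^ (p * q)) (vf n (coeff_part q G) \<circ> vf n (coeff_part p F))) u =
      vf n (vf_bracket n p q (coeff_part p F) (coeff_part q G)) u"
      using vf_bracket_has_parity[OF has_parity_coeff_part has_parity_coeff_part, of n p F q G u]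
      by (simp add: op_scale_apply)
  qed
  hence "superbracket (vf n F) (vf n G) =
    (\<Sum>p\<in>{0,1}. \<Sum>q\<in>{0,1}. vf n (vf_bracket n p q (coeff_part p F) (coeff_part q G)))"
    unfolding superbracket_def op_part_vf by (simp only:)
  thus ?thesis by (simp only: vf_coeff_sum)
qed

lemma Lambda_linear:
  "0 \<in> Lambda n" "f \<in> Lambda n \<Longrightarrow> g \<in> Lambda n \<Longrightarrow> f + g \<in> Lambda n"
  "f \<in> Lambda n \<Longrightarrow> g \<in> Lambda n \<Longrightarrow> f - g \<in> Lambda n"
  "f \<in> Lambda n \<Longrightarrow> gscale c f \<in> Lambda n"
  "f \<in> Lambda n \<Longrightarrow> parity_sign f \<in> Lambda n"
  "f \<in> Lambda n \<Longrightarrow> parity_part p f \<in> Lambda n"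
  by (auto simp: Lambda_def gscale_def parity_sign_def parity_part_def) (metis add_0 subsetD atLeastAtMost_iff)+

lemma Lambda_sum: "(\<And>i. i \<in> A \<Longrightarrow> f i \<in> Lambda n) \<Longrightarrow> (\<Sum>i\<in>A. f i) \<in> Lambda n"
  unfolding Lambda_def mem_Collect_eq sum_apply by (blast elim: sum.not_neutral_contains_not_neutral)

lemma Lambda_gderiv: "f \<in> Lambda n \<Longrightarrow> gderiv i f \<in> Lambda n"
  by (auto simp: Lambda_def gderiv_def split: if_splits)

lemma Lambda_gmult:
  assumes "f \<in> Lambda n" "g \<in> Lambda n"
  shows "gmult f g \<in> Lambda n"
  unfolding Lambda_def mem_Collect_eq
proof (intro allI impI)
  fix K assume "gmult f g K \<noteq> 0"
  then obtain I where I: "I \<subseteq> K" "f I \<noteq> 0" "g (K - I) \<noteq> 0"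
    unfolding gmult_def by (metis (no_types, lifting) PowD mult_eq_0_iff sum.neutral)
  hence "I \<subseteq> {1..n}" "K - I \<subseteq> {1..n}" using assms by (auto simp: Lambda_def)
  thus "K \<subseteq> {1..n}" by blast
qed

lemma Lambda_finite: "f \<in> Lambda n \<Longrightarrow> f I \<noteq> 0 \<Longrightarrow> finite I"
  unfolding Lambda_def by (metis (mono_tags, lifting) finite_atLeastAtMost finite_subset mem_Collect_eq)

definition coeffs :: "nat \<Rightarrow> (nat \<Rightarrow> grass) set" where
  "coeffs n = {F. \<forall>i\<in>{1..n}. F i \<in> Lambda n}"

lemma coeffsD: "F \<in> coeffs n \<Longrightarrow> i \<in> {1..n} \<Longrightarrow> F i \<in> Lambda n"
  by (auto simp: coeffs_def)

lemma coeffsI: "(\<And>i. i \<in> {1..n} \<Longrightarrow> F i \<in> Lambda n) \<Longrightarrow> F \<in> coeffs n"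
  by (auto simp: coeffs_def)

lemma Lambda_vf: "F \<in> coeffs n \<Longrightarrow> u \<in> Lambda n \<Longrightarrow> vf n F u \<in> Lambda n"
  unfolding vf_apply by (intro Lambda_sum Lambda_gmult Lambda_gderiv) (auto simp: coeffs_def)

lemma coeffs_part: "F \<in> coeffs n \<Longrightarrow> coeff_part p F \<in> coeffs n"
  by (auto simp: coeffs_def coeff_part_def intro: Lambda_linear)

lemma coeffs_bracket: "F \<in> coeffs n \<Longrightarrow> G \<in> coeffs n \<Longrightarrow> vf_bracket n p q F G \<in> coeffs n"
  by (auto simp: coeffs_def vf_bracket_def intro!: Lambda_linear Lambda_vf)

text \<open>
  The coefficients of a vector field are its values at the generators, hence are determined by it.
\<close>

lemma vf_xi:
  assumes F: "F \<in> coeffs n" and j: "j \<in> {1..n}"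
  shows "vf n F (xi j) = F j"
proof
  fix K
  have d: "gderiv i (xi j) I = (if i = j \<and> I = {} then 1 else 0)" for i I
    by (auto simp: gderiv_def xi_def)
  have m: "gmult f (gderiv i (xi j)) K = (if i = j then f K else 0)" if f: "f \<in> Lambda n" for i f
  proof (cases "finite K")
    case True
    have "gmult f (gderiv i (xi j)) K =
        (\<Sum>I\<in>Pow K. if I = K then (if i = j then f K else 0) else 0)"
      unfolding gmult_inv_sign by (rule sum.cong) (auto simp: d)
    thus ?thesis using True by (simp add: sum.delta)
  qed (use f Lambda_finite[OF f, of K] in \<open>auto simp: gmult_infinite\<close>)
  have "vf n F (xi j) K = (\<Sum>i=1..n. if i = j then F i K else 0)"
    unfolding vf_apply sum_apply by (rule sum.cong) (use F in \<open>auto simp: m coeffs_def\<close>)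
  thus "vf n F (xi j) K = F j K" using j by (simp add: sum.delta)
qed

lemma vf_inj: "F \<in> coeffs n \<Longrightarrow> G \<in> coeffs n \<Longrightarrow> vf n F = vf n G \<Longrightarrow> i \<in> {1..n} \<Longrightarrow> F i = G i"
  by (metis vf_xi)

lemma W_alg_vf: "W_alg n = vf n ` coeffs n"
  by (auto simp: W_alg_def vf_def coeffs_def)

section \<open>Diagonal vector fields\<close>

definition diag :: "nat \<Rightarrow> (nat \<Rightarrow> complex) \<Rightarrow> oper" where
  "diag n c = vf n (\<lambda>i. gscale (c i) (xi i))"

text \<open>
  The eigenvalue of \<open>\<Sum>i. c\<^sub>i \<xi>\<^sub>i D\<^sub>i\<close> on \<open>\<xi>\<^sub>I D\<^sub>k\<close>.
\<close>

definition wt :: "(nat \<Rightarrow> complex) \<Rightarrow> nat \<Rightarrow> nat set \<Rightarrow> complex" where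
  "wt c k I = (\<Sum>a\<in>I. c a) - c k"

definition wscale :: "(nat set \<Rightarrow> complex) \<Rightarrow> grass \<Rightarrow> grass" where
  "wscale w f = (\<lambda>I. w I * f I)"

lemma xi_in_Lambda: "i \<in> {1..n} \<Longrightarrow> xi i \<in> Lambda n"
  by (auto simp: xi_def Lambda_def)

lemma diag_coeffs: "(\<lambda>i. gscale (c i) (xi i)) \<in> coeffs n"
  by (auto simp: coeffs_def intro!: Lambda_linear xi_in_Lambda)

lemma Lambda_wscale: "f \<in> Lambda n \<Longrightarrow> wscale w f \<in> Lambda n"
  by (auto simp: Lambda_def wscale_def)

lemma gmult_xi_gderiv: "gmult (xi i) (gderiv i u) K = (if i \<in> K \<and> finite K then u K else 0)"
proof (cases "finite K")
  case True
  have "gmult (xi i) (gderiv i u) K =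
      (\<Sum>I\<in>Pow K. if I = {i} then inv_sign {i} (K - {i}) * gderiv i u (K - {i}) else 0)"
    unfolding gmult_inv_sign by (rule sum.cong) (auto simp: xi_def)
  also have "\<dots> = (if i \<in> K then inv_sign {i} (K - {i}) * gderiv i u (K - {i}) else 0)"
    using True by (simp add: sum.delta)
  also have "\<dots> = (if i \<in> K then u K else 0)"
    by (auto simp: gderiv_inv_sign insert_absorb simp flip: mult.assoc)
  finally show ?thesis using True by simp
qed (simp add: gmult_infinite)

lemma diag_apply:
  assumes "u \<in> Lambda n"
  shows "diag n c u = wscale (\<lambda>I. \<Sum>a\<in>I. c a) u"
proof
  fix K
  have "diag n c u = (\<Sum>i=1..n. gscale (c i) (gmult (xi i) (gderiv i u)))"
    by (simp only: diag_def vf_apply gmult_linear)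
  hence "diag n c u K = (\<Sum>i=1..n. c i * gmult (xi i) (gderiv i u) K)"
    by (simp add: sum_apply gscale_def)
  also have "\<dots> = (\<Sum>i=1..n. if i \<in> K \<and> finite K then c i * u K else 0)"
    by (simp add: gmult_xi_gderiv if_distrib cong: if_cong)
  also have "\<dots> = (\<Sum>a\<in>K. c a) * u K"
  proof (cases "u K = 0")
    case False
    hence K: "K \<subseteq> {1..n}" "finite K" using assms Lambda_finite by (auto simp: Lambda_def)
    have "(\<Sum>i=1..n. if i \<in> K \<and> finite K then c i * u K else 0) = (\<Sum>i\<in>{1..n} \<inter> K. c i * u K)"
      using K by (simp add: sum.inter_restrict)
    also have "{1..n} \<inter> K = K" using K by auto
    finally show ?thesis by (simp add: sum_distrib_right)
  qed (auto intro: sum.neutral)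
  finally show "diag n c u K = wscale (\<lambda>I. \<Sum>a\<in>I. c a) u K" by (simp add: wscale_def)
qed

lemma parity_part_xi: "parity_part p (xi i) = (if odd p then xi i else 0)"
  by (auto simp: parity_part_def xi_def fun_eq_iff)

lemma coeff_part_diag:
  "coeff_part p (\<lambda>i. gscale (c i) (xi i)) = (if even p then (\<lambda>i. gscale (c i) (xi i)) else 0)"
  by (auto simp: coeff_part_def parity_part_linear parity_part_xi gscale_linear fun_eq_iff)

lemma coeff_part_both: "coeff_part 0 G k + coeff_part (Suc 0) G k = G k"
  using parity_part_sum_both[of "G k"] parity_part_cong[of "Suc (Suc 0)" 0 "G k"]
  by (simp add: coeff_part_def)

lemma vf_bracket_zero: "vf_bracket n p q 0 G k = 0" "vf_bracket n p q G 0 k = 0"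
  using vf_coeff_linear(4)[of n]
  by (auto simp: vf_bracket_def vf_arg_linear gscale_linear zero_fun_def[symmetric])

text \<open>
  A diagonal field is even, so its superbracket with any field is a commutator, which multiplies
  each monomial by its weight.
\<close>

lemma
  assumes G: "G \<in> coeffs n"
  shows superbracket_diag_left:
      "superbracket (diag n c) (vf n G) = vf n (\<lambda>k. wscale (wt c k) (G k))"
    and superbracket_diag_right:
      "superbracket (vf n G) (diag n c) = - vf n (\<lambda>k. wscale (wt c k) (G k))"
proof -
  let ?X = "\<lambda>i. gscale (c i) (xi i)"
  have act: "vf n ?X (coeff_part q G k) - vf n (coeff_part q G) (gscale (c k) (xi k)) =
      wscale (wt c k) (coeff_part q G k)" if k: "k \<in> {1..n}" for q k
  proof -
    have Gq: "coeff_part q G \<in> coeffs n" by (rule coeffs_part[OF G])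
    have "vf n ?X (coeff_part q G k) = wscale (\<lambda>I. \<Sum>a\<in>I. c a) (coeff_part q G k)"
      using diag_apply[OF coeffsD[OF Gq k], of c] by (simp add: diag_def)
    moreover have "vf n (coeff_part q G) (gscale (c k) (xi k)) = gscale (c k) (coeff_part q G k)"
      by (simp add: vf_arg_linear vf_xi[OF Gq k])
    ultimately show ?thesis by (simp add: wscale_def wt_def gscale_def fun_eq_iff algebra_simps)
  qed
  have both: "wscale w (coeff_part 0 G k) + wscale w (coeff_part (Suc 0) G k) = wscale w (G k)" for w k
    by (subst (3) coeff_part_both[symmetric]) (simp add: wscale_def fun_eq_iff algebra_simps)
  have l: "vf_bracket n 0 q ?X (coeff_part q G) k = wscale (wt c k) (coeff_part q G k)"
    if "k \<in> {1..n}" for q k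
    using act[OF that] by (simp add: vf_bracket_def gscale_linear)
  have r: "vf_bracket n q 0 (coeff_part q G) ?X k = - wscale (wt c k) (coeff_part q G k)"
    if "k \<in> {1..n}" for q k
    using act[OF that, of q, symmetric] by (simp add: vf_bracket_def gscale_linear)
  show "superbracket (diag n c) (vf n G) = vf n (\<lambda>k. wscale (wt c k) (G k))"
    unfolding diag_def superbracket_vf
    by (rule vf_cong) (simp add: coeff_part_diag vf_bracket_zero l both)
  have "superbracket (vf n G) (diag n c) = vf n (\<lambda>k. 0 - wscale (wt c k) (G k))"
    unfolding diag_def superbracket_vf
    by (rule vf_cong) (simp add: coeff_part_diag vf_bracket_zero r both[symmetric])
  thus "superbracket (vf n G) (diag n c) = - vf n (\<lambda>k. wscale (wt c k) (G k))"
    by (simp only: vf_coeff_linear) simp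
qed

section \<open>Divergence\<close>

definition divergence :: "nat \<Rightarrow> (nat \<Rightarrow> grass) \<Rightarrow> grass" where
  "divergence n F = (\<Sum>i=1..n. gderiv i (F i))"

lemma has_parity_gderiv_Lambda:
  assumes "f \<in> Lambda n" "has_parity a f"
  shows "has_parity (Suc a) (gderiv i f)"
  unfolding has_parity_def
proof (intro allI impI)
  fix I assume nz: "gderiv i f I \<noteq> 0"
  thus "even (card I + Suc a)"
    using has_parity_gderiv[OF assms(2) Lambda_finite[OF Lambda_gderiv[OF assms(1)] nz] nz] by simp
qed

lemma gderiv_parity_part:
  assumes "f \<in> Lambda n"
  shows "gderiv i (parity_part p f) = parity_part (Suc p) (gderiv i f)"
proof
  fix I
  show "gderiv i (parity_part p f) I = parity_part (Suc p) (gderiv i f) I"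
  proof (cases "finite I")
    case False
    hence "f (insert i I) = 0" using Lambda_finite[OF assms, of "insert i I"] by auto
    thus ?thesis by (simp add: gderiv_def parity_part_def)
  qed (auto simp: gderiv_def parity_part_def)
qed

lemma divergence_coeff_part:
  assumes "F \<in> coeffs n"
  shows "divergence n (coeff_part p F) = parity_part p (divergence n F)"
proof -
  have "gderiv i (coeff_part p F i) = parity_part p (gderiv i (F i))" if "i \<in> {1..n}" for i
    using gderiv_parity_part[OF coeffsD[OF assms that], of i "Suc p"]
    by (simp add: coeff_part_def parity_part_cong[of "Suc (Suc p)" p])
  thus ?thesis by (simp add: divergence_def parity_part_sum)
qed

lemma gderiv_vf:
  assumes F: "has_parity_vf n p F"
  shows "gderiv k (vf n F u) = (\<Sum>i=1..n. gmult (gderiv k (F i)) (gderiv i u)) +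
     gscale ((-1) ^ p) (vf n F (gderiv k u))"
proof -
  have "gderiv k (gmult (F i) (gderiv i u)) = gmult (gderiv k (F i)) (gderiv i u) +
      gscale ((-1) ^ p) (gmult (F i) (gderiv i (gderiv k u)))" if "i \<in> {1..n}" for i
  proof -
    have h: "has_parity (Suc p) (F i)" using F that by (auto simp: has_parity_vf_def)
    have "gderiv k (gderiv i u) = gscale (-1) (gderiv i (gderiv k u))"
      using gderiv_anticommute[of k i u] by (simp add: gscale_def fun_eq_iff)
    thus ?thesis by (simp add: gderiv_gmult parity_sign_has_parity[OF h] gmult_linear gscale_linear)
  qed
  thus ?thesis by (simp add: vf_apply gderiv_sum sum.distrib gscale_sum)
qed

text \<open>
  In the divergence of \<open>[X, Y]\<close> the terms \<open>D\<^sub>k(F\<^sub>i) D\<^sub>i(G\<^sub>k)\<close> that come from \<open>XY\<close> and from \<open>YX\<close>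
  cancel by supercommutativity. What remains, up to signs, is \<open>X\<close> applied to the divergence of \<open>Y\<close> and vice versa, so
  that divergence-free fields are closed under the bracket.
\<close>

lemma divergence_bracket:
  assumes F: "F \<in> coeffs n" "has_parity_vf n p F" and G: "G \<in> coeffs n" "has_parity_vf n q G"
  shows "divergence n (vf_bracket n p q F G) =
    gscale ((-1) ^ p) (vf n F (divergence n G)) - gscale ((-1) ^ (p * q + q)) (vf n G (divergence n F))"
proof -
  let ?C = "\<lambda>F G. \<Sum>k=1..n. \<Sum>i=1..n. gmult (gderiv k (F i)) (gderiv i (G k))"
  have "?C G F = (\<Sum>i=1..n. \<Sum>k=1..n. gmult (gderiv k (G i)) (gderiv i (F k)))"
    by (rule sum.swap)
  also have "\<dots> = (\<Sum>i=1..n. \<Sum>k=1..n. gscale ((-1) ^ (p * q)) (gmult (gderiv i (F k)) (gderiv k (G i))))"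
  proof (intro sum.cong refl)
    fix i k assume ik: "i \<in> {1..n}" "k \<in> {1..n}"
    have "has_parity (Suc (Suc p)) (gderiv i (F k))" "has_parity (Suc (Suc q)) (gderiv k (G i))"
      using ik F G by (auto intro!: has_parity_gderiv_Lambda[of _ n] simp: coeffs_def has_parity_vf_def)
    hence "has_parity p (gderiv i (F k))" "has_parity q (gderiv k (G i))"
      by (auto intro: has_parity_cong[of "Suc (Suc p)"] has_parity_cong[of "Suc (Suc q)"])
    thus "gmult (gderiv k (G i)) (gderiv i (F k)) =
        gscale ((-1) ^ (p * q)) (gmult (gderiv i (F k)) (gderiv k (G i)))"
      by (rule gmult_supercommute)
  qed
  also have "\<dots> = gscale ((-1) ^ (p * q)) (?C F G)"
    by (simp add: gscale_sum)
  finally have C: "?C G F = gscale ((-1) ^ (p * q)) (?C F G)" .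
  have d: "(\<Sum>k=1..n. gderiv k (vf n F (G k))) = ?C F G + gscale ((-1) ^ p) (vf n F (divergence n G))"
    if "has_parity_vf n p F" for p F G
    by (simp add: gderiv_vf[OF that] sum.distrib divergence_def vf_arg_sum gscale_sum)
  have "divergence n (vf_bracket n p q F G) =
     (\<Sum>k=1..n. gderiv k (vf n F (G k))) - gscale ((-1) ^ (p * q)) (\<Sum>k=1..n. gderiv k (vf n G (F k)))"
    by (simp add: divergence_def vf_bracket_def gderiv_linear sum_subtractf gscale_sum)
  also have "\<dots> = ?C F G + gscale ((-1) ^ p) (vf n F (divergence n G)) -
      gscale ((-1) ^ (p * q)) (gscale ((-1) ^ (p * q)) (?C F G) + gscale ((-1) ^ q) (vf n G (divergence n F)))"
    unfolding d[OF F(2)] d[OF G(2)] C ..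
  also have "\<dots> = gscale ((-1) ^ p) (vf n F (divergence n G)) - gscale ((-1) ^ (p * q + q)) (vf n G (divergence n F))"
    by (simp add: gscale_linear power_add flip: power_mult_distrib)
  finally show ?thesis .
qed

lemma S_alg_vf: "S_alg n = {vf n F |F. F \<in> coeffs n \<and> divergence n F = 0}"
  by (auto simp: S_alg_def vf_def coeffs_def divergence_def)

section \<open>Hamiltonian vector fields\<close>

lemma conj_index_range: "i \<in> {1..n} \<Longrightarrow> conj_index n i \<in> {1..n}"
  by (auto simp: conj_index_def Let_def)

lemma conj_index_invol: "i \<in> {1..n} \<Longrightarrow> conj_index n (conj_index n i) = i"
  by (auto simp: conj_index_def Let_def)

lemma sum_conj_index: "(\<Sum>i=1..n. f (conj_index n i)) = (\<Sum>i=1..n. f i)"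
  by (rule sum.reindex_bij_witness[where i="conj_index n" and j="conj_index n"])
    (use conj_index_range conj_index_invol in auto)

text \<open>
  The coefficients of \<open>D\<^sub>H(f)\<close>, indexed by the derivation \<open>D\<^sub>k\<close> that they multiply.
\<close>

definition hfield :: "nat \<Rightarrow> grass \<Rightarrow> nat \<Rightarrow> grass" where
  "hfield n f k = gderiv (conj_index n k) (parity_sign f)"

lemma D_H_vf: "D_H n f = vf n (hfield n f)"
proof -
  have "D_H n f = (\<Sum>k=1..n. fD (gderiv (conj_index n k) (parity_sign f)) (conj_index n (conj_index n k)))"
    unfolding D_H_def by (rule sum_conj_index[symmetric])
  thus ?thesis by (simp add: vf_def hfield_def conj_index_invol)
qed

lemma hfield_coeffs: "f \<in> Lambda n \<Longrightarrow> hfield n f \<in> coeffs n"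
  by (auto simp: hfield_def coeffs_def intro: Lambda_gderiv Lambda_linear)

lemma coeff_part_hfield:
  assumes "f \<in> Lambda n"
  shows "coeff_part p (hfield n f) = hfield n (parity_part p f)"
proof
  fix k
  have "parity_sign (parity_part p f) = parity_part p (parity_sign f)"
    by (auto simp: parity_sign_def parity_part_def)
  thus "coeff_part p (hfield n f) k = hfield n (parity_part p f) k"
    using gderiv_parity_part[of "parity_sign f" n "conj_index n k" p] assms
    by (simp add: coeff_part_def hfield_def Lambda_linear)
qed

text \<open>
  Up to the sign \<open>(-1)\<^bsup>|f|\<^esup>\<close>, both the value of \<open>D\<^sub>H(f)\<close> at \<open>g\<close> and the function that generates
  \<open>[D\<^sub>H(f), D\<^sub>H(g)]\<close>.
\<close>

definition poisson :: "nat \<Rightarrow> grass \<Rightarrow> grass \<Rightarrow> grass" where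
  "poisson n f g = (\<Sum>i=1..n. gmult (gderiv (conj_index n i) f) (gderiv i g))"

lemma poisson_Lambda: "f \<in> Lambda n \<Longrightarrow> g \<in> Lambda n \<Longrightarrow> poisson n f g \<in> Lambda n"
  unfolding poisson_def by (intro Lambda_sum Lambda_gmult Lambda_gderiv)

lemma has_parity_poisson:
  assumes "f \<in> Lambda n" "g \<in> Lambda n" "has_parity a f" "has_parity b g"
  shows "has_parity (a + b) (poisson n f g)"
proof -
  have "has_parity (Suc a + Suc b) (poisson n f g)"
    unfolding poisson_def using assms by (intro has_parity_sum has_parity_gmult has_parity_gderiv_Lambda)
  thus ?thesis by (rule has_parity_cong[rotated]) simp
qed

lemma vf_hfield: "has_parity a f \<Longrightarrow> vf n (hfield n f) u = gscale ((-1) ^ a) (poisson n f u)"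
  by (simp add: vf_apply hfield_def poisson_def parity_sign_has_parity gderiv_linear gmult_linear gscale_sum)

text \<open>
  Derivations act on the Poisson bracket by a Leibniz rule: in the terms in which \<open>D\<^sub>m\<close> falls on the first
  factor, the summation index is replaced by its conjugate and the factors are exchanged.
\<close>

lemma gderiv_poisson:
  assumes f: "f \<in> Lambda n" "has_parity a f" and g: "g \<in> Lambda n" "has_parity b g"
  shows "gderiv m (poisson n f g) = gscale ((-1) ^ a)
    (poisson n f (gderiv m g) - gscale ((-1) ^ (a * b)) (poisson n g (gderiv m f)))"
proof -
  have anti: "gderiv i (gderiv j u) = gscale (-1) (gderiv j (gderiv i u))" for i j u
    using gderiv_anticommute[of i j u] by (simp add: gscale_def fun_eq_iff)
  have "gderiv m (poisson n f g) =
      (\<Sum>i=1..n. gmult (gderiv m (gderiv (conj_index n i) f)) (gderiv i g)) +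
      (\<Sum>i=1..n. gmult (parity_sign (gderiv (conj_index n i) f)) (gderiv m (gderiv i g)))"
    by (simp add: poisson_def gderiv_sum gderiv_gmult sum.distrib)
  also have "(\<Sum>i=1..n. gmult (parity_sign (gderiv (conj_index n i) f)) (gderiv m (gderiv i g))) =
      gscale ((-1) ^ a) (poisson n f (gderiv m g))"
  proof -
    have "gmult (parity_sign (gderiv i f)) (gderiv m (gderiv j g)) =
       gscale ((-1) ^ a) (gmult (gderiv i f) (gderiv j (gderiv m g)))" for i j
      by (subst anti) (simp add: parity_sign_has_parity[OF has_parity_gderiv_Lambda[OF f]] gmult_linear gscale_linear)
    thus ?thesis by (simp add: poisson_def gscale_sum)
  qed
  also have "(\<Sum>i=1..n. gmult (gderiv m (gderiv (conj_index n i) f)) (gderiv i g)) =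
      (\<Sum>i=1..n. gmult (gderiv m (gderiv (conj_index n (conj_index n i)) f)) (gderiv (conj_index n i) g))"
    by (rule sum_conj_index[symmetric])
  also have "\<dots> = (\<Sum>i=1..n. gmult (gderiv m (gderiv i f)) (gderiv (conj_index n i) g))"
    by (rule sum.cong) (simp_all add: conj_index_invol)
  also have "\<dots> = gscale (- ((-1) ^ a * (-1) ^ (a * b))) (poisson n g (gderiv m f))"
  proof -
    have "gmult (gderiv m (gderiv i f)) (gderiv j g) =
       gscale (- ((-1) ^ a * (-1) ^ (a * b))) (gmult (gderiv j g) (gderiv i (gderiv m f)))" for i j
    proof -
      have h: "has_parity (Suc (Suc a)) (gderiv i (gderiv m f))" "has_parity (Suc b) (gderiv j g)"
        using f g by (auto intro!: has_parity_gderiv_Lambda Lambda_gderiv)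
      have "gmult (gderiv i (gderiv m f)) (gderiv j g) =
          gscale ((-1) ^ (Suc b * Suc (Suc a))) (gmult (gderiv j g) (gderiv i (gderiv m f)))"
        by (rule gmult_supercommute[OF h(2,1)])
      moreover have "(-1) ^ (Suc b * Suc (Suc a)) = (-1::complex) ^ a * (-1) ^ (a * b)"
        by (cases "even a"; cases "even b") (auto simp: minus_one_power_iff)
      ultimately show ?thesis
        by (subst anti) (simp add: gmult_linear gscale_linear)
    qed
    thus ?thesis by (simp add: poisson_def gscale_sum)
  qed
  finally show ?thesis by (simp add: gscale_def fun_eq_iff algebra_simps)
qed

text \<open>
  By \<open>gderiv_poisson\<close>, both sides are \<open>\<plusminus>D\<^sub>m\<close> of the Poisson bracket.
\<close>

lemma hfield_bracket:
  assumes f: "f \<in> Lambda n" "has_parity a f" and g: "g \<in> Lambda n" "has_parity b g"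
  shows "vf_bracket n a b (hfield n f) (hfield n g) k = hfield n (gscale ((-1) ^ a) (poisson n f g)) k"
proof -
  let ?m = "conj_index n k"
  have h: "hfield n u k = gscale ((-1) ^ c) (gderiv ?m u)" if "has_parity c u" for u c
    by (simp add: hfield_def parity_sign_has_parity[OF that] gderiv_linear)
  have pl: "poisson n u (gscale c v) = gscale c (poisson n u v)" for u c v
    by (simp add: poisson_def gderiv_linear gmult_linear gscale_sum)
  have "vf_bracket n a b (hfield n f) (hfield n g) k = gscale ((-1) ^ a * (-1) ^ b)
     (poisson n f (gderiv ?m g) - gscale ((-1) ^ (a * b)) (poisson n g (gderiv ?m f)))"
    by (simp add: vf_bracket_def vf_hfield[OF f(2)] vf_hfield[OF g(2)] h[OF f(2)] h[OF g(2)] pl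
        gscale_linear mult_ac)
  also have "\<dots> = gscale ((-1) ^ b) (gderiv ?m (poisson n f g))"
    unfolding gderiv_poisson[OF f g] by (simp add: gscale_linear mult_ac)
  also have "\<dots> = hfield n (gscale ((-1) ^ a) (poisson n f g)) k"
  proof -
    have "has_parity (a + b) (gscale ((-1) ^ a) (poisson n f g))"
      by (intro has_parity_linear has_parity_poisson f g)
    moreover have "(-1) ^ (a + b) * (-1) ^ a = ((-1) ^ b :: complex)"
      by (cases "even a"; cases "even b") (auto simp: minus_one_power_iff)
    ultimately show ?thesis by (simp add: h gderiv_linear gscale_linear)
  qed
  finally show ?thesis .
qed

text \<open>
  The bracket of two functions has no component at \<open>\<xi>\<^sub>1 \<dots> \<xi>\<^sub>n\<close>: up to sign it is the sum of the
  total derivatives \<open>D\<^sub>i(D\<^bsub>i'\<^esub>(f) g)\<close>, since the sum \<open>S\<close> of the \<open>D\<^sub>i D\<^bsub>i'\<^esub>(f)\<close> vanishes.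
\<close>

lemma poisson_top:
  assumes f: "f \<in> Lambda n" "has_parity a f"
  shows "poisson n f g {1..n} = 0"
proof -
  define S where "S = (\<Sum>i=1..n. gderiv i (gderiv (conj_index n i) f))"
  have anti: "gderiv i (gderiv j u) = gscale (-1) (gderiv j (gderiv i u))" for i j u
    using gderiv_anticommute[of i j u] by (simp add: gscale_def fun_eq_iff)
  \<comment> \<open>Conjugating the index and anticommuting the two derivations shows \<open>S = - S\<close>.\<close>
  have "S = (\<Sum>i=1..n. gderiv (conj_index n i) (gderiv (conj_index n (conj_index n i)) f))"
    unfolding S_def by (rule sum_conj_index[symmetric])
  also have "\<dots> = (\<Sum>i=1..n. gderiv (conj_index n i) (gderiv i f))"
    by (rule sum.cong) (simp_all add: conj_index_invol)
  also have "\<dots> = gscale (-1) S"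
    unfolding S_def gscale_sum by (rule sum.cong[OF refl]) (rule anti)
  finally have S: "S = gscale (-1) S" .
  have "S I = - S I" for I
    by (rule trans[OF fun_cong[OF S]]) (simp add: gscale_def)
  hence S0: "S = 0" by (simp add: fun_eq_iff)
  have "(\<Sum>i=1..n. gderiv i (gmult (gderiv (conj_index n i) f) g)) =
      gmult S g + gscale ((-1) ^ Suc a) (poisson n f g)"
    by (simp only: gderiv_gmult parity_sign_has_parity[OF has_parity_gderiv_Lambda[OF f]] sum.distrib gmult_sum
        gmult_linear gscale_sum poisson_def S_def)
  hence "gscale ((-1) ^ Suc a) (poisson n f g) =
      (\<Sum>i=1..n. gderiv i (gmult (gderiv (conj_index n i) f) g))"
    unfolding S0 gmult_linear by simp
  hence "gscale ((-1) ^ Suc a) (poisson n f g) {1..n} =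
      (\<Sum>i=1..n. gderiv i (gmult (gderiv (conj_index n i) f) g) {1..n})"
    by (simp only: sum_apply)
  also have "\<dots> = 0" by (rule sum.neutral) (simp add: gderiv_def)
  finally show ?thesis by (simp add: gscale_def)
qed

section \<open>Closure of the algebras under the superbracket\<close>

lemma op_scale_linear: "op_scale c (X + Y) = op_scale c X + op_scale c Y"
  "op_scale c (X - Y) = op_scale c X - op_scale c Y"
  "op_scale (c * d) X = op_scale c (op_scale d X)" "op_scale 1 X = X" "op_scale c 0 = 0"
  by (auto simp: op_scale_def fun_eq_iff algebra_simps)

lemma op_part_linear:
  "op_part p (X + Y) = op_part p X + op_part p Y"
  "op_part p (op_scale c X) = op_scale c (op_part p X)"
  by (auto simp: op_part_def fun_eq_iff op_scale_apply parity_part_linear gscale_linear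
      simp del: plus_fun_apply) (simp_all add: gscale_def parity_part_def algebra_simps)

lemma gscale_apply: "gscale c f I = c * f I"
  by (simp add: gscale_def)

lemma superbracket_vf_linear:
  "superbracket (vf n F) (Y + Z) = superbracket (vf n F) Y + superbracket (vf n F) Z"
  "superbracket (Y + Z) (vf n F) = superbracket Y (vf n F) + superbracket Z (vf n F)"
  "superbracket (vf n F) (op_scale c Y) = op_scale c (superbracket (vf n F) Y)"
  "superbracket (op_scale c Y) (vf n F) = op_scale c (superbracket Y (vf n F))"
  by (auto simp: fun_eq_iff superbracket_def op_part_linear op_part_vf op_scale_apply vf_arg_linear
      gscale_apply algebra_simps)

text \<open>
  Multiplying the coefficient of each monomial \<open>\<xi>\<^sub>I D\<^sub>k\<close> by a number preserves Hamiltonian fields if this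
  number depends only on the set \<open>I \<union> {k'}\<close>, that is on the monomial of \<open>f\<close> from which \<open>\<xi>\<^sub>I D\<^sub>k\<close>
  arises.
\<close>

lemma hfield_reweight:
  assumes f: "f \<in> Lambda n" and k: "k \<in> {1..n}"
    and u: "\<And>I. I \<subseteq> {1..n} \<Longrightarrow> conj_index n k \<notin> I \<Longrightarrow> u I = w (insert (conj_index n k) I)"
  shows "wscale u (hfield n f k) = hfield n (wscale w f) k"
proof
  fix I
  let ?m = "conj_index n k"
  show "wscale u (hfield n f k) I = hfield n (wscale w f) k I"
  proof (cases "?m \<in> I \<or> f (insert ?m I) = 0")
    case False
    hence "I \<subseteq> {1..n}" using f unfolding Lambda_def by blast
    thus ?thesis using False u[of I]
      by (simp add: wscale_def hfield_def gderiv_def parity_sign_def)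
  qed (auto simp: wscale_def hfield_def gderiv_def parity_sign_def)
qed

text \<open>
  The coefficient of the divergence at \<open>I\<close> involves only the monomials \<open>\<xi>\<^bsub>I \<union> {k}\<^esub> D\<^sub>k\<close>, so a common
  factor for all of them can be pulled out.
\<close>

lemma divergence_reweight:
  assumes F: "F \<in> coeffs n"
    and u: "\<And>k I. k \<in> {1..n} \<Longrightarrow> I \<subseteq> {1..n} \<Longrightarrow> k \<notin> I \<Longrightarrow> u k (insert k I) = w I"
  shows "divergence n (\<lambda>k. wscale (u k) (F k)) = wscale w (divergence n F)"
proof
  fix I
  have "gderiv k (wscale (u k) (F k)) I = w I * gderiv k (F k) I" if k: "k \<in> {1..n}" for k
  proof (cases "k \<in> I \<or> F k (insert k I) = 0")
    case False
    hence "I \<subseteq> {1..n}" using coeffsD[OF F k] unfolding Lambda_def by blast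
    thus ?thesis using False u[OF k, of I] by (simp add: wscale_def gderiv_def)
  qed (auto simp: wscale_def gderiv_def)
  thus "divergence n (\<lambda>k. wscale (u k) (F k)) I = wscale w (divergence n F) I"
    by (simp add: divergence_def sum_apply wscale_def sum_distrib_left)
qed

definition so_type :: "cartan_type \<Rightarrow> bool" where
  "so_type X \<longleftrightarrow> X = H_bar \<or> X = CH_bar"

definition Ham :: "nat \<Rightarrow> nat \<Rightarrow> grass set" where
  "Ham n N = {f \<in> Lambda n. \<forall>I. f I \<noteq> 0 \<longrightarrow> card I \<le> N}"

text \<open>
  The coefficient families of the algebra without the summand spanned by \<open>d_elt n\<close>.
\<close>

fun base_coeffs :: "cartan_type \<Rightarrow> nat \<Rightarrow> (nat \<Rightarrow> grass) set" where
  "base_coeffs W n = coeffs n"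
| "base_coeffs S_bar n = {F \<in> coeffs n. divergence n F = 0}"
| "base_coeffs H_bar n = hfield n ` Ham n (n - 1)"
| "base_coeffs CH_bar n = hfield n ` Ham n n"

lemma Ham_linear:
  "0 \<in> Ham n N" "f \<in> Ham n N \<Longrightarrow> g \<in> Ham n N \<Longrightarrow> f + g \<in> Ham n N"
  "f \<in> Ham n N \<Longrightarrow> gscale c f \<in> Ham n N" "f \<in> Ham n N \<Longrightarrow> wscale w f \<in> Ham n N"
  "f \<in> Ham n N \<Longrightarrow> parity_part p f \<in> Ham n N"
proof -
  show "f + g \<in> Ham n N" if "f \<in> Ham n N" "g \<in> Ham n N"
    unfolding Ham_def
  proof (intro CollectI conjI allI impI)
    show "f + g \<in> Lambda n" using that by (auto simp: Ham_def intro: Lambda_linear)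
    fix I assume "(f + g) I \<noteq> 0"
    hence "f I \<noteq> 0 \<or> g I \<noteq> 0" by auto
    thus "card I \<le> N" using that unfolding Ham_def by blast
  qed
qed (auto simp: Ham_def wscale_def gscale_def parity_part_def Lambda_def)

lemma Ham_Lambda: "f \<in> Ham n N \<Longrightarrow> f \<in> Lambda n"
  by (simp add: Ham_def)

lemma Ham_top: "Ham n n = Lambda n"
proof -
  have "card I \<le> n" if "f \<in> Lambda n" "f I \<noteq> 0" for f I
    using that card_mono[of "{1..n}" I] by (auto simp: Lambda_def)
  thus ?thesis by (auto simp: Ham_def)
qed

lemma hfield_linear:
  "hfield n 0 = 0" "hfield n (f + g) = hfield n f + hfield n g"
  "hfield n (gscale c f) = (\<lambda>k. gscale c (hfield n f k))"
  by (auto simp: fun_eq_iff hfield_def parity_sign_linear gderiv_linear)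

lemma divergence_linear:
  "divergence n 0 = 0" "divergence n (F + G) = divergence n F + divergence n G"
  "divergence n (\<lambda>k. gscale c (F k)) = gscale c (divergence n F)"
  by (simp_all add: divergence_def gderiv_linear sum.distrib gscale_sum)

lemma poisson_Ham:
  assumes "f \<in> Lambda n" "has_parity a f" "g \<in> Lambda n"
  shows "poisson n f g \<in> Ham n (n - 1)"
  unfolding Ham_def
proof (intro CollectI conjI allI impI)
  show L: "poisson n f g \<in> Lambda n" using assms by (simp add: poisson_Lambda)
  fix I assume nz: "poisson n f g I \<noteq> 0"
  hence "I \<subseteq> {1..n}" "I \<noteq> {1..n}" using L poisson_top[OF assms(1,2)] by (auto simp: Lambda_def)
  hence "card I < card {1..n}" by (intro psubset_card_mono) auto
  thus "card I \<le> n - 1" by simp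
qed

lemma Ham_mono: "M \<le> N \<Longrightarrow> Ham n M \<subseteq> Ham n N"
  by (auto simp: Ham_def)

lemma base_coeffs_coeffs: "base_coeffs X n \<subseteq> coeffs n"
  by (cases X) (auto intro!: hfield_coeffs Ham_Lambda)

lemma base_coeffs_so:
  assumes "so_type X"
  shows "\<exists>N. n - 1 \<le> N \<and> base_coeffs X n = hfield n ` Ham n N"
  using assms unfolding so_type_def
proof
  show ?thesis if "X = CH_bar" using that by (intro exI[of _ n]) simp
qed (intro exI[of _ "n - 1"], simp)

lemma coeffs_linear:
  "0 \<in> coeffs n" "F \<in> coeffs n \<Longrightarrow> G \<in> coeffs n \<Longrightarrow> F + G \<in> coeffs n"
  "F \<in> coeffs n \<Longrightarrow> (\<lambda>k. gscale c (F k)) \<in> coeffs n"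
  unfolding coeffs_def by (simp_all add: Lambda_linear)

lemma base_coeffs_linear:
  "0 \<in> base_coeffs X n"
  "F \<in> base_coeffs X n \<Longrightarrow> G \<in> base_coeffs X n \<Longrightarrow> F + G \<in> base_coeffs X n"
  "F \<in> base_coeffs X n \<Longrightarrow> (\<lambda>k. gscale c (F k)) \<in> base_coeffs X n"
proof -
  show "0 \<in> base_coeffs X n"
    by (cases X) (simp_all add: coeffs_linear divergence_linear rev_image_eqI[OF Ham_linear(1)] hfield_linear)
  show "F + G \<in> base_coeffs X n" if "F \<in> base_coeffs X n" "G \<in> base_coeffs X n"
  proof (cases "so_type X")
    case True
    thus ?thesis using that base_coeffs_so[OF True, of n]
      by (elim exE conjE, simp only:) (elim imageE, simp only: hfield_linear(2)[symmetric] imageI Ham_linear)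
  next
    case False
    thus ?thesis using that by (cases X) (simp_all add: so_type_def coeffs_linear divergence_linear)
  qed
  show "(\<lambda>k. gscale c (F k)) \<in> base_coeffs X n" if "F \<in> base_coeffs X n"
  proof (cases "so_type X")
    case True
    thus ?thesis using that base_coeffs_so[OF True, of n]
      by (elim exE conjE, simp only:) (elim imageE, simp only: hfield_linear(3)[symmetric] imageI Ham_linear)
  next
    case False
    thus ?thesis using that by (cases X) (simp_all add: so_type_def coeffs_linear divergence_linear gscale_linear)
  qed
qed

lemma base_coeffs_part: "F \<in> base_coeffs X n \<Longrightarrow> coeff_part p F \<in> base_coeffs X n"
  by (cases X) (auto simp: coeffs_part divergence_coeff_part parity_part_linear coeff_part_hfield Ham_Lambda
      intro!: imageI Ham_linear)

lemma base_coeffs_bracket: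
  assumes F: "F \<in> base_coeffs X n" and G: "G \<in> base_coeffs X n"
  shows "vf_bracket n p q (coeff_part p F) (coeff_part q G) \<in> base_coeffs X n"
proof (cases "so_type X")
  case True
  then obtain N where N: "n - 1 \<le> N" "base_coeffs X n = hfield n ` Ham n N"
    using base_coeffs_so by blast
  obtain f g where f: "f \<in> Lambda n" "F = hfield n f" and g: "g \<in> Lambda n" "G = hfield n g"
    using F G unfolding N(2) by (auto dest: Ham_Lambda)
  let ?f = "parity_part p f" and ?g = "parity_part q g"
  have h: "?f \<in> Lambda n" "has_parity p ?f" "?g \<in> Lambda n" "has_parity q ?g"
    using f g by (auto intro: Lambda_linear)
  have "vf_bracket n p q (coeff_part p F) (coeff_part q G) =
      hfield n (gscale ((-1) ^ p) (poisson n ?f ?g))"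
    using hfield_bracket[OF h] by (simp add: fun_eq_iff[of "vf_bracket _ _ _ _ _"] f g coeff_part_hfield)
  moreover have "gscale ((-1) ^ p) (poisson n ?f ?g) \<in> Ham n N"
    using poisson_Ham[OF h(1-3)] Ham_mono[OF N(1)] by (blast intro: Ham_linear)
  ultimately show ?thesis unfolding N(2) by blast
next
  case False
  have c: "F \<in> coeffs n" "G \<in> coeffs n" using F G base_coeffs_coeffs by blast+
  show ?thesis
  proof (cases "X = S_bar")
    case True
    hence d: "divergence n F = 0" "divergence n G = 0" using F G by auto
    have "divergence n (vf_bracket n p q (coeff_part p F) (coeff_part q G)) = 0"
      by (subst divergence_bracket)
        (simp_all add: c d coeffs_part has_parity_coeff_part divergence_coeff_part parity_part_linear vf_arg_linear gscale_linear)
    thus ?thesis using True c by (simp add: coeffs_bracket coeffs_part)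
  next
    case W: False
    hence "X = W" using False by (cases X) (auto simp: so_type_def)
    thus ?thesis using c by (simp add: coeffs_bracket coeffs_part)
  qed
qed

text \<open>
  The factors \<open>u k I\<close> for which rescaling every \<open>\<xi>\<^sub>I D\<^sub>k\<close> by \<open>u k I\<close> preserves \<open>base_coeffs\<close>. Weights, and
  functions of weights, are of this kind; this gives both the action of \<open>d_elt n\<close> and the projections
  onto weight spaces.
\<close>

definition weight_compatible :: "cartan_type \<Rightarrow> nat \<Rightarrow> (nat \<Rightarrow> nat set \<Rightarrow> complex) \<Rightarrow> bool" where
  "weight_compatible X n u \<longleftrightarrow> (\<exists>w. \<forall>k\<in>{1..n}. \<forall>I\<subseteq>{1..n}. if so_type X
     then conj_index n k \<notin> I \<longrightarrow> u k I = w (insert (conj_index n k) I)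
     else k \<notin> I \<longrightarrow> u k (insert k I) = w I)"

lemma base_coeffs_reweight:
  assumes F: "F \<in> base_coeffs X n" and u: "weight_compatible X n u"
  shows "\<exists>G \<in> base_coeffs X n. \<forall>k\<in>{1..n}. G k = wscale (u k) (F k)"
proof (cases "so_type X")
  case True
  then obtain N where N: "base_coeffs X n = hfield n ` Ham n N"
    using base_coeffs_so by blast
  obtain f where f: "f \<in> Ham n N" "F = hfield n f" using F N by auto
  obtain w where w: "\<And>k I. k \<in> {1..n} \<Longrightarrow> I \<subseteq> {1..n} \<Longrightarrow> conj_index n k \<notin> I \<Longrightarrow>
      u k I = w (insert (conj_index n k) I)"
    using u True by (auto simp: weight_compatible_def)
  have "hfield n (wscale w f) k = wscale (u k) (F k)" if "k \<in> {1..n}" for k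
    unfolding f(2) by (rule hfield_reweight[symmetric]) (use f that w in \<open>auto dest: Ham_Lambda\<close>)
  moreover have "hfield n (wscale w f) \<in> base_coeffs X n" using f N by (auto intro: Ham_linear)
  ultimately show ?thesis by blast
next
  case False
  let ?G = "\<lambda>k. wscale (u k) (F k)"
  have c: "F \<in> coeffs n" using F base_coeffs_coeffs by blast
  hence G: "?G \<in> coeffs n" by (auto simp: coeffs_def intro: Lambda_wscale)
  obtain w where w: "\<And>k I. k \<in> {1..n} \<Longrightarrow> I \<subseteq> {1..n} \<Longrightarrow> k \<notin> I \<Longrightarrow> u k (insert k I) = w I"
    using u False by (auto simp: weight_compatible_def)
  have "divergence n ?G = wscale w (divergence n F)" by (rule divergence_reweight[OF c, of u w]) (rule w)
  moreover have "wscale w 0 = 0" by (simp add: wscale_def fun_eq_iff)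
  ultimately have "?G \<in> base_coeffs X n" using G F False by (cases X) (auto simp: so_type_def)
  thus ?thesis by (rule bexI[rotated]) simp
qed

text \<open>
  The tuples \<open>c\<close> for which \<open>\<Sum>i. c\<^sub>i \<xi>\<^sub>i D\<^sub>i\<close> lies in the Cartan subalgebra. In the orthogonal case
  \<open>c\<^sub>k + c\<^bsub>k'\<^esub>\<close> is twice the coefficient of \<open>d_elt n\<close>, so this sum does not depend on \<open>k\<close>.
\<close>

definition cartan_tuple :: "cartan_type \<Rightarrow> nat \<Rightarrow> (nat \<Rightarrow> complex) \<Rightarrow> bool" where
  "cartan_tuple X n c \<longleftrightarrow> (so_type X \<longrightarrow> (\<forall>k\<in>{1..n}. c k + c (conj_index n k) = c 1 + c (conj_index n 1)))"

lemma wt_insert: "finite I \<Longrightarrow> k \<notin> I \<Longrightarrow> wt c k (insert k I) = (\<Sum>a\<in>I. c a)"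
  by (simp add: wt_def)

text \<open>
  In the orthogonal case the weight of \<open>\<xi>\<^sub>I D\<^sub>k\<close> depends only on \<open>I \<union> {k'}\<close>.
\<close>

lemma wt_insert_conj:
  assumes "so_type X" "cartan_tuple X n c" "k \<in> {1..n}" "finite I" "conj_index n k \<notin> I"
  shows "wt c k I = (\<Sum>a\<in>insert (conj_index n k) I. c a) - (c 1 + c (conj_index n 1))"
proof -
  have "c 1 + c (conj_index n 1) = c k + c (conj_index n k)"
    using assms(1-3) unfolding cartan_tuple_def by metis
  thus ?thesis using assms(4,5) by (simp only: wt_def) simp
qed

lemma weight_compatible_wt:
  assumes "cartan_tuple X n c"
  shows "weight_compatible X n (wt c)"
proof (cases "so_type X")
  case True
  have "\<forall>k\<in>{1..n}. \<forall>I\<subseteq>{1..n}. conj_index n k \<notin> I \<longrightarrow>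
      wt c k I = (\<lambda>M. (\<Sum>a\<in>M. c a) - (c 1 + c (conj_index n 1))) (insert (conj_index n k) I)"
    using wt_insert_conj[OF True assms] finite_subset[of _ "{1..n}"] by blast
  thus ?thesis using True unfolding weight_compatible_def by (simp only: if_True) (rule exI)
next
  case False
  have "\<forall>k\<in>{1..n}. \<forall>I\<subseteq>{1..n}. k \<notin> I \<longrightarrow> wt c k (insert k I) = (\<lambda>I. \<Sum>a\<in>I. c a) I"
    using wt_insert finite_subset[of _ "{1..n}"] by blast
  thus ?thesis using False unfolding weight_compatible_def by (simp only: if_False) (rule exI)
qed

lemma d_elt_diag: "d_elt n = diag n (\<lambda>_. 1)"
  by (simp add: d_elt_def diag_def vf_def gscale_linear)

lemma diag_scale_one: "vf n (\<lambda>k. gscale a (xi k)) = op_scale a (d_elt n)"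
  unfolding d_elt_diag diag_def by (simp add: gscale_linear vf_coeff_linear)

lemma coeffs_add_xi: "F \<in> coeffs n \<Longrightarrow> (\<lambda>k. F k + gscale a (xi k)) \<in> coeffs n"
  by (intro coeffsI Lambda_linear xi_in_Lambda) (rule coeffsD)

text \<open>
  As \<open>d_elt n\<close> lies in \<open>W(n)\<close>, all four cases have the same shape.
\<close>

lemma lie_alg_base:
  "lie_alg X n = {vf n F + op_scale a (d_elt n) |F a. F \<in> base_coeffs X n}"
proof (cases "X = W")
  case True
  have "vf n F + op_scale a (d_elt n) \<in> W_alg n" if "F \<in> coeffs n" for F a
    unfolding diag_scale_one[symmetric] vf_coeff_linear(1)[symmetric] W_alg_vf
    using that by (intro imageI coeffs_add_xi)
  moreover have "op_scale 0 X = 0" for X by (simp add: op_scale_def fun_eq_iff)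
  hence "\<exists>F' a. vf n F = vf n F' + op_scale a (d_elt n) \<and> F' \<in> coeffs n" if "F \<in> coeffs n" for F
    using that by (intro exI[of _ F] exI[of _ 0]) simp
  ultimately show ?thesis using True by (auto simp: W_alg_vf)
next
  case False
  have "lie_alg X n = adjoin_d n (vf n ` base_coeffs X n)"
    using False by (cases X) (auto simp: S_alg_vf H_alg_def CH_alg_def Ham_top image_image
        D_H_vf image_Collect[symmetric] Ham_def intro!: arg_cong[of _ _ "adjoin_d n"])
  thus ?thesis unfolding adjoin_d_def by blast
qed

lemma lie_algI:
  assumes "F \<in> base_coeffs X n" "\<And>k. k \<in> {1..n} \<Longrightarrow> G k = F k + gscale a (xi k)"
  shows "vf n G \<in> lie_alg X n"
proof -
  have "vf n G = vf n F + op_scale a (d_elt n)"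
    unfolding diag_scale_one[symmetric] vf_coeff_linear(1)[symmetric] by (rule vf_cong) (rule assms)
  thus ?thesis using assms(1) unfolding lie_alg_base by blast
qed

lemma lie_algE:
  assumes "x \<in> lie_alg X n"
  obtains F a where "F \<in> base_coeffs X n" "x = vf n (\<lambda>k. F k + gscale a (xi k))"
    "(\<lambda>k. F k + gscale a (xi k)) \<in> coeffs n"
proof -
  obtain F a where F: "F \<in> base_coeffs X n" "x = vf n F + op_scale a (d_elt n)"
    using assms unfolding lie_alg_base by blast
  have "F \<in> coeffs n" using F base_coeffs_coeffs by blast
  hence "(\<lambda>k. F k + gscale a (xi k)) \<in> coeffs n" by (rule coeffs_add_xi)
  moreover have "x = vf n (\<lambda>k. F k + gscale a (xi k))"
    unfolding F(2) diag_scale_one[symmetric] vf_coeff_linear(1)[symmetric] ..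
  ultimately show ?thesis using that F by blast
qed

lemma lie_alg_subspace: "opv.subspace (lie_alg X n)"
  unfolding opv.subspace_def
proof (intro conjI ballI allI)
  show "0 \<in> lie_alg X n"
    using lie_algI[OF base_coeffs_linear(1), of n "\<lambda>k. 0" 0]
    by (simp add: vf_coeff_linear gscale_linear)
next
  fix x y assume "x \<in> lie_alg X n" "y \<in> lie_alg X n"
  then obtain F a G b where x: "F \<in> base_coeffs X n" "x = vf n F + op_scale a (d_elt n)"
    and y: "G \<in> base_coeffs X n" "y = vf n G + op_scale b (d_elt n)"
    unfolding lie_alg_base by blast
  have "x + y = vf n (F + G) + op_scale (a + b) (d_elt n)"
    using vf_coeff_linear(1)[of n F G] unfolding x(2) y(2) plus_fun_def[of F G]
    by (simp add: op_scale_def fun_eq_iff algebra_simps)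
  thus "x + y \<in> lie_alg X n" unfolding lie_alg_base using base_coeffs_linear(2)[OF x(1) y(1)] by blast
next
  fix c x assume "x \<in> lie_alg X n"
  then obtain F a where x: "F \<in> base_coeffs X n" "x = vf n F + op_scale a (d_elt n)"
    unfolding lie_alg_base by blast
  have "op_scale c x = vf n (\<lambda>k. gscale c (F k)) + op_scale (c * a) (d_elt n)"
    unfolding x(2) vf_coeff_linear op_scale_linear ..
  thus "op_scale c x \<in> lie_alg X n" unfolding lie_alg_base using base_coeffs_linear(3)[OF x(1)] by blast
qed

lemma base_lie_alg: "F \<in> base_coeffs X n \<Longrightarrow> vf n F \<in> lie_alg X n"
  by (rule lie_algI[of F _ _ _ 0]) (simp_all add: gscale_linear)

lemma d_elt_lie_alg: "d_elt n \<in> lie_alg X n"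
proof -
  have "vf n 0 + op_scale 1 (d_elt n) \<in> lie_alg X n"
    using base_coeffs_linear(1) unfolding lie_alg_base by blast
  thus ?thesis by (simp add: op_scale_linear vf_zero)
qed

lemma op_part_d_elt: "op_part p (d_elt n) = (if even p then d_elt n else 0)"
  by (simp only: d_elt_diag diag_def op_part_vf coeff_part_diag split: if_split) (simp add: vf_zero)

lemma lie_alg_op_part:
  assumes "x \<in> lie_alg X n"
  shows "op_part p x \<in> lie_alg X n"
proof -
  obtain F a where x: "F \<in> base_coeffs X n" "x = vf n F + op_scale a (d_elt n)"
    using assms unfolding lie_alg_base by blast
  have "op_part p x = vf n (coeff_part p F) + op_scale a (op_part p (d_elt n))"
    by (simp only: x op_part_linear op_part_vf)
  moreover have "vf n (coeff_part p F) \<in> lie_alg X n"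
    by (intro base_lie_alg base_coeffs_part x)
  moreover have "op_part p (d_elt n) \<in> lie_alg X n"
    using d_elt_lie_alg opv.subspace_0[OF lie_alg_subspace] by (simp add: op_part_d_elt)
  ultimately show ?thesis
    using opv.subspace_add[OF lie_alg_subspace] opv.subspace_scale[OF lie_alg_subspace] by metis
qed

lemma base_coeffs_sum:
  assumes "\<And>a. a \<in> A \<Longrightarrow> F a \<in> base_coeffs X n" "finite A"
  shows "(\<lambda>k. \<Sum>a\<in>A. F a k) \<in> base_coeffs X n"
  using assms(2,1)
proof induction
  case empty
  thus ?case using base_coeffs_linear(1)[of X n] by (simp add: zero_fun_def[symmetric])
next
  case (insert a A)
  hence "F a + (\<lambda>k. \<Sum>a\<in>A. F a k) \<in> base_coeffs X n" by (intro base_coeffs_linear) auto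
  also have "F a + (\<lambda>k. \<Sum>a\<in>A. F a k) = (\<lambda>k. \<Sum>a\<in>insert a A. F a k)"
    by (rule ext) (simp only: sum.insert[OF insert.hyps] plus_fun_apply)
  finally show ?case .
qed

lemma lie_alg_superbracket:
  assumes "x \<in> lie_alg X n" "y \<in> lie_alg X n"
  shows "superbracket x y \<in> lie_alg X n"
proof -
  obtain F a G b where x: "F \<in> base_coeffs X n" "x = vf n F + op_scale a (d_elt n)"
    and y: "G \<in> base_coeffs X n" "y = vf n G + op_scale b (d_elt n)"
    using assms unfolding lie_alg_base by blast
  let ?L = "lie_alg X n"
  have c: "F \<in> coeffs n" "G \<in> coeffs n" using x y base_coeffs_coeffs by blast+
  have d: "superbracket (d_elt n) (vf n H) \<in> ?L \<and> superbracket (vf n H) (d_elt n) \<in> ?L"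
    if H: "H \<in> base_coeffs X n" for H
  proof -
    have "H \<in> coeffs n" using H base_coeffs_coeffs by blast
    moreover have "vf n (\<lambda>k. wscale (wt (\<lambda>_. 1) k) (H k)) \<in> ?L"
    proof -
      have "weight_compatible X n (wt (\<lambda>_. 1))" by (rule weight_compatible_wt) (simp add: cartan_tuple_def)
      then obtain K where "K \<in> base_coeffs X n" "\<forall>k\<in>{1..n}. K k = wscale (wt (\<lambda>_. 1) k) (H k)"
        using base_coeffs_reweight[OF H] by blast
      thus ?thesis by (intro lie_algI[of K _ _ _ 0]) (auto simp: gscale_linear)
    qed
    ultimately show ?thesis
      using opv.subspace_neg[OF lie_alg_subspace[of X n]]
      by (simp add: d_elt_diag superbracket_diag_left superbracket_diag_right)
  qed
  have dd: "superbracket (d_elt n) (d_elt n) \<in> ?L"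
  proof -
    have "wscale (wt (\<lambda>_. 1) k) (gscale 1 (xi k)) = 0" for k
      by (auto simp: fun_eq_iff wscale_def gscale_def xi_def wt_def)
    hence "superbracket (d_elt n) (d_elt n) = vf n (\<lambda>k. 0)"
      unfolding d_elt_diag by (subst (2) diag_def) (simp only: superbracket_diag_left[OF diag_coeffs])
    thus ?thesis using opv.subspace_0[OF lie_alg_subspace] by (simp only: vf_coeff_linear)
  qed
  have FG: "superbracket (vf n F) (vf n G) \<in> ?L"
    unfolding superbracket_vf
    by (intro base_lie_alg base_coeffs_sum base_coeffs_bracket x y) auto
  have dv: "d_elt n = vf n (\<lambda>i. gscale 1 (xi i))" by (simp add: d_elt_diag diag_def)
  have lin_d: "superbracket (d_elt n) (Y + Z) = superbracket (d_elt n) Y + superbracket (d_elt n) Z"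
     "superbracket (d_elt n) (op_scale c Y) = op_scale c (superbracket (d_elt n) Y)" for Y Z c
    unfolding dv by (rule superbracket_vf_linear)+
  have yv: "y = vf n (\<lambda>k. G k + gscale b (xi k))"
    unfolding y(2) diag_scale_one[symmetric] vf_coeff_linear(1)[symmetric] ..
  have "superbracket x y = superbracket (vf n F) y + op_scale a (superbracket (d_elt n) y)"
    unfolding x(2) yv superbracket_vf_linear ..
  also have "\<dots> = superbracket (vf n F) (vf n G) + op_scale b (superbracket (vf n F) (d_elt n)) +
      op_scale a (superbracket (d_elt n) (vf n G) + op_scale b (superbracket (d_elt n) (d_elt n)))"
    unfolding y(2) lin_d superbracket_vf_linear ..
  also have "\<dots> \<in> ?L"
    using FG dd d[OF x(1)] d[OF y(1)]
    by (intro opv.subspace_add opv.subspace_scale lie_alg_subspace) auto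
  finally show ?thesis .
qed

lemma lie_alg_subalgebra: "subalgebra X n (lie_alg X n)"
  by (simp add: subalgebra_def lie_alg_subspace lie_alg_op_part lie_alg_superbracket)

section \<open>The Cartan subalgebras as diagonal vector fields\<close>

lemma diag_cong: "(\<And>k. k \<in> {1..n} \<Longrightarrow> c k = e k) \<Longrightarrow> diag n c = diag n e"
  unfolding diag_def by (rule vf_cong) simp

lemma diag_linear:
  "diag n (\<lambda>k. c k + e k) = diag n c + diag n e"
  "diag n (\<lambda>k. c k - e k) = diag n c - diag n e"
  "diag n (\<lambda>k. a * c k) = op_scale a (diag n c)"
  "diag n (\<lambda>k. 0) = 0"
proof -
  have "gscale (c k + e k) f = gscale (c k) f + gscale (e k) f"
    "gscale (c k - e k) f = gscale (c k) f - gscale (e k) f" for k f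
    by (auto simp: gscale_def fun_eq_iff algebra_simps)
  thus "diag n (\<lambda>k. c k + e k) = diag n c + diag n e" "diag n (\<lambda>k. c k - e k) = diag n c - diag n e"
    unfolding diag_def by (simp_all only: vf_coeff_linear)
  show "diag n (\<lambda>k. a * c k) = op_scale a (diag n c)" "diag n (\<lambda>k. 0) = 0"
    unfolding diag_def by (simp_all only: vf_coeff_linear(3)[symmetric] gscale_linear vf_coeff_linear(4))
qed

lemma diag_sum: "finite A \<Longrightarrow> diag n (\<lambda>k. \<Sum>i\<in>A. c i k) = (\<Sum>i\<in>A. diag n (c i))"
proof (induction A rule: finite_induct)
  case (insert i A)
  show ?case unfolding sum.insert[OF insert.hyps] diag_linear insert.IH ..
qed (simp add: diag_linear)

lemma fD_xi_diag:
  assumes "i \<in> {1..n}"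
  shows "fD (xi i) i = diag n (\<lambda>k. if k = i then 1 else 0)"
proof -
  have "diag n (\<lambda>k. if k = i then 1 else 0) = (\<Sum>k=1..n. if k = i then fD (xi i) i else 0)"
    unfolding diag_def vf_def
  proof (rule sum.cong[OF refl])
    fix k
    have "fD 0 k = 0" by (simp add: fD_def gmult_linear fun_eq_iff)
    thus "fD (gscale (if k = i then 1 else 0) (xi k)) k = (if k = i then fD (xi i) i else 0)"
      by (simp add: gscale_linear)
  qed
  thus ?thesis using assms by (simp only: sum.delta finite_atLeastAtMost if_True)
qed

lemma cartan_basis_diag:
  assumes b: "b \<in> cartan_basis X n" and n: "1 \<le> n"
  obtains c where "cartan_tuple X n c" "b = diag n c" "\<And>k. c k \<in> \<real>"
proof (cases "so_type X")
  case False
  hence "b \<in> gl_cartan_basis n" using b by (cases X) (auto simp: so_type_def)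
  then obtain i where i: "i \<in> {1..n}" "b = fD (xi i) i" by (auto simp: gl_cartan_basis_def)
  show ?thesis
    by (rule that[OF _ i(2)[unfolded fD_xi_diag[OF i(1)]]]) (auto simp: cartan_tuple_def False)
next
  case True
  hence "b \<in> so_cartan_basis n" using b by (auto simp: so_type_def)
  then consider "b = d_elt n" | i where "i \<in> {1..n div 2}"
      "b = fD (xi i) i - fD (xi (i + n div 2)) (i + n div 2)"
    by (auto simp: so_cartan_basis_def Let_def)
  thus ?thesis
  proof cases
    case 1
    thus ?thesis by (intro that[of "\<lambda>_. 1"]) (auto simp: d_elt_diag cartan_tuple_def)
  next
    case 2
    let ?c = "\<lambda>k. (if k = i then 1 else 0) - (if k = i + n div 2 then 1 else 0 :: complex)"
    have r: "i \<in> {1..n}" "i + n div 2 \<in> {1..n}" using 2 by auto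
    have "b = diag n ?c" unfolding 2(2) fD_xi_diag[OF r(1)] fD_xi_diag[OF r(2)] diag_linear ..
    moreover have "?c k + ?c (conj_index n k) = 0" if "k \<in> {1..n}" for k
      using that 2(1) by (auto simp: conj_index_def Let_def)
    hence "cartan_tuple X n ?c" using n by (simp add: cartan_tuple_def)
    ultimately show ?thesis using that[of ?c] by auto
  qed
qed

text \<open>
  With \<open>r = n div 2\<close>, the field is \<open>t d + \<Sum>i\<le>r. (c\<^sub>i - t) (\<xi>\<^sub>i D\<^sub>i - \<xi>\<^bsub>i+r\<^esub> D\<^bsub>i+r\<^esub>)\<close>.
\<close>

lemma diag_in_span_so_cartan_basis:
  assumes c: "\<And>k. k \<in> {1..n} \<Longrightarrow> c k + c (conj_index n k) = 2 * t"
  shows "diag n c \<in> opv.span (so_cartan_basis n)"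
proof -
  let ?r = "n div 2"
  let ?b = "\<lambda>i k. (c i - t) * ((if k = i then 1 else 0) - (if k = i + ?r then 1 else 0))"
  have "diag n c = diag n (\<lambda>k. t * 1 + (\<Sum>i=1..?r. ?b i k))"
  proof (rule diag_cong)
    fix k assume k: "k \<in> {1..n}"
    have "(\<Sum>i=1..?r. ?b i k) = (\<Sum>i=1..?r. if i = k then c i - t else 0) -
        (\<Sum>i=1..?r. if i = k - ?r then (if ?r < k then c i - t else 0) else 0)"
      unfolding sum_subtractf[symmetric] by (rule sum.cong) (auto simp: algebra_simps)
    also have "\<dots> = c k - t"
    proof -
      consider "k \<le> ?r" | "?r < k" "k \<le> 2 * ?r" | "k = 2 * ?r + 1" using k by (auto simp: not_le) linarith
      thus ?thesis
      proof cases
        case 2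
        hence "c k + c (k - ?r) = 2 * t" using c[OF k] by (simp add: conj_index_def Let_def)
        hence "t - c (k - ?r) = c k - t" by (simp add: algebra_simps)
        moreover have "k - ?r \<in> {1..?r}" "k \<notin> {1..?r}" using 2 by auto
        ultimately show ?thesis using 2 by (simp add: sum.delta')
      next
        case 3
        hence "c k + c k = 2 * t" using c[OF k] by (simp add: conj_index_def Let_def)
        hence "c k = t" by simp
        moreover have "k - ?r \<notin> {1..?r}" "k \<notin> {1..?r}" using 3 by auto
        ultimately show ?thesis by (simp add: sum.delta')
      qed (use k in \<open>auto simp: sum.delta'\<close>)
    qed
    finally show "c k = t * 1 + (\<Sum>i=1..?r. ?b i k)" by simp
  qed
  also have "\<dots> = op_scale t (d_elt n) + (\<Sum>i=1..?r. op_scale (c i - t)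
      (fD (xi i) i - fD (xi (i + ?r)) (i + ?r)))"
  proof -
    have "diag n (?b i) = op_scale (c i - t) (fD (xi i) i - fD (xi (i + ?r)) (i + ?r))"
      if "i \<in> {1..?r}" for i
    proof -
      have r: "i \<in> {1..n}" "i + ?r \<in> {1..n}" using that by auto
      show ?thesis unfolding fD_xi_diag[OF r(1)] fD_xi_diag[OF r(2)] by (simp only: diag_linear)
    qed
    thus ?thesis unfolding diag_linear(1) diag_linear(3) d_elt_diag diag_sum[OF finite_atLeastAtMost]
      by (metis (no_types, lifting) sum.cong)
  qed
  also have "\<dots> \<in> opv.span (so_cartan_basis n)"
    by (intro opv.span_add opv.span_scale opv.span_sum opv.span_base)
      (auto simp: so_cartan_basis_def Let_def)
  finally show ?thesis .
qed

lemma cartan_diag: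
  assumes n: "1 \<le> n"
  shows "cartan X n = {diag n c |c. cartan_tuple X n c}"
proof
  show "cartan X n \<subseteq> {diag n c |c. cartan_tuple X n c}"
    unfolding cartan_def
  proof (rule opv.span_minimal)
    show "cartan_basis X n \<subseteq> {diag n c |c. cartan_tuple X n c}"
      using cartan_basis_diag[OF _ n] by blast
    have add: "cartan_tuple X n (\<lambda>k. c k + e k)" if "cartan_tuple X n c" "cartan_tuple X n e" for c e
      unfolding cartan_tuple_def
    proof (intro impI ballI)
      fix k assume "so_type X" "k \<in> {1..n}"
      hence "c k + c (conj_index n k) = c 1 + c (conj_index n 1)"
        "e k + e (conj_index n k) = e 1 + e (conj_index n 1)"
        using that unfolding cartan_tuple_def by metis+
      thus "c k + e k + (c (conj_index n k) + e (conj_index n k)) =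
          c 1 + e 1 + (c (conj_index n 1) + e (conj_index n 1))"
        by (metis add.assoc add.left_commute)
    qed
    have sc: "cartan_tuple X n (\<lambda>k. a * c k)" if "cartan_tuple X n c" for a c
      using that unfolding cartan_tuple_def by (metis distrib_left)
    show "opv.subspace {diag n c |c. cartan_tuple X n c}"
      unfolding opv.subspace_def
    proof (intro conjI ballI allI)
      show "0 \<in> {diag n c |c. cartan_tuple X n c}"
        unfolding mem_Collect_eq by (rule exI[of _ "\<lambda>_. 0"]) (simp only: diag_linear, simp add: cartan_tuple_def)
    next
      fix x y assume "x \<in> {diag n c |c. cartan_tuple X n c}" "y \<in> {diag n c |c. cartan_tuple X n c}"
      then obtain c e where "x = diag n c" "cartan_tuple X n c" "y = diag n e" "cartan_tuple X n e" by blast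
      thus "x + y \<in> {diag n c |c. cartan_tuple X n c}"
        using add[of c e] diag_linear(1)[of n c e, symmetric] by blast
    next
      fix a x assume "x \<in> {diag n c |c. cartan_tuple X n c}"
      then obtain c where "x = diag n c" "cartan_tuple X n c" by blast
      thus "op_scale a x \<in> {diag n c |c. cartan_tuple X n c}"
        using sc[of c a] diag_linear(3)[of n a c, symmetric] by blast
    qed
  qed
  show "{diag n c |c. cartan_tuple X n c} \<subseteq> cartan X n"
  proof safe
    fix c assume c: "cartan_tuple X n c"
    show "diag n c \<in> cartan X n"
    proof (cases "so_type X")
      case False
      have "diag n c = (\<Sum>i=1..n. op_scale (c i) (fD (xi i) i))"
        by (simp add: diag_def vf_def fD_def op_scale_def gscale_def fun_eq_iff gmult_def
            sum_distrib_left mult_ac sum_apply)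
      also have "\<dots> \<in> opv.span (gl_cartan_basis n)"
        by (intro opv.span_scale opv.span_sum opv.span_base) (auto simp: gl_cartan_basis_def)
      finally show ?thesis using False by (cases X) (auto simp: so_type_def cartan_def)
    next
      case True
      have "diag n c \<in> opv.span (so_cartan_basis n)"
      proof (rule diag_in_span_so_cartan_basis)
        fix k assume "k \<in> {1..n}"
        hence "c k + c (conj_index n k) = c 1 + c (conj_index n 1)"
          using c True unfolding cartan_tuple_def by metis
        thus "c k + c (conj_index n k) = 2 * ((c 1 + c (conj_index n 1)) / 2)" by simp
      qed
      thus ?thesis using True by (auto simp: so_type_def cartan_def)
    qed
  qed
qed

section \<open>Weights of monomials\<close>

text \<open>
  On a diagonal field these are the \<open>c\<^sub>i\<close>; as a formula linear in the operator it is defined for all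
  operators.
\<close>

definition coord :: "oper \<Rightarrow> nat \<Rightarrow> complex" where
  "coord x i = x (xi i) {i}"

text \<open>
  The weight of \<open>\<xi>\<^sub>I D\<^sub>k\<close> as an element of \<open>cartan_dual\<close>, which requires the value 0 off the Cartan
  subalgebra.
\<close>

definition mwt :: "cartan_type \<Rightarrow> nat \<Rightarrow> nat \<Rightarrow> nat set \<Rightarrow> oper \<Rightarrow> complex" where
  "mwt X n k I = (\<lambda>x. if x \<in> cartan X n then wt (coord x) k I else 0)"

lemma coord_diag: "i \<in> {1..n} \<Longrightarrow> coord (diag n c) i = c i"
  unfolding coord_def diag_def by (subst vf_xi[OF diag_coeffs]) (simp_all add: gscale_def xi_def)

lemma wt_cong:
  assumes "\<And>i. i \<in> {1..n} \<Longrightarrow> c i = e i" "k \<in> {1..n}" "I \<subseteq> {1..n}"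
  shows "wt c k I = wt e k I"
proof -
  have "(\<Sum>a\<in>I. c a) = (\<Sum>a\<in>I. e a)" by (rule sum.cong) (use assms in auto)
  thus ?thesis using assms by (simp add: wt_def)
qed

lemma diag_in_cartan: "1 \<le> n \<Longrightarrow> cartan_tuple X n c \<Longrightarrow> diag n c \<in> cartan X n"
  using cartan_diag by blast

lemma mwt_diag:
  assumes "1 \<le> n" "cartan_tuple X n c" "k \<in> {1..n}" "I \<subseteq> {1..n}"
  shows "mwt X n k I (diag n c) = wt c k I"
proof -
  have "wt (coord (diag n c)) k I = wt c k I" by (rule wt_cong[OF coord_diag assms(3,4)])
  thus ?thesis unfolding mwt_def using diag_in_cartan[OF assms(1,2)] by simp
qed

lemma cartan_tuple_coord:
  assumes n: "1 \<le> n" and x: "x \<in> cartan X n"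
  shows "cartan_tuple X n (coord x)"
proof -
  obtain c where c: "x = diag n c" "cartan_tuple X n c" using x cartan_diag[OF n] by blast
  have e: "coord x k = c k" if "k \<in> {1..n}" for k unfolding c(1) by (rule coord_diag[OF that])
  show ?thesis unfolding cartan_tuple_def
  proof (intro impI ballI)
    fix k assume k: "so_type X" "k \<in> {1..n}"
    have "1 \<in> {1..n}" using n by simp
    thus "coord x k + coord x (conj_index n k) = coord x 1 + coord x (conj_index n 1)"
      using c(2) k e conj_index_range unfolding cartan_tuple_def by metis
  qed
qed

lemma mwt_cartan_dual: "mwt X n k I \<in> cartan_dual X n"
proof -
  have w: "wt (coord (x + y)) k I = wt (coord x) k I + wt (coord y) k I"
    "wt (coord (op_scale a x)) k I = a * wt (coord x) k I" for x y a
    by (simp_all add: wt_def coord_def op_scale_def sum.distrib sum_distrib_left algebra_simps)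
  have "x + y \<in> cartan X n" if "x \<in> cartan X n" "y \<in> cartan X n" for x y
    using that unfolding cartan_def by (rule opv.span_add)
  moreover have "op_scale a x \<in> cartan X n" if "x \<in> cartan X n" for a x
    using that unfolding cartan_def by (rule opv.span_scale)
  ultimately show ?thesis by (simp add: cartan_dual_def mwt_def w)
qed

lemma cartan_dual_eqI:
  assumes n: "1 \<le> n" and "\<alpha> \<in> cartan_dual X n" "\<beta> \<in> cartan_dual X n"
    and eq: "\<And>c. cartan_tuple X n c \<Longrightarrow> \<alpha> (diag n c) = \<beta> (diag n c)"
  shows "\<alpha> = \<beta>"
proof
  fix x
  show "\<alpha> x = \<beta> x"
  proof (cases "x \<in> cartan X n")
    case True
    then obtain c where "x = diag n c" "cartan_tuple X n c" using cartan_diag[OF n] by blast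
    thus ?thesis using eq by simp
  qed (use assms in \<open>auto simp: cartan_dual_def\<close>)
qed

lemma mwt_self: "mwt X n k {k} = 0"
  by (simp add: mwt_def wt_def fun_eq_iff)

text \<open>
  Evaluation at \<open>d_elt n\<close> gives \<open>|I| = 1\<close>. A diagonal field that separates \<open>k\<close> from the element of \<open>I\<close>
  then shows that they are equal.
\<close>

lemma mwt_zeroD:
  assumes n: "1 \<le> n" and k: "k \<in> {1..n}" and I: "I \<subseteq> {1..n}"
    and so: "so_type X \<Longrightarrow> conj_index n k \<notin> I" and z: "mwt X n k I = 0"
  shows "I = {k}"
proof -
  have w: "wt c k I = 0" if "cartan_tuple X n c" for c
    using mwt_diag[OF n that k I] z by simp
  have fin: "finite I" using I finite_subset by blast
  have one: "card I = 1"
    using w[of "\<lambda>_. 1"] by (simp add: cartan_tuple_def wt_def)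
  have "k \<in> I"
  proof (cases "so_type X")
    case False
    hence "cartan_tuple X n (\<lambda>a. if a = k then 1 else 0)" by (simp add: cartan_tuple_def)
    from w[OF this] show ?thesis using fin by (simp add: wt_def split: if_splits)
  next
    case True
    let ?m = "conj_index n"
    obtain b where b: "I = {b}" using one by (metis card_1_singletonE)
    show ?thesis
    proof (rule ccontr)
      assume "k \<notin> I"
      hence bk: "b \<noteq> k" "b \<noteq> ?m k" "b \<in> {1..n}" using b so[OF True] I by auto
      \<comment> \<open>The tuple with value 1 at \<open>a\<close>, -1 at its conjugate and 0 elsewhere separates \<open>a\<close> from any \<open>a'\<close>
        other than these two.\<close>
      have sep: False if "a \<in> {1..n}" "?m a \<noteq> a" "a' \<in> {1..n}" "a' \<noteq> a" "a' \<noteq> ?m a"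
          "{a, a'} = {k, b}" for a a'
      proof -
        let ?c = "\<lambda>j. (if j = a then 1 else 0) - (if j = ?m a then 1 else 0 :: complex)"
        have "?c j + ?c (?m j) = 0" if j: "j \<in> {1..n}" for j
        proof -
          have "?m j = a \<longleftrightarrow> j = ?m a" "?m j = ?m a \<longleftrightarrow> j = a"
            using conj_index_invol j that \<open>a \<in> {1..n}\<close> by metis+
          thus ?thesis by simp
        qed
        hence "cartan_tuple X n ?c" using n by (simp add: cartan_tuple_def)
        hence "?c b - ?c k = 0" using w[of ?c] b by (simp add: wt_def)
        moreover have "?c a = 1" "?c a' = 0" using that by auto
        ultimately show False using that(6) by (auto simp: doubleton_eq_iff)
      qed
      show False
      proof (cases "?m k = k")
        case False
        show False by (rule sep[of k b]) (use k bk False in auto)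
      next
        case kk: True
        show False
        proof (cases "?m b = b")
          case False
          show False by (rule sep[of b k])
            (use k bk False kk conj_index_invol[of b n] in auto)
        next
          case True
          hence "b = k" using kk k bk by (auto simp: conj_index_def Let_def split: if_splits)
          thus False using bk by simp
        qed
      qed
    qed
  qed
  thus ?thesis using one by (metis card_1_singletonE singletonD)
qed

lemma weight_compatible_mwt:
  assumes n: "1 \<le> n"
  shows "weight_compatible X n (\<lambda>k I. g (mwt X n k I))"
proof (cases "so_type X")
  case True
  let ?w = "\<lambda>M. g (\<lambda>x. if x \<in> cartan X n
     then (\<Sum>a\<in>M. coord x a) - (coord x 1 + coord x (conj_index n 1)) else 0)"
  have "g (mwt X n k I) = ?w (insert (conj_index n k) I)"
    if "k \<in> {1..n}" "I \<subseteq> {1..n}" "conj_index n k \<notin> I" for k I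
    unfolding mwt_def using wt_insert_conj[OF True cartan_tuple_coord[OF n]] that finite_subset[of I "{1..n}"]
    by (intro arg_cong[of _ _ g] ext) auto
  thus ?thesis unfolding weight_compatible_def using True by (intro exI[of _ ?w]) simp
next
  case False
  let ?w = "\<lambda>M. g (\<lambda>x. if x \<in> cartan X n then (\<Sum>a\<in>M. coord x a) else 0)"
  have "g (mwt X n k (insert k I)) = ?w I" if "I \<subseteq> {1..n}" "k \<notin> I" for k I
    unfolding mwt_def using that finite_subset[of I "{1..n}"]
    by (intro arg_cong[of _ _ g] ext) (auto simp: wt_insert)
  thus ?thesis unfolding weight_compatible_def using False by (intro exI[of _ ?w]) simp
qed

definition weight_part :: "cartan_type \<Rightarrow> nat \<Rightarrow> (oper \<Rightarrow> complex) \<Rightarrow> (nat \<Rightarrow> grass) \<Rightarrow> nat \<Rightarrow> grass" where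
  "weight_part X n \<alpha> F k = wscale (\<lambda>I. if mwt X n k I = \<alpha> then 1 else 0) (F k)"

lemma weight_part_coeffs: "F \<in> coeffs n \<Longrightarrow> weight_part X n \<alpha> F \<in> coeffs n"
  by (auto simp: coeffs_def weight_part_def intro: Lambda_wscale)

lemma wscale_linear: "wscale w (f + g) = wscale w f + wscale w g"
  by (simp add: wscale_def fun_eq_iff algebra_simps)

lemma lie_alg_coeffs_split:
  assumes F: "F \<in> coeffs n" "vf n F \<in> lie_alg X n"
  obtains G a where "G \<in> base_coeffs X n" "\<And>k. k \<in> {1..n} \<Longrightarrow> F k = G k + gscale a (xi k)"
proof -
  obtain G a where G: "G \<in> base_coeffs X n" "vf n F = vf n (\<lambda>k. G k + gscale a (xi k))"
    "(\<lambda>k. G k + gscale a (xi k)) \<in> coeffs n"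
    using F(2) by (rule lie_algE)
  have "F k = G k + gscale a (xi k)" if "k \<in> {1..n}" for k
    using vf_inj[OF F(1) G(3,2) that] .
  thus ?thesis using that G(1) by blast
qed

text \<open>
  Taking the component of a given weight rescales each monomial by a function of its weight.
\<close>

lemma weight_part_lie_alg:
  assumes n: "1 \<le> n" and F: "F \<in> coeffs n" "vf n F \<in> lie_alg X n"
  shows "vf n (weight_part X n \<alpha> F) \<in> lie_alg X n"
proof -
  obtain G a where G: "G \<in> base_coeffs X n" "\<And>k. k \<in> {1..n} \<Longrightarrow> F k = G k + gscale a (xi k)"
    using lie_alg_coeffs_split[OF F] by blast
  obtain K where K: "K \<in> base_coeffs X n"
      "\<forall>k\<in>{1..n}. K k = wscale (\<lambda>I. if mwt X n k I = \<alpha> then 1 else 0) (G k)"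
    using base_coeffs_reweight[OF G(1) weight_compatible_mwt[OF n, of X "\<lambda>\<beta>. if \<beta> = \<alpha> then 1 else 0"]] by blast
  have x: "wscale (\<lambda>I. if mwt X n k I = \<alpha> then 1 else 0) (gscale a (xi k)) =
      gscale (if \<alpha> = 0 then a else 0) (xi k)" for k
    by (auto simp: wscale_def gscale_def xi_def fun_eq_iff mwt_self)
  show ?thesis
    by (rule lie_algI[OF K(1)]) (simp add: weight_part_def G(2) K(2) wscale_linear x)
qed

text \<open>
  The weight space of weight 0 is the Cartan subalgebra. In the orthogonal case the two coefficients
  belonging to a pair \<open>{k, k'}\<close> come from the same coefficient of \<open>f\<close> and have opposite signs, which is the
  linear relation that defines the Cartan subalgebra.
\<close>

lemma zero_weight_cartan:
  assumes n: "1 \<le> n" and F: "F \<in> coeffs n" "vf n F \<in> lie_alg X n"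
    and z: "\<And>k I. k \<in> {1..n} \<Longrightarrow> F k I \<noteq> 0 \<Longrightarrow> mwt X n k I = 0"
  shows "vf n F \<in> cartan X n"
proof -
  obtain G a where G: "G \<in> base_coeffs X n" "\<And>k. k \<in> {1..n} \<Longrightarrow> F k = G k + gscale a (xi k)"
    using lie_alg_coeffs_split[OF F] by blast
  define c where "c k = F k {k}" for k
  have supp: "I = {k}" if k: "k \<in> {1..n}" and nz: "F k I \<noteq> 0" for k I
  proof (rule ccontr)
    assume ne: "I \<noteq> {k}"
    have I: "I \<subseteq> {1..n}" using nz coeffsD[OF F(1) k] by (auto simp: Lambda_def)
    have "conj_index n k \<notin> I" if so: "so_type X"
    proof
      assume "conj_index n k \<in> I"
      obtain N f where f: "G = hfield n f" using base_coeffs_so[OF so, of n] G(1) by auto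
      have "F k I = 0" unfolding G(2)[OF k] f using \<open>conj_index n k \<in> I\<close> ne
        by (simp add: hfield_def gderiv_def gscale_def xi_def)
      thus False using nz by simp
    qed
    from mwt_zeroD[OF n k I this z[OF k nz]] show False using ne by simp
  qed
  have "vf n F = diag n c"
    unfolding diag_def
  proof (rule vf_cong)
    fix k assume k: "k \<in> {1..n}"
    show "F k = gscale (c k) (xi k)"
      by (rule ext) (use supp[OF k] in \<open>auto simp: c_def gscale_def xi_def\<close>)
  qed
  moreover have "cartan_tuple X n c"
    unfolding cartan_tuple_def
  proof (intro impI ballI)
    assume so: "so_type X"
    obtain N f where f: "G = hfield n f" using base_coeffs_so[OF so, of n] G(1) by auto
    have "c k + c (conj_index n k) = 2 * a" if k: "k \<in> {1..n}" for k
    proof -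
      let ?m = "conj_index n k"
      have m: "?m \<in> {1..n}" "conj_index n ?m = k" using conj_index_range conj_index_invol k by blast+
      have "hfield n f k {k} + hfield n f ?m {?m} = 0"
      proof (cases "?m = k")
        case False
        have "inv_sign {?m} {k} = - inv_sign {k} {?m}"
          using inv_sign_swap_singleton[of "{?m}" k] False by simp
        thus ?thesis using False m
          by (simp add: hfield_def gderiv_inv_sign parity_sign_def insert_commute)
      qed (simp add: hfield_def gderiv_def m)
      thus ?thesis unfolding c_def G(2)[OF k] G(2)[OF m(1)] f
        by (simp add: gscale_def xi_def)
    qed
    moreover have "1 \<in> {1..n}" using n by simp
    ultimately show "c k + c (conj_index n k) = c 1 + c (conj_index n 1)" if "k \<in> {1..n}" for k
      using that by metis
  qed
  ultimately show ?thesis using diag_in_cartan[OF n] by simp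
qed

section \<open>Root spaces and sums of root spaces\<close>

definition weights_in :: "cartan_type \<Rightarrow> nat \<Rightarrow> (nat \<Rightarrow> grass) \<Rightarrow> (oper \<Rightarrow> complex) set \<Rightarrow> bool" where
  "weights_in X n F \<Psi> \<longleftrightarrow> (\<forall>k\<in>{1..n}. \<forall>I. F k I \<noteq> 0 \<longrightarrow> mwt X n k I \<in> \<Psi>)"

lemma root_space_iff:
  assumes n: "1 \<le> n" and F: "F \<in> coeffs n" and \<alpha>: "\<alpha> \<in> cartan_dual X n"
  shows "vf n F \<in> root_space X n \<alpha> \<longleftrightarrow> vf n F \<in> lie_alg X n \<and> weights_in X n F {\<alpha>}"
proof -
  have "superbracket (diag n c) (vf n F) = op_scale (\<alpha> (diag n c)) (vf n F) \<longleftrightarrow>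
      (\<forall>k\<in>{1..n}. \<forall>I. F k I \<noteq> 0 \<longrightarrow> mwt X n k I (diag n c) = \<alpha> (diag n c))"
    (is "?l \<longleftrightarrow> ?r") if c: "cartan_tuple X n c" for c
  proof -
    let ?A = "\<lambda>k. wscale (wt c k) (F k)" and ?B = "\<lambda>k. gscale (\<alpha> (diag n c)) (F k)"
    have AB: "?A \<in> coeffs n" "?B \<in> coeffs n"
      using F by (auto simp: coeffs_def intro: Lambda_wscale Lambda_linear)
    have "?l \<longleftrightarrow> vf n ?A = vf n ?B"
      by (simp only: superbracket_diag_left[OF F] vf_coeff_linear)
    also have "\<dots> \<longleftrightarrow> (\<forall>k\<in>{1..n}. ?A k = ?B k)"
      using vf_inj[OF AB] vf_cong[of n ?A ?B] by blast
    also have "\<dots> \<longleftrightarrow> ?r"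
    proof (rule ball_cong[OF refl])
      fix k assume k: "k \<in> {1..n}"
      have "mwt X n k I (diag n c) = wt c k I" if "F k I \<noteq> 0" for I
        using mwt_diag[OF n c k] coeffsD[OF F k] that by (auto simp: Lambda_def)
      thus "?A k = ?B k \<longleftrightarrow> (\<forall>I. F k I \<noteq> 0 \<longrightarrow> mwt X n k I (diag n c) = \<alpha> (diag n c))"
        by (auto simp: fun_eq_iff wscale_def gscale_def)
    qed
    finally show ?thesis .
  qed
  hence "vf n F \<in> root_space X n \<alpha> \<longleftrightarrow> vf n F \<in> lie_alg X n \<and>
      (\<forall>c. cartan_tuple X n c \<longrightarrow> (\<forall>k\<in>{1..n}. \<forall>I. F k I \<noteq> 0 \<longrightarrow> mwt X n k I (diag n c) = \<alpha> (diag n c)))"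
    unfolding root_space_def cartan_diag[OF n] by auto
  also have "(\<forall>c. cartan_tuple X n c \<longrightarrow> (\<forall>k\<in>{1..n}. \<forall>I. F k I \<noteq> 0 \<longrightarrow> mwt X n k I (diag n c) = \<alpha> (diag n c)))
      \<longleftrightarrow> weights_in X n F {\<alpha>}"
    unfolding weights_in_def using cartan_dual_eqI[OF n mwt_cartan_dual \<alpha>] by auto
  finally show ?thesis .
qed

lemma lie_alg_vf_coeffs:
  assumes "x \<in> lie_alg X n"
  obtains F where "F \<in> coeffs n" "x = vf n F"
  using assms lie_algE by metis

lemma min_n_ge: "min_n X \<le> n \<Longrightarrow> 3 \<le> n"
  by (cases X) auto

lemma min_n_ge_1: "min_n X \<le> n \<Longrightarrow> 1 \<le> n"
  by (cases X) auto

definition monomial :: "nat set \<Rightarrow> grass" where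
  "monomial M = (\<lambda>I. if I = M then 1 else 0)"

lemma monomial_Lambda: "M \<subseteq> {1..n} \<Longrightarrow> monomial M \<in> Lambda n"
  by (simp add: monomial_def Lambda_def)

lemma xi_monomial: "xi i = monomial {i}"
  by (simp add: xi_def monomial_def)

lemma gderiv_monomial:
  "gderiv k (monomial M) = (if k \<in> M then gscale (inv_sign {k} (M - {k})) (monomial (M - {k})) else 0)"
  by (auto simp: fun_eq_iff gderiv_inv_sign monomial_def gscale_def)

lemma hfield_monomial:
  "hfield n (monomial M) k = (let m = conj_index n k in
     if m \<in> M then gscale ((-1) ^ card M * inv_sign {m} (M - {m})) (monomial (M - {m})) else 0)"
proof -
  have "parity_sign (monomial M) = gscale ((-1) ^ card M) (monomial M)"
    by (auto simp: parity_sign_def monomial_def gscale_def fun_eq_iff)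
  thus ?thesis by (simp add: hfield_def gderiv_linear gderiv_monomial gscale_linear Let_def)
qed

lemma monomial_Ham: "M \<subseteq> {1..n} \<Longrightarrow> card M \<le> N \<Longrightarrow> monomial M \<in> Ham n N"
  unfolding Ham_def using monomial_Lambda[of M n] by (simp add: monomial_def)

text \<open>
  It suffices to consider the basis: \<open>\<xi>\<^sub>i D\<^sub>i - d / n\<close> is divergence-free, and the field
  \<open>\<xi>\<^sub>i D\<^sub>i - \<xi>\<^sub>j D\<^sub>j\<close> with \<open>j = i'\<close> is \<open>- D\<^sub>H(\<xi>\<^sub>i \<xi>\<^sub>j)\<close>.
\<close>

lemma cartan_lie_alg:
  assumes n: "min_n X \<le> n"
  shows "cartan X n \<subseteq> lie_alg X n"
  unfolding cartan_def
proof (rule opv.span_minimal[OF _ lie_alg_subspace], rule subsetI)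
  fix b assume b: "b \<in> cartan_basis X n"
  show "b \<in> lie_alg X n"
  proof (cases "so_type X")
    case False
    hence "b \<in> gl_cartan_basis n" using b by (cases X) (auto simp: so_type_def)
    then obtain i where i: "i \<in> {1..n}" "b = fD (xi i) i" by (auto simp: gl_cartan_basis_def)
    let ?c = "\<lambda>k. (if k = i then 1 else 0) - 1 / of_nat n :: complex"
    let ?F = "\<lambda>k. gscale (?c k) (xi k)"
    have "divergence n ?F = (\<Sum>k=1..n. gscale (?c k) (monomial {}))"
      by (simp add: divergence_def gderiv_linear xi_monomial gderiv_monomial gscale_linear)
    also have "\<dots> = gscale (\<Sum>k=1..n. ?c k) (monomial {})"
      by (simp add: fun_eq_iff sum_apply gscale_def sum_distrib_right)
    also have "(\<Sum>k=1..n. ?c k) = 0"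
      using i(1) by (simp add: sum_subtractf sum.delta)
    finally have "?F \<in> base_coeffs X n"
      using False diag_coeffs[of ?c n] by (cases X) (auto simp: so_type_def gscale_linear)
    hence "vf n (\<lambda>k. gscale (if k = i then 1 else 0) (xi k)) \<in> lie_alg X n"
      by (rule lie_algI[of _ _ _ _ "1 / of_nat n"]) (auto simp: gscale_def fun_eq_iff algebra_simps)
    thus ?thesis using fD_xi_diag[OF i(1)] by (simp only: i(2) diag_def)
  next
    case True
    hence "b \<in> so_cartan_basis n" using b by (auto simp: so_type_def)
    then consider "b = d_elt n" | i where "i \<in> {1..n div 2}"
        "b = fD (xi i) i - fD (xi (i + n div 2)) (i + n div 2)"
      by (auto simp: so_cartan_basis_def Let_def)
    thus ?thesis
    proof cases
      case 1
      thus ?thesis using d_elt_lie_alg by simp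
    next
      case 2
      let ?j = "i + n div 2"
      let ?f = "gscale (-1) (monomial {i, ?j})"
      have r: "i \<in> {1..n}" "?j \<in> {1..n}" "i \<noteq> ?j" using 2 by auto
      obtain N where N: "n - 1 \<le> N" "base_coeffs X n = hfield n ` Ham n N"
        using base_coeffs_so[OF True] by blast
      have "?f \<in> Ham n N"
        using r N(1) min_n_ge[OF n] by (intro Ham_linear monomial_Ham) auto
      hence "vf n (hfield n ?f) \<in> lie_alg X n" using N(2) by (intro base_lie_alg) blast
      moreover have "vf n (hfield n ?f) =
          vf n (\<lambda>k. gscale ((if k = i then 1 else 0) - (if k = ?j then 1 else 0)) (xi k))"
      proof (rule vf_cong)
        fix k assume k: "k \<in> {1..n}"
        have ij: "conj_index n k = i \<longleftrightarrow> k = ?j" "conj_index n k = ?j \<longleftrightarrow> k = i"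
          using 2(1) k by (auto simp: conj_index_def Let_def)
        have emp: "{(a, b). a \<in> {i} \<and> b \<in> {?j} \<and> b < a} = {}" by auto
        have s1: "inv_sign {i} {?j} = 1" unfolding inv_sign_def emp by simp
        have s2: "inv_sign {?j} {i} = - 1"
          using inv_sign_swap_singleton[of "{?j}" i] r s1 by simp
        have d: "{i, ?j} - {?j} = {i}" "{i, ?j} - {i} = {?j}" using r by auto
        have "hfield n ?f k = gscale (-1) (hfield n (monomial {i, ?j}) k)"
          by (simp add: hfield_linear)
        also have "\<dots> = gscale ((if k = i then 1 else 0) - (if k = ?j then 1 else 0)) (xi k)"
        proof -
          have c: "conj_index n i = ?j" "conj_index n ?j = i"
            using 2(1) by (auto simp: conj_index_def Let_def)
          consider "k = i" | "k = ?j" "k \<noteq> i" | "k \<noteq> i" "k \<noteq> ?j" by blast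
          thus ?thesis
          proof cases
            case 1
            thus ?thesis using r(3) by (simp add: hfield_monomial Let_def c d s2 gscale_linear xi_monomial)
          next
            case 2
            thus ?thesis using r(3) by (simp add: hfield_monomial Let_def c d s1 gscale_linear xi_monomial)
          next
            case 3
            thus ?thesis by (simp add: hfield_monomial Let_def ij gscale_linear)
          qed
        qed
        finally show "hfield n ?f k = gscale ((if k = i then 1 else 0) - (if k = ?j then 1 else 0)) (xi k)" .
      qed
      ultimately show ?thesis
        unfolding 2(2) fD_xi_diag[OF r(1)] fD_xi_diag[OF r(2)] diag_linear(2)[symmetric]
        by (simp only: diag_def)
    qed
  qed
qed

lemma cartan_weights:
  assumes n: "1 \<le> n" and x: "x \<in> cartan X n"
  obtains F where "F \<in> coeffs n" "x = vf n F" "weights_in X n F {0}"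
proof -
  obtain c where c: "x = diag n c" using x cartan_diag[OF n] by blast
  show ?thesis
    by (rule that[OF diag_coeffs[of c], folded diag_def, OF c])
      (auto simp: weights_in_def gscale_def xi_def mwt_self split: if_splits)
qed

text \<open>
  Membership in a sum of root spaces is decided by the weights of the monomials. It yields both the root
  decomposition of the algebra and the independence of root spaces. For the inclusion that is not a
  span argument, decompose the field into its finitely many weight components.
\<close>

lemma root_sum_iff:
  assumes m: "min_n X \<le> n" and F: "F \<in> coeffs n" and \<Psi>: "\<Psi> \<subseteq> roots X n"
  shows "vf n F \<in> root_sum X n \<Psi> \<longleftrightarrow> vf n F \<in> lie_alg X n \<and> weights_in X n F (insert 0 \<Psi>)"
proof
  note n = min_n_ge_1[OF m]
  let ?T = "{x \<in> lie_alg X n. \<forall>k\<in>{1..n}. \<forall>I. x (xi k) I \<noteq> 0 \<longrightarrow> mwt X n k I \<in> insert 0 \<Psi>}"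
  have T: "vf n G \<in> ?T \<longleftrightarrow> vf n G \<in> lie_alg X n \<and> weights_in X n G (insert 0 \<Psi>)" if "G \<in> coeffs n" for G
    using vf_xi[OF that] by (simp add: weights_in_def)
  have "root_sum X n \<Psi> \<subseteq> ?T"
    unfolding root_sum_def
  proof (rule opv.span_minimal)
    show "cartan X n \<union> (\<Union>\<alpha>\<in>\<Psi>. root_space X n \<alpha>) \<subseteq> ?T"
    proof
      fix x assume "x \<in> cartan X n \<union> (\<Union>\<alpha>\<in>\<Psi>. root_space X n \<alpha>)"
      then consider "x \<in> cartan X n" | \<alpha> where "\<alpha> \<in> \<Psi>" "x \<in> root_space X n \<alpha>" by blast
      thus "x \<in> ?T"
      proof cases
        case 1
        from cartan_weights[OF n 1] obtain G where G: "G \<in> coeffs n" "x = vf n G" "weights_in X n G {0}" .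
        have "vf n G \<in> lie_alg X n" using cartan_lie_alg[OF m] 1 G(2) by blast
        thus ?thesis using T[OF G(1)] G(2,3) by (simp add: weights_in_def)
      next
        case 2
        have "x \<in> lie_alg X n" using 2 by (auto simp: root_space_def)
        then obtain G where G: "G \<in> coeffs n" "x = vf n G" by (rule lie_alg_vf_coeffs)
        have "\<alpha> \<in> cartan_dual X n" using \<Psi> 2 by (auto simp: roots_def)
        hence "x \<in> lie_alg X n \<and> weights_in X n G {\<alpha>}" using root_space_iff[OF n G(1)] 2 G(2) by blast
        thus ?thesis using T[OF G(1)] G(2) 2(1) by (simp add: weights_in_def)
      qed
    qed
    show "opv.subspace ?T"
      unfolding opv.subspace_def
      using opv.subspace_0[OF lie_alg_subspace] opv.subspace_add[OF lie_alg_subspace]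
        opv.subspace_scale[OF lie_alg_subspace]
      by (simp add: op_scale_def) (metis add_0)
  qed
  moreover assume "vf n F \<in> root_sum X n \<Psi>"
  ultimately show "vf n F \<in> lie_alg X n \<and> weights_in X n F (insert 0 \<Psi>)" using T[OF F] by blast
next
  assume a: "vf n F \<in> lie_alg X n \<and> weights_in X n F (insert 0 \<Psi>)"
  note n = min_n_ge_1[OF m]
  define A where "A = (\<lambda>(k, I). mwt X n k I) ` ({1..n} \<times> Pow {1..n})"
  have fin: "finite A" unfolding A_def by auto
  have "vf n F = vf n (\<lambda>k. \<Sum>\<alpha>\<in>A. weight_part X n \<alpha> F k)"
  proof (rule vf_cong)
    fix k assume k: "k \<in> {1..n}"
    show "F k = (\<Sum>\<alpha>\<in>A. weight_part X n \<alpha> F k)"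
    proof
      fix I
      have "(\<Sum>\<alpha>\<in>A. weight_part X n \<alpha> F k) I = (\<Sum>\<alpha>\<in>A. if mwt X n k I = \<alpha> then F k I else 0)"
        unfolding sum_apply by (rule sum.cong) (auto simp: weight_part_def wscale_def)
      also have "\<dots> = (if mwt X n k I \<in> A then F k I else 0)" using fin by (simp add: sum.delta')
      also have "\<dots> = F k I"
      proof -
        have "mwt X n k I \<in> A" if "F k I \<noteq> 0"
          unfolding A_def using coeffsD[OF F k] that k
          by (intro rev_image_eqI[of "(k, I)"]) (auto simp: Lambda_def)
        thus ?thesis by auto
      qed
      finally show "F k I = (\<Sum>\<alpha>\<in>A. weight_part X n \<alpha> F k) I" ..
    qed
  qed
  also have "\<dots> = (\<Sum>\<alpha>\<in>A. vf n (weight_part X n \<alpha> F))" by (rule vf_coeff_sum)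
  also have "\<dots> \<in> root_sum X n \<Psi>"
    unfolding root_sum_def
  proof (rule opv.span_sum)
    fix \<alpha> assume "\<alpha> \<in> A"
    hence dual: "\<alpha> \<in> cartan_dual X n" by (auto simp: A_def mwt_cartan_dual)
    have P: "weight_part X n \<alpha> F \<in> coeffs n" "vf n (weight_part X n \<alpha> F) \<in> lie_alg X n"
      using weight_part_coeffs[OF F] weight_part_lie_alg[OF n F] a by blast+
    have s: "weights_in X n (weight_part X n \<alpha> F) {\<alpha>}"
      by (auto simp: weights_in_def weight_part_def wscale_def split: if_splits)
    consider "\<alpha> = 0" | "\<alpha> \<in> \<Psi>" | "\<alpha> \<notin> insert 0 \<Psi>" by blast
    thus "vf n (weight_part X n \<alpha> F) \<in> opv.span (cartan X n \<union> (\<Union>\<alpha>\<in>\<Psi>. root_space X n \<alpha>))"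
    proof cases
      case 1
      have "vf n (weight_part X n \<alpha> F) \<in> cartan X n"
        by (rule zero_weight_cartan[OF n P]) (use s 1 in \<open>auto simp: weights_in_def\<close>)
      thus ?thesis by (intro opv.span_base) blast
    next
      case 2
      thus ?thesis using root_space_iff[OF n P(1) dual] P(2) s by (intro opv.span_base) blast
    next
      case 3
      have "vf n (weight_part X n \<alpha> F) = vf n (\<lambda>k. 0)"
      proof (rule vf_cong)
        fix k assume k: "k \<in> {1..n}"
        show "weight_part X n \<alpha> F k = 0"
        proof
          fix I
          have "F k I \<noteq> 0 \<longrightarrow> mwt X n k I \<noteq> \<alpha>" using a 3 k unfolding weights_in_def by blast
          thus "weight_part X n \<alpha> F k I = 0 I" by (auto simp: weight_part_def wscale_def)
        qed
      qed
      thus ?thesis by (simp only: vf_coeff_linear opv.span_zero)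
    qed
  qed
  finally show "vf n F \<in> root_sum X n \<Psi>" .
qed

section \<open>The set of roots\<close>

text \<open>
  The monomials \<open>\<xi>\<^sub>I D\<^sub>k\<close> that occur in elements of the algebra without the summand \<open>d_elt n\<close>. For \<open>S\<close> the
  top monomial is excluded; \<open>D\<^sub>H(f)\<close> contains \<open>\<xi>\<^sub>I D\<^sub>k\<close> if \<open>f\<close> contains the monomial with index set
  \<open>I \<union> {k'}\<close>.
\<close>

fun root_monomial :: "cartan_type \<Rightarrow> nat \<Rightarrow> nat \<Rightarrow> nat set \<Rightarrow> bool" where
  "root_monomial W n k I \<longleftrightarrow> k \<in> {1..n} \<and> I \<subseteq> {1..n}"
| "root_monomial S_bar n k I \<longleftrightarrow> k \<in> {1..n} \<and> I \<subset> {1..n}"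
| "root_monomial H_bar n k I \<longleftrightarrow> k \<in> {1..n} \<and> conj_index n k \<notin> I \<and> insert (conj_index n k) I \<subset> {1..n}"
| "root_monomial CH_bar n k I \<longleftrightarrow> k \<in> {1..n} \<and> conj_index n k \<notin> I \<and> I \<subseteq> {1..n}"

lemma root_monomial_range: "root_monomial X n k I \<Longrightarrow> k \<in> {1..n}" "root_monomial X n k I \<Longrightarrow> I \<subseteq> {1..n}"
  by (cases X; auto)+

lemma hfield_nonzeroD:
  assumes "f \<in> Lambda n" "hfield n f k I \<noteq> 0"
  shows "conj_index n k \<notin> I" "f (insert (conj_index n k) I) \<noteq> 0" "insert (conj_index n k) I \<subseteq> {1..n}"
proof -
  show "conj_index n k \<notin> I" "f (insert (conj_index n k) I) \<noteq> 0"
    using assms(2) by (auto simp: hfield_def gderiv_def parity_sign_def split: if_splits)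
  thus "insert (conj_index n k) I \<subseteq> {1..n}" using assms(1) unfolding Lambda_def by blast
qed

lemma root_monomial_of_nonzero:
  assumes n: "min_n X \<le> n" and F: "F \<in> coeffs n" "vf n F \<in> lie_alg X n"
    and k: "k \<in> {1..n}" and nz: "F k I \<noteq> 0" and I: "I \<noteq> {k}"
  shows "root_monomial X n k I"
proof -
  obtain G a where G: "G \<in> base_coeffs X n" "\<And>k. k \<in> {1..n} \<Longrightarrow> F k = G k + gscale a (xi k)"
    using lie_alg_coeffs_split[OF F] by blast
  have GI: "G k I \<noteq> 0" using nz I unfolding G(2)[OF k] by (simp add: gscale_def xi_def)
  have c: "G \<in> coeffs n" using G(1) base_coeffs_coeffs by blast
  hence sub: "I \<subseteq> {1..n}" using GI coeffsD[OF c k] by (auto simp: Lambda_def)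
  show ?thesis
  proof (cases X)
    case W
    thus ?thesis using k sub by simp
  next
    case S_bar
    \<comment> \<open>A term \<open>\<xi>\<^sub>1 \<dots> \<xi>\<^sub>n D\<^sub>k\<close> would contribute to the divergence at \<open>{1..n} - {k}\<close>, to which no other
      monomial contributes.\<close>
    have "I \<noteq> {1..n}"
    proof
      assume e: "I = {1..n}"
      have "gderiv j (G j) ({1..n} - {k}) = 0" if "j \<in> {1..n}" "j \<noteq> k" for j
        using that by (simp add: gderiv_def)
      hence "divergence n G ({1..n} - {k}) = gderiv k (G k) ({1..n} - {k})"
        unfolding divergence_def sum_apply using k by (subst sum.remove[of _ k]) auto
      also have "\<dots> \<noteq> 0" using GI e k by (simp add: gderiv_inv_sign insert_absorb)
      finally show False using G(1) S_bar by simp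
    qed
    thus ?thesis using S_bar k sub by auto
  next
    case H_bar
    then obtain f where f: "f \<in> Ham n (n - 1)" "G = hfield n f" using G(1) by auto
    note h = hfield_nonzeroD[OF Ham_Lambda[OF f(1)] GI[unfolded f(2)]]
    have "card (insert (conj_index n k) I) \<le> n - 1" using f(1) h(2) unfolding Ham_def by blast
    hence "card (insert (conj_index n k) I) \<noteq> card {1..n}" using min_n_ge[OF n] by simp
    hence "insert (conj_index n k) I \<noteq> {1..n}" by metis
    thus ?thesis using H_bar k h by auto
  next
    case CH_bar
    then obtain f where f: "f \<in> Ham n n" "G = hfield n f" using G(1) by auto
    note h = hfield_nonzeroD[OF Ham_Lambda[OF f(1)] GI[unfolded f(2)]]
    thus ?thesis using CH_bar k by auto
  qed
qed

text \<open>
  A single monomial, or \<open>D\<^sub>H\<close> of one, is such an element, unless \<open>k \<in> I\<close> in the divergence-free case.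
  There one cancels the divergence by a multiple of \<open>\<xi>\<^sub>J D\<^sub>j\<close> with \<open>j \<notin> I\<close> and \<open>J = I - {k} \<union> {j}\<close>.
\<close>

lemma root_monomial_element:
  assumes "root_monomial X n k I"
  shows "\<exists>F \<in> base_coeffs X n. F k I \<noteq> 0"
proof -
  have k: "k \<in> {1..n}" and I: "I \<subseteq> {1..n}" using root_monomial_range assms by auto
  show ?thesis
  proof (cases "so_type X")
    case True
    let ?m = "conj_index n k"
    have m: "?m \<notin> I" "?m \<in> {1..n}" using assms True conj_index_range[OF k] by (auto simp: so_type_def)
    have "finite I" using I finite_subset by blast
    hence "card (insert ?m I) = Suc (card I)" using m by simp
    have "hfield n (monomial (insert ?m I)) k = gscale ((-1) ^ card (insert ?m I) * inv_sign {?m} I) (monomial I)"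
      using m by (simp add: hfield_monomial Let_def)
    hence nz: "hfield n (monomial (insert ?m I)) k I \<noteq> 0"
      by (simp add: gscale_def) (simp add: monomial_def)
    have sub: "insert ?m I \<subseteq> {1..n}" using I m by auto
    have "\<exists>N. base_coeffs X n = hfield n ` Ham n N \<and> monomial (insert ?m I) \<in> Ham n N"
    proof (cases "X = H_bar")
      case True
      hence "insert ?m I \<subset> {1..n}" using assms by auto
      hence "card (insert ?m I) < card {1..n}" by (intro psubset_card_mono) auto
      hence "monomial (insert ?m I) \<in> Ham n (n - 1)" using sub by (intro monomial_Ham) auto
      thus ?thesis using True by auto
    next
      case False
      thus ?thesis using True monomial_Lambda[OF sub] by (auto simp: so_type_def Ham_top intro!: exI[of _ n])
    qed
    thus ?thesis using nz by auto
  next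
    case False
    show ?thesis
    proof (cases "X = S_bar \<and> k \<in> I")
      case c: False
      let ?F = "\<lambda>j. if j = k then monomial I else 0"
      have "?F \<in> coeffs n" using monomial_Lambda[OF I] by (auto simp: coeffs_def Lambda_linear)
      moreover have "divergence n ?F = 0" if "X = S_bar"
        unfolding divergence_def using c that by (intro sum.neutral) (auto simp: gderiv_monomial gderiv_linear)
      ultimately have "?F \<in> base_coeffs X n" using False by (cases X) (auto simp: so_type_def)
      thus ?thesis by (intro bexI[of _ ?F]) (simp_all add: monomial_def)
    next
      case True
      hence "I \<subset> {1..n}" using assms by simp
      then obtain j where j: "j \<in> {1..n}" "j \<notin> I" by blast
      define J where "J = I - {k}"
      have J: "I = insert k J" "k \<notin> J" "j \<notin> J" "j \<noteq> k" "insert j J \<subseteq> {1..n}"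
        using True j I by (auto simp: J_def)
      let ?s = "- (inv_sign {k} J * inv_sign {j} J)"
      let ?F = "\<lambda>l. if l = k then monomial I else if l = j then gscale ?s (monomial (insert j J)) else 0"
      have "?F \<in> coeffs n"
        using monomial_Lambda[OF I] monomial_Lambda[OF J(5)] by (auto simp: coeffs_def Lambda_linear)
      moreover have "divergence n ?F = 0"
      proof -
        have "divergence n ?F = gderiv k (?F k) + (\<Sum>l\<in>{1..n} - {k}. gderiv l (?F l))"
          unfolding divergence_def by (rule sum.remove) (use k in auto)
        also have "(\<Sum>l\<in>{1..n} - {k}. gderiv l (?F l)) =
            gderiv j (?F j) + (\<Sum>l\<in>{1..n} - {k} - {j}. gderiv l (?F l))"
          by (rule sum.remove) (use j J in auto)
        also have "(\<Sum>l\<in>{1..n} - {k} - {j}. gderiv l (?F l)) = 0"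
          by (rule sum.neutral) (auto simp: gderiv_linear)
        also have "gderiv k (?F k) = gscale (inv_sign {k} J) (monomial J)"
          using J by (simp add: gderiv_monomial)
        also have "gderiv j (?F j) = gscale (- inv_sign {k} J) (monomial J)"
          using J by (simp add: gderiv_linear gderiv_monomial gscale_linear mult.assoc)
        finally show ?thesis by (simp add: gscale_def fun_eq_iff)
      qed
      ultimately have "?F \<in> base_coeffs X n" using True by simp
      thus ?thesis by (intro bexI[of _ ?F]) (simp_all add: monomial_def)
    qed
  qed
qed

lemma root_vector_monomial:
  assumes n: "1 \<le> n" and r: "\<alpha> \<in> roots X n"
  obtains F k I where "F \<in> coeffs n" "vf n F \<in> root_space X n \<alpha>" "vf n F \<in> lie_alg X n"
    "k \<in> {1..n}" "F k I \<noteq> 0" "mwt X n k I = \<alpha>"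
proof -
  have dual: "\<alpha> \<in> cartan_dual X n" using r by (simp add: roots_def)
  have "0 \<in> root_space X n \<alpha>"
    using root_space_iff[OF n coeffs_linear(1) dual] opv.subspace_0[OF lie_alg_subspace]
    by (simp add: vf_zero weights_in_def)
  then obtain x where x: "x \<in> root_space X n \<alpha>" "x \<noteq> 0"
    using r unfolding roots_def by auto
  have "x \<in> lie_alg X n" using x by (simp add: root_space_def)
  then obtain F where F: "F \<in> coeffs n" "x = vf n F" by (rule lie_alg_vf_coeffs)
  have s: "vf n F \<in> lie_alg X n" "weights_in X n F {\<alpha>}"
    using root_space_iff[OF n F(1) dual] x F by auto
  have "\<exists>k\<in>{1..n}. \<exists>I. F k I \<noteq> 0"
  proof (rule ccontr)
    assume "\<not> ?thesis"
    hence "vf n F = vf n 0" by (intro vf_cong) (auto simp: fun_eq_iff)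
    thus False using x F vf_zero by simp
  qed
  then obtain k I where k: "k \<in> {1..n}" "F k I \<noteq> 0" by blast
  have "mwt X n k I = \<alpha>" using s(2) k by (simp add: weights_in_def)
  thus ?thesis using that F(1) x(1) s(1) k unfolding F(2) by blast
qed

lemma roots_iff:
  assumes m: "min_n X \<le> n"
  shows "\<alpha> \<in> roots X n \<longleftrightarrow> \<alpha> \<noteq> 0 \<and> (\<exists>k I. root_monomial X n k I \<and> \<alpha> = mwt X n k I)"
proof
  note n = min_n_ge_1[OF m]
  assume r: "\<alpha> \<in> roots X n"
  hence a0: "\<alpha> \<noteq> 0" by (simp add: roots_def)
  obtain F k I where F: "F \<in> coeffs n" "vf n F \<in> lie_alg X n" and k: "k \<in> {1..n}" "F k I \<noteq> 0"
    and w: "mwt X n k I = \<alpha>"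
    using root_vector_monomial[OF n r] by blast
  hence "I \<noteq> {k}" using a0 mwt_self by auto
  hence "root_monomial X n k I" by (rule root_monomial_of_nonzero[OF m F k])
  thus "\<alpha> \<noteq> 0 \<and> (\<exists>k I. root_monomial X n k I \<and> \<alpha> = mwt X n k I)" using a0 w by blast
next
  note n = min_n_ge_1[OF m]
  assume "\<alpha> \<noteq> 0 \<and> (\<exists>k I. root_monomial X n k I \<and> \<alpha> = mwt X n k I)"
  then obtain k I where a: "\<alpha> \<noteq> 0" "root_monomial X n k I" "\<alpha> = mwt X n k I" by blast
  obtain F where F: "F \<in> base_coeffs X n" "F k I \<noteq> 0" using root_monomial_element[OF a(2)] by blast
  have c: "F \<in> coeffs n" using F base_coeffs_coeffs by blast
  let ?P = "weight_part X n \<alpha> F"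
  have dual: "\<alpha> \<in> cartan_dual X n" using a mwt_cartan_dual by simp
  have s: "weights_in X n ?P {\<alpha>}" by (auto simp: weights_in_def weight_part_def wscale_def split: if_splits)
  have P: "vf n ?P \<in> root_space X n \<alpha>"
    using root_space_iff[OF n weight_part_coeffs[OF c] dual] weight_part_lie_alg[OF n c base_lie_alg[OF F(1)]] s by blast
  have "vf n ?P \<noteq> 0"
  proof
    assume "vf n ?P = 0"
    hence "vf n ?P = vf n 0" by (simp add: vf_zero)
    hence "?P k = 0 k"
      using vf_inj[OF weight_part_coeffs[OF c] coeffs_linear(1) _ root_monomial_range(1)[OF a(2)]] by blast
    hence "?P k I = 0" by simp
    thus False using F a(3) by (simp add: weight_part_def wscale_def)
  qed
  hence "root_space X n \<alpha> \<noteq> {0}" using P by auto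
  thus "\<alpha> \<in> roots X n" using a dual by (simp add: roots_def)
qed

section \<open>Degrees of roots\<close>

definition deg_roots :: "cartan_type \<Rightarrow> nat \<Rightarrow> int \<Rightarrow> (oper \<Rightarrow> complex) set" where
  "deg_roots X n m = {\<alpha> \<in> roots X n. \<alpha> (d_elt n) = of_int m}"

text \<open>
  The largest size of \<open>I\<close>, respectively of \<open>I \<union> {k'}\<close> in the orthogonal case, among the monomials
  \<open>\<xi>\<^sub>I D\<^sub>k\<close> that occur.
\<close>

definition max_card :: "cartan_type \<Rightarrow> nat \<Rightarrow> nat" where
  "max_card X n = (if X = W \<or> X = CH_bar then n else n - 1)"

text \<open>
  The weight of \<open>D\<^sub>H(\<xi>\<^sub>M)\<close>. The sum that is subtracted is \<open>c\<^sub>k + c\<^bsub>k'\<^esub>\<close> for any \<open>k\<close>.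
\<close>

definition hwt :: "cartan_type \<Rightarrow> nat \<Rightarrow> nat set \<Rightarrow> oper \<Rightarrow> complex" where
  "hwt X n M = (\<lambda>x. if x \<in> cartan X n
     then (\<Sum>a\<in>M. coord x a) - (coord x 1 + coord x (conj_index n 1)) else 0)"

lemma max_card_ge_2: "min_n X \<le> n \<Longrightarrow> 2 \<le> max_card X n"
  by (cases X) (auto simp: max_card_def)

lemma mwt_degree:
  assumes "1 \<le> n" "k \<in> {1..n}" "I \<subseteq> {1..n}"
  shows "mwt X n k I (d_elt n) = of_int (int (card I) - 1)"
  unfolding d_elt_diag using assms by (subst mwt_diag) (auto simp: cartan_tuple_def wt_def)

lemma mwt_hwt:
  assumes "so_type X" "1 \<le> n" "k \<in> {1..n}" "I \<subseteq> {1..n}" "conj_index n k \<notin> I"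
  shows "mwt X n k I = hwt X n (insert (conj_index n k) I)"
  unfolding mwt_def hwt_def
  using wt_insert_conj[OF assms(1) cartan_tuple_coord[OF assms(2)] assms(3) _ assms(5)]
    finite_subset[OF assms(4)]
  by (intro ext) (simp only: finite_atLeastAtMost split: if_split, blast)

lemma mwt_add:
  assumes "1 \<le> n" "\<And>c. cartan_tuple X n c \<Longrightarrow> wt c k I + wt c l J = wt c j K"
  shows "mwt X n k I + mwt X n l J = mwt X n j K"
  using assms(2)[OF cartan_tuple_coord[OF assms(1)]] by (auto simp: mwt_def fun_eq_iff)

lemma hwt_add:
  assumes "1 \<le> n" "\<And>c. cartan_tuple X n c \<Longrightarrow>
     (\<Sum>a\<in>M. c a) + (\<Sum>a\<in>M'. c a) = (\<Sum>a\<in>K. c a) + (c 1 + c (conj_index n 1))"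
  shows "hwt X n M + hwt X n M' = hwt X n K"
proof
  fix x
  show "(hwt X n M + hwt X n M') x = hwt X n K x"
  proof (cases "x \<in> cartan X n")
    case True
    show ?thesis using assms(2)[OF cartan_tuple_coord[OF assms(1) True]] True
      by (simp add: hwt_def algebra_simps)
  qed (simp add: hwt_def)
qed

lemma roots_mwt_gl:
  assumes m: "min_n X \<le> n" and gl: "\<not> so_type X"
  shows "\<alpha> \<in> roots X n \<longleftrightarrow> \<alpha> \<noteq> 0 \<and>
    (\<exists>k I. k \<in> {1..n} \<and> I \<subseteq> {1..n} \<and> card I \<le> max_card X n \<and> \<alpha> = mwt X n k I)"
proof -
  have "root_monomial X n k I \<longleftrightarrow> k \<in> {1..n} \<and> I \<subseteq> {1..n} \<and> card I \<le> max_card X n" for k I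
  proof (cases "X = W")
    case True
    thus ?thesis using card_mono[of "{1..n}" I] by (auto simp: max_card_def)
  next
    case False
    hence S: "X = S_bar" using gl by (cases X) (auto simp: so_type_def)
    have "I \<noteq> {1..n} \<longleftrightarrow> card I \<le> n - 1" if "I \<subseteq> {1..n}"
    proof -
      have "card I \<le> n" using card_mono[OF _ that] by simp
      moreover have "I = {1..n} \<longleftrightarrow> card I = n" using card_subset_eq[OF _ that] by auto
      ultimately show ?thesis using min_n_ge[OF m] by auto
    qed
    thus ?thesis using S by (auto simp: max_card_def)
  qed
  thus ?thesis unfolding roots_iff[OF m] by auto
qed

lemma roots_hwt_so:
  assumes m: "min_n X \<le> n" and so: "so_type X"
  shows "\<alpha> \<in> roots X n \<longleftrightarrow> \<alpha> \<noteq> 0 \<and>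
    (\<exists>M. M \<subseteq> {1..n} \<and> M \<noteq> {} \<and> card M \<le> max_card X n \<and> \<alpha> = hwt X n M)"
proof -
  note n = min_n_ge_1[OF m]
  have root_monomial: "root_monomial X n k I \<longleftrightarrow> k \<in> {1..n} \<and> conj_index n k \<notin> I \<and> I \<subseteq> {1..n} \<and>
      card (insert (conj_index n k) I) \<le> max_card X n" for k I
  proof (cases "k \<in> {1..n} \<and> I \<subseteq> {1..n}")
    case True
    hence s: "insert (conj_index n k) I \<subseteq> {1..n}" using conj_index_range[of k n] by blast
    have "card (insert (conj_index n k) I) \<le> n" using card_mono[OF _ s] by simp
    moreover have "insert (conj_index n k) I = {1..n} \<longleftrightarrow> card (insert (conj_index n k) I) = n"
      using card_subset_eq[OF _ s] by auto
    ultimately have "insert (conj_index n k) I \<noteq> {1..n} \<longleftrightarrow> card (insert (conj_index n k) I) \<le> n - 1"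
      "card (insert (conj_index n k) I) \<le> n"
      using n by auto
    hence "insert (conj_index n k) I \<subset> {1..n} \<longleftrightarrow> card (insert (conj_index n k) I) \<le> n - 1"
      "card (insert (conj_index n k) I) \<le> n"
      unfolding psubset_eq using s by blast+
    thus ?thesis using so True by (cases X) (simp_all only: root_monomial.simps so_type_def max_card_def, simp_all)
  next
    case False
    hence "\<not> root_monomial X n k I" using root_monomial_range by blast
    thus ?thesis using False by blast
  qed
  have "(\<exists>k I. root_monomial X n k I \<and> \<alpha> = mwt X n k I) \<longleftrightarrow>
    (\<exists>M. M \<subseteq> {1..n} \<and> M \<noteq> {} \<and> card M \<le> max_card X n \<and> \<alpha> = hwt X n M)" (is "?l \<longleftrightarrow> ?r")
  proof
    assume ?l
    then obtain k I where k: "root_monomial X n k I" "\<alpha> = mwt X n k I" by blast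
    hence "\<alpha> = hwt X n (insert (conj_index n k) I)" using root_monomial mwt_hwt[OF so n] by simp
    thus ?r using k(1) conj_index_range[of k n] unfolding root_monomial
      by (intro exI[of _ "insert (conj_index n k) I"]) auto
  next
    assume ?r
    then obtain M where M: "M \<subseteq> {1..n}" "M \<noteq> {}" "card M \<le> max_card X n" "\<alpha> = hwt X n M" by blast
    then obtain j where j: "j \<in> M" "j \<in> {1..n}" by blast
    let ?k = "conj_index n j"
    have k: "?k \<in> {1..n}" "conj_index n ?k = j" using conj_index_range conj_index_invol j by blast+
    have e: "insert (conj_index n ?k) (M - {j}) = M" "M - {j} \<subseteq> {1..n}" using k j M by auto
    have "root_monomial X n ?k (M - {j})" using M(3) e k unfolding root_monomial by auto
    moreover have "mwt X n ?k (M - {j}) = hwt X n M"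
      using mwt_hwt[OF so n k(1) e(2)] k e by simp
    ultimately show ?l using M(4) by (intro exI[of _ ?k] exI[of _ "M - {j}"]) simp
  qed
  thus ?thesis unfolding roots_iff[OF m] by simp
qed

lemma hwt_degree:
  assumes "1 \<le> n" "M \<subseteq> {1..n}"
  shows "hwt X n M (d_elt n) = of_int (int (card M) - 2)"
proof -
  have "d_elt n \<in> cartan X n"
    unfolding d_elt_diag by (rule diag_in_cartan[OF assms(1)]) (simp add: cartan_tuple_def)
  moreover have c: "coord (d_elt n) a = 1" if "a \<in> {1..n}" for a
    using coord_diag[OF that] by (simp add: d_elt_diag)
  hence "coord (d_elt n) 1 + coord (d_elt n) (conj_index n 1) = 2"
    using assms(1) conj_index_range[of 1 n] by simp
  moreover have "(\<Sum>a\<in>M. coord (d_elt n) a) = (\<Sum>a\<in>M. 1)"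
    by (rule sum.cong) (use c assms in auto)
  ultimately show ?thesis by (simp add: hwt_def)
qed

lemma deg_roots_glI:
  assumes "min_n X \<le> n" "\<not> so_type X" "k \<in> {1..n}" "I \<subseteq> {1..n}" "card I \<le> max_card X n"
    "I \<noteq> {k}" "int (card I) = m + 1"
  shows "mwt X n k I \<in> deg_roots X n m"
proof -
  note n = min_n_ge_1[OF assms(1)]
  have "mwt X n k I \<noteq> 0" using mwt_zeroD[OF n assms(3,4)] assms(2,6) by blast
  hence "mwt X n k I \<in> roots X n" using roots_mwt_gl[OF assms(1,2)] assms by blast
  thus ?thesis using mwt_degree[OF n assms(3,4)] assms(7) by (simp add: deg_roots_def)
qed

lemma deg_roots_glE:
  assumes "min_n X \<le> n" "\<not> so_type X" "\<alpha> \<in> deg_roots X n m"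
  obtains k I where "\<alpha> = mwt X n k I" "k \<in> {1..n}" "I \<subseteq> {1..n}" "card I \<le> max_card X n"
    "int (card I) = m + 1"
proof -
  note n = min_n_ge_1[OF assms(1)]
  obtain k I where k: "\<alpha> = mwt X n k I" "k \<in> {1..n}" "I \<subseteq> {1..n}" "card I \<le> max_card X n"
    using assms(3) roots_mwt_gl[OF assms(1,2)] unfolding deg_roots_def by blast
  have "(of_int (int (card I) - 1) :: complex) = of_int m"
    using mwt_degree[OF n k(2,3), of X] assms(3) k(1) unfolding deg_roots_def by simp
  hence "int (card I) - 1 = m" by (simp only: of_int_eq_iff)
  thus ?thesis using that[OF k] by simp
qed

lemma deg_roots_soI:
  assumes "min_n X \<le> n" "so_type X" "M \<subseteq> {1..n}" "card M \<le> max_card X n" "M \<noteq> {}"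
    "int (card M) = m + 2" "m \<noteq> 0 \<or> (\<exists>a b. M = {a, b} \<and> a \<noteq> b \<and> b \<noteq> conj_index n a)"
  shows "hwt X n M \<in> deg_roots X n m"
proof -
  note n = min_n_ge_1[OF assms(1)]
  have d: "hwt X n M (d_elt n) = of_int m" using hwt_degree[OF n assms(3)] assms(6) by simp
  have "hwt X n M \<noteq> 0"
  proof (cases "m = 0")
    case True
    then obtain a b where ab: "M = {a, b}" "a \<noteq> b" "b \<noteq> conj_index n a" using assms(7) by blast
    have a: "a \<in> {1..n}" "b \<in> {1..n}" using ab assms(3) by auto
    let ?k = "conj_index n a"
    have k: "?k \<in> {1..n}" "conj_index n ?k = a" using conj_index_range conj_index_invol a by blast+
    have "mwt X n ?k {b} = hwt X n M" using mwt_hwt[OF assms(2) n k(1), of "{b}"] k ab a by simp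
    moreover have "mwt X n ?k {b} \<noteq> 0"
      using mwt_zeroD[OF n k(1), of "{b}" X] a ab k by auto
    ultimately show ?thesis by simp
  next
    case False
    show ?thesis
    proof
      assume "hwt X n M = 0"
      thus False using d False by simp
    qed
  qed
  hence "hwt X n M \<in> roots X n" using roots_hwt_so[OF assms(1,2)] assms by blast
  thus ?thesis using d by (simp add: deg_roots_def)
qed

lemma deg_roots_soE:
  assumes "min_n X \<le> n" "so_type X" "\<alpha> \<in> deg_roots X n m"
  obtains M where "\<alpha> = hwt X n M" "M \<subseteq> {1..n}" "M \<noteq> {}" "card M \<le> max_card X n"
    "int (card M) = m + 2"
proof -
  note n = min_n_ge_1[OF assms(1)]
  obtain M where M: "\<alpha> = hwt X n M" "M \<subseteq> {1..n}" "M \<noteq> {}" "card M \<le> max_card X n"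
    using assms(3) roots_hwt_so[OF assms(1,2)] unfolding deg_roots_def by blast
  have "(of_int (int (card M) - 2) :: complex) = of_int m"
    using hwt_degree[OF n M(2), of X] assms(3) M(1) unfolding deg_roots_def by simp
  hence "int (card M) - 2 = m" by (simp only: of_int_eq_iff)
  thus ?thesis using that[OF M] by simp
qed

lemma root_degree:
  assumes m: "min_n X \<le> n" and r: "\<alpha> \<in> roots X n"
  obtains d where "d \<ge> - 1" "\<alpha> \<in> deg_roots X n d"
proof -
  note n = min_n_ge_1[OF m]
  obtain k I where k: "root_monomial X n k I" "\<alpha> = mwt X n k I" using r roots_iff[OF m] by blast
  show ?thesis
    by (rule that[of "int (card I) - 1"])
      (use r mwt_degree[OF n root_monomial_range[OF k(1)], of X] k(2) in \<open>auto simp: deg_roots_def\<close>)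
qed

section \<open>Closed sets containing the roots of degree 0\<close>

lemma card_exchange:
  assumes "finite K" "x \<in> K" "y \<notin> K"
  shows "card (insert y (K - {x})) = card K"
  using assms card_Suc_Diff1[of K x] by simp

text \<open>
  Exchanging an element of \<open>I - J\<close> for one of \<open>J - I\<close> makes \<open>I - J\<close> smaller.
\<close>

lemma exchange_induct:
  assumes "finite S" "I \<subseteq> S" "J \<subseteq> S" "card I = card J" "P I"
    and step: "\<And>K a b. K \<subseteq> S \<Longrightarrow> card K = card J \<Longrightarrow> P K \<Longrightarrow> a \<in> K \<Longrightarrow> b \<in> S - K \<Longrightarrow>
      P (insert b (K - {a}))"
  shows "P J"
  using assms(2,4,5)
proof (induction "card (I - J)" arbitrary: I rule: less_induct)
  case less
  have fin: "finite I" "finite J" using less.prems assms finite_subset by blast+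
  show ?case
  proof (cases "I - J = {}")
    case True
    hence "I = J" using less.prems card_subset_eq[OF fin(2), of I] by auto
    thus ?thesis using less.prems by simp
  next
    case False
    then obtain a where a: "a \<in> I" "a \<notin> J" by blast
    have "card (I - J) = card (J - I)"
      using fin less.prems(2) card_Diff_subset_Int[of I J] card_Diff_subset_Int[of J I]
      by (simp add: Int_commute)
    hence "J - I \<noteq> {}" using False fin by (metis card_0_eq finite_Diff)
    then obtain b where b: "b \<in> J" "b \<notin> I" by blast
    let ?K = "insert b (I - {a})"
    have "?K - J = (I - J) - {a}" using a b by auto
    hence "card (?K - J) < card (I - J)" using a fin by (metis Diff_iff card_Diff1_less finite_Diff)
    moreover have "?K \<subseteq> S" using less.prems b assms(3) by auto
    moreover have "card ?K = card J"
      using card_exchange[OF fin(1) a(1) b(2)] less.prems(2) by simp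
    moreover have "P ?K" by (rule step) (use less.prems a b assms(3) in auto)
    ultimately show ?thesis by (rule less.hyps)
  qed
qed

lemma closed_rootsD:
  "closed_roots X n \<Psi> \<Longrightarrow> \<alpha> \<in> \<Psi> \<Longrightarrow> \<beta> \<in> \<Psi> \<Longrightarrow> \<alpha> + \<beta> \<in> deg_roots X n m \<Longrightarrow> \<alpha> + \<beta> \<in> \<Psi>"
  by (auto simp: closed_roots_def deg_roots_def)

text \<open>
  The degree-0 roots \<open>\<epsilon>\<^sub>y - \<epsilon>\<^sub>x\<close> exchange the derivation index \<open>k\<close> and the elements of \<open>I\<close>. As
  \<open>d \<noteq> 0\<close>, no intermediate weight is 0.
\<close>

lemma deg_roots_connected_gl:
  assumes m: "min_n X \<le> n" and gl: "\<not> so_type X"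
    and closed: "closed_roots X n \<Psi>" and zero: "deg_roots X n 0 \<subseteq> \<Psi>"
    and d: "d \<noteq> 0" and a: "\<alpha> \<in> \<Psi>" "\<alpha> \<in> deg_roots X n d" and b: "\<beta> \<in> deg_roots X n d"
  shows "\<beta> \<in> \<Psi>"
proof -
  note n = min_n_ge_1[OF m] and max_card = max_card_ge_2[OF m]
  obtain k I where k: "\<alpha> = mwt X n k I" "k \<in> {1..n}" "I \<subseteq> {1..n}" "card I \<le> max_card X n" "int (card I) = d + 1"
    using deg_roots_glE[OF m gl a(2)] by blast
  obtain l J where l: "\<beta> = mwt X n l J" "l \<in> {1..n}" "J \<subseteq> {1..n}" "card J \<le> max_card X n" "int (card J) = d + 1"
    using deg_roots_glE[OF m gl b] by blast
  have mem: "mwt X n l K \<in> deg_roots X n d" if "K \<subseteq> {1..n}" "card K = card J" for K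
    by (rule deg_roots_glI[OF m gl l(2)]) (use that l d in auto)
  have ex: "mwt X n x {y} \<in> \<Psi>" if "x \<in> {1..n}" "y \<in> {1..n}" "x \<noteq> y" for x y
    using deg_roots_glI[OF m gl that(1), of "{y}" 0] that zero max_card by auto
  have cIJ: "card I = card J" using k l by simp
  have "mwt X n l I \<in> \<Psi>"
  proof (cases "k = l")
    case False
    have e: "mwt X n k I + mwt X n l {k} = mwt X n l I" by (rule mwt_add[OF n]) (simp add: wt_def)
    show ?thesis
      using closed_rootsD[OF closed, of "mwt X n k I" "mwt X n l {k}" d] a(1) k ex[of l k] l(2) False
        mem[OF k(3) cIJ] by (simp add: e)
  qed (use a k in simp)
  hence "mwt X n l J \<in> \<Psi>"
  proof (rule exchange_induct[OF _ k(3) l(3) cIJ, rotated])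
    fix K x y assume K: "K \<subseteq> {1..n}" "card K = card J" "mwt X n l K \<in> \<Psi>" "x \<in> K" "y \<in> {1..n} - K"
    let ?K = "insert y (K - {x})"
    have fin: "finite K" using K finite_subset by blast
    have e: "mwt X n l K + mwt X n x {y} = mwt X n l ?K"
      using K fin by (intro mwt_add[OF n]) (simp add: wt_def sum_diff1)
    have "card ?K = card J" using K card_exchange[OF fin] by auto
    hence "mwt X n l ?K \<in> deg_roots X n d" using K by (intro mem) auto
    moreover have "mwt X n x {y} \<in> \<Psi>" by (rule ex) (use K in auto)
    ultimately show "mwt X n l ?K \<in> \<Psi>"
      using closed_rootsD[OF closed K(3), of "mwt X n x {y}" d] by (simp add: e)
  qed simp
  thus ?thesis using l by simp
qed

text \<open>
  Exchanging \<open>x\<close> for \<open>y\<close> in \<open>M\<close> adds the weight of \<open>D\<^sub>H(\<xi>\<^bsub>x'\<^esub> \<xi>\<^sub>y)\<close>, which is a root if \<open>y \<noteq> x'\<close>.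
\<close>

lemma deg_roots_connected_so:
  assumes m: "min_n X \<le> n" and so: "so_type X"
    and closed: "closed_roots X n \<Psi>" and zero: "deg_roots X n 0 \<subseteq> \<Psi>"
    and d: "d \<noteq> 0" and a: "\<alpha> \<in> \<Psi>" "\<alpha> \<in> deg_roots X n d" and b: "\<beta> \<in> deg_roots X n d"
  shows "\<beta> \<in> \<Psi>"
proof -
  note n = min_n_ge_1[OF m] and max_card = max_card_ge_2[OF m]
  obtain I where k: "\<alpha> = hwt X n I" "I \<subseteq> {1..n}" "I \<noteq> {}" "card I \<le> max_card X n" "int (card I) = d + 2"
    using deg_roots_soE[OF m so a(2)] by blast
  obtain J where l: "\<beta> = hwt X n J" "J \<subseteq> {1..n}" "J \<noteq> {}" "card J \<le> max_card X n" "int (card J) = d + 2"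
    using deg_roots_soE[OF m so b] by blast
  have cIJ: "card I = card J" using k l by simp
  have swap: "hwt X n (insert y (K - {x})) \<in> \<Psi>"
    if K: "K \<subseteq> {1..n}" "card K = card J" "hwt X n K \<in> \<Psi>" "x \<in> K" "y \<in> {1..n}" "y \<notin> K"
      "y \<noteq> conj_index n x" for K x y
  proof -
    let ?K = "insert y (K - {x})" and ?m = "conj_index n x"
    have fin: "finite K" using K finite_subset by blast
    have x: "x \<in> {1..n}" "?m \<in> {1..n}" "conj_index n ?m = x"
      using K conj_index_range conj_index_invol by blast+
    have "?m \<noteq> y" "y \<noteq> conj_index n ?m" using K x by auto
    hence "hwt X n {?m, y} \<in> deg_roots X n 0"
      using x K max_card by (intro deg_roots_soI[OF m so] disjI2 exI[of _ ?m] exI[of _ y]) simp_all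
    hence r: "hwt X n {?m, y} \<in> \<Psi>" using zero by blast
    have e: "hwt X n K + hwt X n {?m, y} = hwt X n ?K"
    proof (rule hwt_add[OF n])
      fix c assume "cartan_tuple X n c"
      hence "c 1 + c (conj_index n 1) = c x + c ?m" using so x unfolding cartan_tuple_def by metis
      thus "(\<Sum>a\<in>K. c a) + (\<Sum>a\<in>{?m, y}. c a) = (\<Sum>a\<in>?K. c a) + (c 1 + c (conj_index n 1))"
        using K fin by (simp only:) (simp add: sum_diff1)
    qed
    have "card ?K = card J" using K card_exchange[OF fin] by auto
    hence "hwt X n ?K \<in> deg_roots X n d" using K l d by (intro deg_roots_soI[OF m so]) auto
    thus ?thesis using closed_rootsD[OF closed K(3) r, of d] by (simp add: e)
  qed
  have "hwt X n J \<in> \<Psi>"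
  proof (rule exchange_induct[OF _ k(2) l(2) cIJ])
    fix K x y assume K: "K \<subseteq> {1..n}" "card K = card J" "hwt X n K \<in> \<Psi>" "x \<in> K" "y \<in> {1..n} - K"
    have x: "x \<in> {1..n}" using K by blast
    have fin: "finite K" using K(1) finite_subset by blast
    show "hwt X n (insert y (K - {x})) \<in> \<Psi>"
    proof (cases "y = conj_index n x")
      case False
      thus ?thesis using swap[OF K(1-4)] K(5) by blast
    next
      case True
      have yx: "conj_index n y = x" using True conj_index_invol[OF x] by simp
      \<comment> \<open>To exchange \<open>x\<close> for its conjugate \<open>y\<close>, use a third index \<open>z\<close>: exchange \<open>x\<close> for \<open>z\<close> and then
        \<open>z\<close> for \<open>y\<close>, or, if \<open>z \<in> K\<close>, first \<open>z\<close> for \<open>y\<close> and then \<open>x\<close> for \<open>z\<close>.\<close>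
      have "\<not> {1..n} \<subseteq> {x, y}"
      proof
        assume "{1..n} \<subseteq> {x, y}"
        hence "card {1..n} \<le> card {x, y}" by (intro card_mono) auto
        moreover have "card {x, y} \<le> 2" by (simp add: card_insert_if)
        ultimately show False using min_n_ge[OF m] by simp
      qed
      then obtain z where z: "z \<in> {1..n}" "z \<noteq> x" "z \<noteq> y" by blast
      have zy: "y \<noteq> conj_index n z" "z \<noteq> conj_index n x"
        using conj_index_invol[OF z(1)] yx z True by auto
      show ?thesis
      proof (cases "z \<in> K")
        case True
        let ?L = "insert y (K - {z})"
        have 1: "hwt X n ?L \<in> \<Psi>" using swap[OF K(1-3) True, of y] K(5) zy by blast
        have "hwt X n (insert z (?L - {x})) \<in> \<Psi>"
          by (rule swap[OF _ _ 1]) (use K True z zy card_exchange[OF fin True, of y] in auto)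
        moreover have "insert z (?L - {x}) = insert y (K - {x})" using K True z by auto
        ultimately show ?thesis by simp
      next
        case False
        let ?L = "insert z (K - {x})"
        have 1: "hwt X n ?L \<in> \<Psi>" using swap[OF K(1-4) z(1) False zy(2)] .
        have "hwt X n (insert y (?L - {z})) \<in> \<Psi>"
          by (rule swap[OF _ _ 1]) (use K False z zy card_exchange[OF fin K(4) False] in auto)
        moreover have "insert y (?L - {z}) = insert y (K - {x})" using K False z by auto
        ultimately show ?thesis by simp
      qed
    qed
  qed (use a k in simp_all)
  thus ?thesis using l by simp
qed

lemma deg_roots_connected:
  assumes "min_n X \<le> n" "closed_roots X n \<Psi>" "deg_roots X n 0 \<subseteq> \<Psi>" "d \<noteq> 0"
    "\<Psi> \<inter> deg_roots X n d \<noteq> {}"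
  shows "deg_roots X n d \<subseteq> \<Psi>"
  using assms deg_roots_connected_gl[OF assms(1) _ assms(2,3,4)] deg_roots_connected_so[OF assms(1) _ assms(2,3,4)]
  by blast

text \<open>
  A root of degree -1 removes an element of \<open>I\<close> (of \<open>M\<close> in the orthogonal case).
\<close>

lemma deg_roots_down:
  assumes m: "min_n X \<le> n" and d: "2 \<le> d" and ne: "deg_roots X n d \<noteq> {}"
  shows "\<exists>\<alpha>\<in>deg_roots X n d. \<exists>\<beta>\<in>deg_roots X n (- 1). \<alpha> + \<beta> \<in> deg_roots X n (d - 1)"
proof -
  note n = min_n_ge_1[OF m] and max_card = max_card_ge_2[OF m]
  obtain \<alpha> where \<alpha>: "\<alpha> \<in> deg_roots X n d" using ne by blast
  show ?thesis
  proof (cases "so_type X")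
    case False
    obtain k I where k: "\<alpha> = mwt X n k I" "k \<in> {1..n}" "I \<subseteq> {1..n}" "card I \<le> max_card X n" "int (card I) = d + 1"
      using deg_roots_glE[OF m False \<alpha>] by blast
    have fin: "finite I" using k finite_subset by blast
    have "I \<noteq> {}" using k(5) d by auto
    then obtain a where a: "a \<in> I" by blast
    have cI: "Suc (card (I - {a})) = card I" by (rule card_Suc_Diff1[OF fin a])
    have "mwt X n a {} \<in> deg_roots X n (- 1)"
      by (rule deg_roots_glI[OF m False]) (use a k in auto)
    moreover have e: "mwt X n k I + mwt X n a {} = mwt X n k (I - {a})"
      by (rule mwt_add[OF n]) (use a fin in \<open>simp add: wt_def sum_diff1\<close>)
    have "mwt X n k (I - {a}) \<in> deg_roots X n (d - 1)"
    proof (rule deg_roots_glI[OF m False k(2)])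
      show "I - {a} \<noteq> {k}" by (rule notI) (use cI k(5) d in simp)
    qed (use k cI in auto)
    ultimately show ?thesis using \<alpha> e k(1) by metis
  next
    case True
    obtain M where k: "\<alpha> = hwt X n M" "M \<subseteq> {1..n}" "M \<noteq> {}" "card M \<le> max_card X n" "int (card M) = d + 2"
      using deg_roots_soE[OF m True \<alpha>] by blast
    have fin: "finite M" using k finite_subset by blast
    obtain a where a: "a \<in> M" using k by blast
    have cM: "Suc (card (M - {a})) = card M" by (rule card_Suc_Diff1[OF fin a])
    have x: "a \<in> {1..n}" "conj_index n a \<in> {1..n}" using a k conj_index_range by blast+
    have "hwt X n {conj_index n a} \<in> deg_roots X n (- 1)"
      by (rule deg_roots_soI[OF m True]) (use x max_card in auto)
    moreover have e: "hwt X n M + hwt X n {conj_index n a} = hwt X n (M - {a})"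
    proof (rule hwt_add[OF n])
      fix c assume "cartan_tuple X n c"
      hence "c 1 + c (conj_index n 1) = c a + c (conj_index n a)" using True x unfolding cartan_tuple_def by metis
      thus "(\<Sum>a\<in>M. c a) + (\<Sum>a\<in>{conj_index n a}. c a) = (\<Sum>a\<in>M - {a}. c a) + (c 1 + c (conj_index n 1))"
        using a fin by (simp only:) (simp add: sum_diff1)
    qed
    have "hwt X n (M - {a}) \<in> deg_roots X n (d - 1)"
    proof (rule deg_roots_soI[OF m True])
      show "M - {a} \<noteq> {}"
        by (rule card_gt_0_iff[THEN iffD1, THEN conjunct1]) (use cM k(5) d in linarith)
    qed (use cM k d in auto)
    ultimately show ?thesis using \<alpha> e k(1) by metis
  qed
qed

text \<open>
  A root of degree 1 with the weight of \<open>\<xi>\<^sub>b\<close> adds an element \<open>b\<close>: the weight of \<open>\<xi>\<^sub>a \<xi>\<^sub>b D\<^sub>a\<close>, or in the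
  orthogonal case that of \<open>D\<^sub>H(\<xi>\<^sub>b \<xi>\<^sub>i \<xi>\<^bsub>i'\<^esub>)\<close> for a pair \<open>i, i'\<close> that does not contain \<open>b\<close>.
\<close>

lemma deg_roots_up:
  assumes m: "min_n X \<le> n" and d: "1 \<le> d" and ne: "deg_roots X n (d + 1) \<noteq> {}"
  shows "\<exists>\<alpha>\<in>deg_roots X n d. \<exists>\<beta>\<in>deg_roots X n 1. \<alpha> + \<beta> \<in> deg_roots X n (d + 1)"
proof -
  note n = min_n_ge_1[OF m] and max_card = max_card_ge_2[OF m]
  obtain \<alpha> where \<alpha>: "\<alpha> \<in> deg_roots X n (d + 1)" using ne by blast
  show ?thesis
  proof (cases "so_type X")
    case False
    obtain k I where k: "\<alpha> = mwt X n k I" "k \<in> {1..n}" "I \<subseteq> {1..n}" "card I \<le> max_card X n" "int (card I) = d + 1 + 1"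
      using deg_roots_glE[OF m False \<alpha>] by blast
    have fin: "finite I" using k finite_subset by blast
    have "I \<noteq> {}" using k(5) d by auto
    then obtain b where b: "b \<in> I" by blast
    have cI: "Suc (card (I - {b})) = card I" by (rule card_Suc_Diff1[OF fin b])
    have "\<not> I \<subseteq> {b}"
    proof
      assume "I \<subseteq> {b}"
      hence "card I \<le> 1" using card_mono[of "{b}" I] by simp
      thus False using k(5) d by linarith
    qed
    then obtain a where a: "a \<in> I" "a \<noteq> b" by blast
    have 1: "mwt X n a {a, b} \<in> deg_roots X n 1"
      by (rule deg_roots_glI[OF m False]) (use a b k max_card in auto)
    have e: "mwt X n k (I - {b}) + mwt X n a {a, b} = mwt X n k I"
      by (rule mwt_add[OF n]) (use a b fin in \<open>simp add: wt_def sum_diff1\<close>)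
    have "mwt X n k (I - {b}) \<in> deg_roots X n d"
    proof (rule deg_roots_glI[OF m False k(2)])
      show "I - {b} \<noteq> {k}" by (rule notI) (use cI k(5) d in simp)
    qed (use k cI in auto)
    thus ?thesis using 1 e \<alpha> k(1) by metis
  next
    case True
    hence n5: "5 \<le> n" using m by (auto simp: so_type_def)
    obtain M where k: "\<alpha> = hwt X n M" "M \<subseteq> {1..n}" "M \<noteq> {}" "card M \<le> max_card X n" "int (card M) = d + 1 + 2"
      using deg_roots_soE[OF m True \<alpha>] by blast
    have fin: "finite M" using k finite_subset by blast
    obtain b where b: "b \<in> M" "b \<in> {1..n}" using k by blast
    have cM: "Suc (card (M - {b})) = card M" by (rule card_Suc_Diff1[OF fin b(1)])
    \<comment> \<open>Among the first two conjugate pairs one avoids \<open>b\<close>; there are two since \<open>n \<ge> 5\<close>.\<close>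
    define i where "i = (if b = 1 \<or> b = 1 + n div 2 then 2 else 1 :: nat)"
    have i: "i \<in> {1..n}" "conj_index n i = i + n div 2" "b \<noteq> i" "b \<noteq> i + n div 2" "i \<noteq> i + n div 2"
      "i + n div 2 \<in> {1..n}"
      using n5 by (auto simp: i_def conj_index_def Let_def)
    let ?T = "{b, i, i + n div 2}"
    have 1: "hwt X n ?T \<in> deg_roots X n 1"
      by (rule deg_roots_soI[OF m True]) (use i b n5 in \<open>auto simp: max_card_def\<close>)
    have e: "hwt X n (M - {b}) + hwt X n ?T = hwt X n M"
    proof (rule hwt_add[OF n])
      fix c assume "cartan_tuple X n c"
      hence "c 1 + c (conj_index n 1) = c i + c (i + n div 2)" using True i unfolding cartan_tuple_def by metis
      thus "(\<Sum>a\<in>M - {b}. c a) + (\<Sum>a\<in>?T. c a) = (\<Sum>a\<in>M. c a) + (c 1 + c (conj_index n 1))"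
        using b fin i by (simp only:) (simp add: sum_diff1)
    qed
    have "hwt X n (M - {b}) \<in> deg_roots X n d"
    proof (rule deg_roots_soI[OF m True])
      show "M - {b} \<noteq> {}"
        by (rule card_gt_0_iff[THEN iffD1, THEN conjunct1]) (use cM k(5) d in linarith)
    qed (use cM k d in auto)
    thus ?thesis using 1 e \<alpha> k(1) by metis
  qed
qed

lemma closed_roots_full:
  assumes m: "min_n X \<le> n" and closed: "closed_roots X n \<Psi>" and zero: "deg_roots X n 0 \<subseteq> \<Psi>"
    and neg: "deg_roots X n (- 1) \<subseteq> \<Psi>" and d: "1 \<le> d" and pos: "\<Psi> \<inter> deg_roots X n d \<noteq> {}"
  shows "\<Psi> = roots X n"
proof -
  have conn: "deg_roots X n e \<subseteq> \<Psi>" if "e \<noteq> 0" "\<Psi> \<inter> deg_roots X n e \<noteq> {}" for e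
    by (rule deg_roots_connected[OF m closed zero that])
  have down: "deg_roots X n (e - 1) \<subseteq> \<Psi>" if "2 \<le> e" "\<Psi> \<inter> deg_roots X n e \<noteq> {}" for e
  proof -
    have "deg_roots X n e \<subseteq> \<Psi>" using conn that by simp
    moreover have "\<exists>\<alpha>\<in>deg_roots X n e. \<exists>\<beta>\<in>deg_roots X n (- 1). \<alpha> + \<beta> \<in> deg_roots X n (e - 1)"
      by (rule deg_roots_down[OF m that(1)]) (use that in blast)
    ultimately obtain \<alpha> \<beta> where "\<alpha> \<in> \<Psi>" "\<beta> \<in> \<Psi>" "\<alpha> + \<beta> \<in> deg_roots X n (e - 1)"
      using neg by blast
    hence "\<alpha> + \<beta> \<in> \<Psi> \<inter> deg_roots X n (e - 1)" using closed_rootsD[OF closed] by blast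
    thus ?thesis using that by (intro conn) auto
  qed
  have one: "deg_roots X n 1 \<subseteq> \<Psi>"
  proof -
    have "\<Psi> \<inter> deg_roots X n (int k + 1) \<noteq> {} \<Longrightarrow> \<Psi> \<inter> deg_roots X n 1 \<noteq> {}" for k
    proof (induction k)
      case (Suc k)
      have "deg_roots X n (int k + 1) \<subseteq> \<Psi>" using down[of "int (Suc k) + 1"] Suc.prems by (simp add: add.commute)
      moreover have "deg_roots X n (int k + 1) \<noteq> {}"
        using deg_roots_down[OF m, of "int (Suc k) + 1"] Suc.prems by (auto simp: add.commute)
      ultimately show ?case using Suc.IH by blast
    qed simp
    from this[of "nat (d - 1)"] have "\<Psi> \<inter> deg_roots X n 1 \<noteq> {}" using d pos by simp
    thus ?thesis by (intro conn) auto
  qed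
  have up: "deg_roots X n (int k + 1) \<subseteq> \<Psi>" for k
  proof (induction k)
    case 0
    thus ?case using one by simp
  next
    case (Suc k)
    show ?case
    proof (cases "deg_roots X n (int (Suc k) + 1) = {}")
      case False
      hence "\<exists>\<alpha>\<in>deg_roots X n (int k + 1). \<exists>\<beta>\<in>deg_roots X n 1. \<alpha> + \<beta> \<in> deg_roots X n (int (Suc k) + 1)"
        using deg_roots_up[OF m, of "int k + 1"] by (simp add: add.commute)
      then obtain \<alpha> \<beta> where "\<alpha> \<in> \<Psi>" "\<beta> \<in> \<Psi>" "\<alpha> + \<beta> \<in> deg_roots X n (int (Suc k) + 1)"
        using Suc.IH one by blast
      hence "\<alpha> + \<beta> \<in> \<Psi> \<inter> deg_roots X n (int (Suc k) + 1)" using closed_rootsD[OF closed] by blast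
      thus ?thesis by (intro conn) auto
    qed simp
  qed
  have "\<alpha> \<in> \<Psi>" if r: "\<alpha> \<in> roots X n" for \<alpha>
  proof -
    obtain e where e: "e \<ge> - 1" "\<alpha> \<in> deg_roots X n e" using root_degree[OF m r] .
    consider "e = - 1" | "e = 0" | "e = int (nat (e - 1)) + 1" using e(1) by linarith
    thus ?thesis using e(2) neg zero up[of "nat (e - 1)"] by cases auto
  qed
  thus ?thesis using closed by (auto simp: closed_roots_def)
qed

section \<open>Positive roots of a regular element\<close>

lemma cartan_real_coord:
  assumes n: "1 \<le> n" and h: "h \<in> cartan_real X n"
  shows "h \<in> cartan X n" "i \<in> {1..n} \<Longrightarrow> coord h i \<in> \<real>"
proof -
  obtain c where c: "h = (\<Sum>b\<in>cartan_basis X n. op_scale (complex_of_real (c b)) b)"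
    using h by (auto simp: cartan_real_def)
  show "h \<in> cartan X n"
    unfolding c cartan_def by (intro opv.span_sum opv.span_scale opv.span_base)
  assume i: "i \<in> {1..n}"
  have "coord h i = (\<Sum>b\<in>cartan_basis X n. complex_of_real (c b) * coord b i)"
    unfolding c coord_def sum_apply by (simp add: op_scale_def)
  also have "\<dots> \<in> \<real>"
  proof (rule sum_in_Reals)
    fix b assume "b \<in> cartan_basis X n"
    then obtain e where e: "b = diag n e" "\<And>k. e k \<in> \<real>" using cartan_basis_diag[OF _ n] by metis
    have "coord b i \<in> \<real>" unfolding e(1) coord_diag[OF i] by (rule e(2))
    thus "complex_of_real (c b) * coord b i \<in> \<real>" by (intro Reals_mult) auto
  qed
  finally show "coord h i \<in> \<real>" .
qed

text \<open>
  The values at \<open>h\<close> of the weights of degree -1 are the \<open>-c\<^sub>i\<close>, so all \<open>c\<^sub>i\<close> are positive. In the general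
  linear case a sum of \<open>d\<close> of the \<open>c\<^sub>i\<close> is the value of a root of degree \<open>d\<close>. In the orthogonal case the
  weights of \<open>M\<close> and of its conjugate have values with the positive sum \<open>d s\<close>, where
  \<open>s = c\<^sub>i + c\<^bsub>i'\<^esub>\<close>, so one of the two is positive.
\<close>

lemma pos_roots_each_degree:
  assumes m: "min_n X \<le> n" and h: "regular X n h"
    and neg: "pos_roots X n h \<inter> deg_roots X n (- 1) = {}"
    and d: "1 \<le> d" and ne: "deg_roots X n d \<noteq> {}"
  shows "pos_roots X n h \<inter> deg_roots X n d \<noteq> {}"
proof -
  note n = min_n_ge_1[OF m] and max_card = max_card_ge_2[OF m]
  let ?c = "coord h"
  have hc: "h \<in> cartan X n" and real: "\<And>i. i \<in> {1..n} \<Longrightarrow> ?c i \<in> \<real>"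
    using cartan_real_coord[OF n] h by (auto simp: regular_def)
  have reg: "\<alpha> h \<noteq> 0" if "\<alpha> \<in> roots X n" for \<alpha> using h that by (auto simp: regular_def)
  have nonpos: "\<not> 0 < Re (\<alpha> h)" if "\<alpha> \<in> deg_roots X n (- 1)" "\<alpha> h \<in> \<real>" for \<alpha>
    using neg that by (auto simp: pos_roots_def deg_roots_def)
  obtain \<alpha> where \<alpha>: "\<alpha> \<in> deg_roots X n d" using ne by blast
  show ?thesis
  proof (cases "so_type X")
    case False
    have pos: "0 < Re (?c j)" if j: "j \<in> {1..n}" for j
    proof -
      have r: "mwt X n j {} \<in> deg_roots X n (- 1)" by (rule deg_roots_glI[OF m False j]) auto
      have v: "mwt X n j {} h = - ?c j" using hc by (simp add: mwt_def wt_def)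
      have "\<not> 0 < Re (- ?c j)" using nonpos[OF r] real[OF j] by (simp add: v)
      moreover have "?c j \<noteq> 0" using reg[of "mwt X n j {}"] r v by (auto simp: deg_roots_def)
      hence "Re (?c j) \<noteq> 0" using real[OF j] by (auto elim!: Reals_cases)
      ultimately show ?thesis by simp
    qed
    obtain k I where k: "\<alpha> = mwt X n k I" "k \<in> {1..n}" "I \<subseteq> {1..n}" "card I \<le> max_card X n" "int (card I) = d + 1"
      using deg_roots_glE[OF m False \<alpha>] by blast
    have fin: "finite I" using k finite_subset by blast
    have "I \<noteq> {}" using k(5) d by auto
    then obtain a where a: "a \<in> I" by blast
    have cI: "Suc (card (I - {a})) = card I" by (rule card_Suc_Diff1[OF fin a])
    have r: "mwt X n a I \<in> deg_roots X n d"
      by (rule deg_roots_glI[OF m False]) (use a k d in auto)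
    have v: "mwt X n a I h = (\<Sum>j\<in>I - {a}. ?c j)" using hc a fin by (simp add: mwt_def wt_def sum_diff1)
    have "I - {a} \<noteq> {}"
      by (rule card_gt_0_iff[THEN iffD1, THEN conjunct1]) (use cI k(5) d in linarith)
    hence "0 < Re (\<Sum>j\<in>I - {a}. ?c j)"
      unfolding Re_sum using fin k(3) pos by (intro sum_pos) auto
    moreover have "(\<Sum>j\<in>I - {a}. ?c j) \<in> \<real>" using k(3) real by (intro sum_in_Reals) auto
    ultimately show ?thesis using r v by (auto simp: pos_roots_def deg_roots_def)
  next
    case True
    let ?m = "conj_index n"
    define s where "s = ?c 1 + ?c (?m 1)"
    have cs: "?c j + ?c (?m j) = s" if "j \<in> {1..n}" for j
      using cartan_tuple_coord[OF n hc] True that unfolding cartan_tuple_def s_def by metis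
    have v: "hwt X n M h = (\<Sum>a\<in>M. ?c a) - s" for M using hc by (simp add: hwt_def s_def)
    have sreal: "s \<in> \<real>" unfolding s_def using n conj_index_range[of 1 n] by (intro Reals_add real) auto
    have vreal: "hwt X n M h \<in> \<real>" if "M \<subseteq> {1..n}" for M
      unfolding v using that sreal real by (intro Reals_diff sum_in_Reals) auto
    have pos: "0 < Re (?c j)" if j: "j \<in> {1..n}" for j
    proof -
      have mj: "?m j \<in> {1..n}" "?m (?m j) = j" using conj_index_range conj_index_invol j by blast+
      have r: "hwt X n {?m j} \<in> deg_roots X n (- 1)"
        by (rule deg_roots_soI[OF m True]) (use mj max_card in auto)
      have vj: "hwt X n {?m j} h = - ?c j" unfolding v using cs[OF j] by (simp add: algebra_simps)
      have "\<not> 0 < Re (- ?c j)" using nonpos[OF r] real[OF j] by (simp add: vj)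
      moreover have "?c j \<noteq> 0" using reg[of "hwt X n {?m j}"] r vj by (auto simp: deg_roots_def)
      hence "Re (?c j) \<noteq> 0" using real[OF j] by (auto elim!: Reals_cases)
      ultimately show ?thesis by simp
    qed
    have spos: "0 < Re s" unfolding s_def using pos[of 1] pos[of "?m 1"] n conj_index_range[of 1 n] by simp
    obtain M where k: "\<alpha> = hwt X n M" "M \<subseteq> {1..n}" "M \<noteq> {}" "card M \<le> max_card X n" "int (card M) = d + 2"
      using deg_roots_soE[OF m True \<alpha>] by blast
    have inj: "inj_on ?m M" using conj_index_invol k(2) by (metis inj_on_inverseI subsetD)
    let ?M = "?m ` M"
    have sub: "?M \<subseteq> {1..n}" using k(2) conj_index_range by blast
    have r: "hwt X n ?M \<in> deg_roots X n d"
      by (rule deg_roots_soI[OF m True sub]) (use k d card_image[OF inj] in auto)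
    have "(\<Sum>a\<in>M. ?c a) + (\<Sum>a\<in>?M. ?c a) = (\<Sum>a\<in>M. ?c a + ?c (?m a))"
      by (simp add: sum.reindex[OF inj] sum.distrib)
    also have "\<dots> = (\<Sum>a\<in>M. s)" by (rule sum.cong) (use cs k(2) in auto)
    also have "\<dots> = of_nat (card M) * s" by simp
    finally have "hwt X n M h + hwt X n ?M h = (of_nat (card M) - 2) * s"
      unfolding v by (simp add: algebra_simps)
    also have "of_nat (card M) - 2 = complex_of_real (of_int d)"
    proof -
      have "real (card M) = of_int d + 2" using k(5) by (metis of_int_add of_int_numeral of_int_of_nat_eq)
      hence "complex_of_real (real (card M)) = complex_of_real (of_int d + 2)" by simp
      thus ?thesis by simp
    qed
    finally have e: "hwt X n M h + hwt X n ?M h = complex_of_real (of_int d) * s" .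
    have "Re (hwt X n M h) + Re (hwt X n ?M h) = of_int d * Re s"
      using arg_cong[OF e, of Re] by (simp only: plus_complex.sel times_complex.sel
          Re_complex_of_real Im_complex_of_real mult_zero_left diff_zero)
    moreover have "0 < of_int d * Re s" using d spos by simp
    ultimately have "0 < Re (hwt X n M h) \<or> 0 < Re (hwt X n ?M h)" by linarith
    thus ?thesis using \<alpha> k(1) r vreal[OF k(2)] vreal[OF sub] by (auto simp: pos_roots_def deg_roots_def)
  qed
qed

section \<open>Parabolic subalgebras\<close>

lemma W_deg_iff:
  assumes F: "F \<in> coeffs n"
  shows "vf n F \<in> W_deg n d \<longleftrightarrow> (\<forall>k\<in>{1..n}. \<forall>I. F k I \<noteq> 0 \<longrightarrow> int (card I) = d + 1)"
proof -
  have "vf n F \<in> W_deg n d \<longleftrightarrow> (\<forall>k\<in>{1..n}. F k \<in> Lambda_hom n (d + 1))"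
  proof
    assume "vf n F \<in> W_deg n d"
    then obtain G where G: "vf n F = vf n G" "\<forall>i\<in>{1..n}. G i \<in> Lambda_hom n (d + 1)"
      unfolding W_deg_def vf_def by blast
    hence "G \<in> coeffs n" by (auto simp: coeffs_def Lambda_hom_def)
    hence "F k = G k" if "k \<in> {1..n}" for k using vf_inj[OF F _ G(1) that] by blast
    thus "\<forall>k\<in>{1..n}. F k \<in> Lambda_hom n (d + 1)" using G by simp
  qed (auto simp: W_deg_def vf_def)
  thus ?thesis using coeffsD[OF F] by (auto simp: Lambda_hom_def)
qed

lemma root_space_degree:
  assumes m: "min_n X \<le> n" and a: "\<alpha> \<in> deg_roots X n d"
  shows "root_space X n \<alpha> \<subseteq> lie_deg X n d"
proof
  note n = min_n_ge_1[OF m]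
  fix x assume x: "x \<in> root_space X n \<alpha>"
  have "x \<in> lie_alg X n" using x by (simp add: root_space_def)
  then obtain F where F: "F \<in> coeffs n" "x = vf n F" by (rule lie_alg_vf_coeffs)
  have "\<alpha> \<in> cartan_dual X n" using a by (auto simp: deg_roots_def roots_def)
  hence s: "weights_in X n F {\<alpha>}" using root_space_iff[OF n F(1)] x F(2) by blast
  have "int (card I) = d + 1" if k: "k \<in> {1..n}" "F k I \<noteq> 0" for k I
  proof -
    have "I \<subseteq> {1..n}" using coeffsD[OF F(1) k(1)] k(2) by (auto simp: Lambda_def)
    hence "(of_int (int (card I) - 1) :: complex) = of_int d"
      using mwt_degree[OF n k(1), of I X] s k a by (simp add: weights_in_def deg_roots_def)
    hence "int (card I) - 1 = d" by (simp only: of_int_eq_iff)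
    thus ?thesis by simp
  qed
  hence "x \<in> W_deg n d" unfolding F(2) W_deg_iff[OF F(1)] by blast
  thus "x \<in> lie_deg X n d" using x by (simp add: lie_deg_def root_space_def)
qed

lemma cartan_degree_zero:
  assumes m: "min_n X \<le> n"
  shows "cartan X n \<subseteq> lie_deg X n 0"
proof
  note n = min_n_ge_1[OF m]
  fix x assume x: "x \<in> cartan X n"
  then obtain c where c: "x = diag n c" using cartan_diag[OF n] by blast
  have "x \<in> W_deg n 0"
    unfolding c diag_def W_deg_iff[OF diag_coeffs] by (auto simp: gscale_def xi_def split: if_splits)
  thus "x \<in> lie_deg X n 0" using x cartan_lie_alg[OF m] by (auto simp: lie_deg_def)
qed

lemma lie_alg_weights:
  assumes m: "min_n X \<le> n" and F: "F \<in> coeffs n" "vf n F \<in> lie_alg X n"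
    and k: "k \<in> {1..n}" "F k I \<noteq> 0"
  shows "mwt X n k I \<in> insert 0 (deg_roots X n (int (card I) - 1))"
proof (cases "mwt X n k I = 0")
  case False
  note n = min_n_ge_1[OF m]
  have "I \<noteq> {k}" using False mwt_self by auto
  hence "root_monomial X n k I" by (rule root_monomial_of_nonzero[OF m F k])
  thus ?thesis using False roots_iff[OF m] mwt_degree[OF n root_monomial_range] by (auto simp: deg_roots_def)
qed simp

text \<open>
  \<open>P_max\<close>, \<open>P_min\<close> and their like are sums of root spaces.
\<close>

lemma root_sum_degrees:
  assumes m: "min_n X \<le> n" and K: "0 \<in> K"
  shows "root_sum X n (\<Union>d\<in>K. deg_roots X n d) = opv.span (\<Union>d\<in>K. lie_deg X n d)"
proof
  have "cartan X n \<subseteq> (\<Union>d\<in>K. lie_deg X n d)" using cartan_degree_zero[OF m] K by blast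
  moreover have "(\<Union>\<alpha>\<in>(\<Union>d\<in>K. deg_roots X n d). root_space X n \<alpha>) \<subseteq> (\<Union>d\<in>K. lie_deg X n d)"
    using root_space_degree[OF m] by blast
  ultimately show "root_sum X n (\<Union>d\<in>K. deg_roots X n d) \<subseteq> opv.span (\<Union>d\<in>K. lie_deg X n d)"
    unfolding root_sum_def by (intro opv.span_mono) blast
next
  have sub: "(\<Union>d\<in>K. deg_roots X n d) \<subseteq> roots X n" by (auto simp: deg_roots_def)
  have "lie_deg X n d \<subseteq> root_sum X n (\<Union>d\<in>K. deg_roots X n d)" if d: "d \<in> K" for d
  proof
    fix x assume x: "x \<in> lie_deg X n d"
    hence "x \<in> lie_alg X n" by (simp add: lie_deg_def)
    then obtain F where F: "F \<in> coeffs n" "x = vf n F" by (rule lie_alg_vf_coeffs)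
    have L: "vf n F \<in> lie_alg X n" "vf n F \<in> W_deg n d" using x F by (auto simp: lie_deg_def)
    have "weights_in X n F (insert 0 (\<Union>d\<in>K. deg_roots X n d))"
      unfolding weights_in_def
    proof (intro ballI allI impI)
      fix k I assume k: "k \<in> {1..n}" "F k I \<noteq> 0"
      have "int (card I) - 1 = d" using L(2) k unfolding W_deg_iff[OF F(1)] by fastforce
      thus "mwt X n k I \<in> insert 0 (\<Union>d\<in>K. deg_roots X n d)"
        using lie_alg_weights[OF m F(1) L(1) k] d by auto
    qed
    thus "x \<in> root_sum X n (\<Union>d\<in>K. deg_roots X n d)"
      using root_sum_iff[OF m F(1) sub] L F by blast
  qed
  thus "opv.span (\<Union>d\<in>K. lie_deg X n d) \<subseteq> root_sum X n (\<Union>d\<in>K. deg_roots X n d)"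
    unfolding root_sum_def by (intro opv.span_minimal opv.subspace_span) blast
qed

lemma root_sum_roots:
  assumes m: "min_n X \<le> n"
  shows "root_sum X n (roots X n) = lie_alg X n"
proof
  show "root_sum X n (roots X n) \<subseteq> lie_alg X n"
    unfolding root_sum_def using cartan_lie_alg[OF m]
    by (intro opv.span_minimal lie_alg_subspace) (auto simp: root_space_def)
  show "lie_alg X n \<subseteq> root_sum X n (roots X n)"
  proof
    fix x assume x: "x \<in> lie_alg X n"
    then obtain F where F: "F \<in> coeffs n" "x = vf n F" by (rule lie_alg_vf_coeffs)
    have "weights_in X n F (insert 0 (roots X n))"
      unfolding weights_in_def using lie_alg_weights[OF m F(1)] x F(2) by (fastforce simp: deg_roots_def)
    thus "x \<in> root_sum X n (roots X n)" using root_sum_iff[OF m F(1) order_refl] x F(2) by blast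
  qed
qed

text \<open>
  A nonzero root vector contains a monomial of weight \<open>\<alpha>\<close>, which can only come from \<open>\<Psi>\<close>.
\<close>

lemma root_mem_if_root_space_subset:
  assumes m: "min_n X \<le> n" and \<Psi>: "\<Psi> \<subseteq> roots X n" and a: "\<alpha> \<in> roots X n"
    and sub: "root_space X n \<alpha> \<subseteq> root_sum X n \<Psi>"
  shows "\<alpha> \<in> \<Psi>"
proof -
  note n = min_n_ge_1[OF m]
  obtain F k I where F: "F \<in> coeffs n" "vf n F \<in> root_space X n \<alpha>"
    and k: "k \<in> {1..n}" "F k I \<noteq> 0" "mwt X n k I = \<alpha>"
    using root_vector_monomial[OF n a] by blast
  have "weights_in X n F (insert 0 \<Psi>)" using root_sum_iff[OF m F(1) \<Psi>] sub F(2) by blast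
  moreover have "\<alpha> \<noteq> 0" using a by (simp add: roots_def)
  ultimately show ?thesis using k by (auto simp: weights_in_def)
qed

lemma closed_subalgebra_lie_alg:
  assumes m: "min_n X \<le> n"
  shows "closed_subalgebra X n (lie_alg X n)"
  unfolding closed_subalgebra_def using lie_alg_subalgebra root_sum_roots[OF m]
  by (auto simp: closed_roots_def)

theorem proposition2p3:
  fixes X :: cartan_type and n :: nat and h :: oper
  assumes "n \<ge> min_n X"
    and "strongly_regular X n h"
    and "parabolic X n h \<noteq> lie_alg X n"
  shows "parabolic X n h = P_max X n \<or> parabolic X n h = P_min X n"
proof -
  note m = assms(1)
  have reg: "regular X n h" using assms(2) by (simp add: strongly_regular_def)
  define \<L> where "\<L> = {L. closed_subalgebra X n L \<and> lie_deg X n 0 \<subseteq> L \<and> borel X n h \<subseteq> L}"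
  have par: "parabolic X n h = \<Inter>\<L>" by (simp add: parabolic_def \<L>_def)
  have "borel X n h \<subseteq> root_sum X n (roots X n)"
    unfolding borel_def root_sum_def by (rule opv.span_mono) (auto simp: pos_roots_def)
  hence top: "lie_alg X n \<in> \<L>"
    using closed_subalgebra_lie_alg[OF m] root_sum_roots[OF m] by (simp add: \<L>_def lie_deg_def)
  have Pmax: "P_max X n = root_sum X n (\<Union>d\<in>{0..}. deg_roots X n d)"
  proof -
    have "lie_deg X n 0 \<union> (\<Union>k\<in>{0<..}. lie_deg X n k) = (\<Union>d\<in>{0..}. lie_deg X n d)"
      by (auto simp: le_less)
    thus ?thesis using root_sum_degrees[OF m, of "{0..}"] by (simp add: P_max_def)
  qed
  have Pmin: "P_min X n = root_sum X n (\<Union>d\<in>{0, - 1}. deg_roots X n d)"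
    using root_sum_degrees[OF m, of "{0, - 1}"] by (simp add: P_min_def)
  have member: "\<exists>\<Psi>. closed_roots X n \<Psi> \<and> L = root_sum X n \<Psi> \<and> deg_roots X n 0 \<subseteq> \<Psi> \<and> pos_roots X n h \<subseteq> \<Psi>"
    if L: "L \<in> \<L>" for L
  proof -
    obtain \<Psi> where \<Psi>: "closed_roots X n \<Psi>" "L = root_sum X n \<Psi>"
      using L by (auto simp: \<L>_def closed_subalgebra_def)
    have sub: "\<Psi> \<subseteq> roots X n" using \<Psi> by (simp add: closed_roots_def)
    have "\<alpha> \<in> \<Psi>" if a: "\<alpha> \<in> deg_roots X n 0" for \<alpha>
      by (rule root_mem_if_root_space_subset[OF m sub])
        (use a root_space_degree[OF m a] L \<Psi>(2) in \<open>auto simp: deg_roots_def \<L>_def\<close>)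
    moreover have "\<alpha> \<in> \<Psi>" if a: "\<alpha> \<in> pos_roots X n h" for \<alpha>
    proof (rule root_mem_if_root_space_subset[OF m sub])
      show "\<alpha> \<in> roots X n" using a by (simp add: pos_roots_def)
      have "root_space X n \<alpha> \<subseteq> borel X n h"
        unfolding borel_def root_sum_def
        by (rule order_trans[OF _ opv.span_superset]) (use a in blast)
      thus "root_space X n \<alpha> \<subseteq> root_sum X n \<Psi>" using L \<Psi>(2) by (auto simp: \<L>_def)
    qed
    ultimately show ?thesis using \<Psi> by blast
  qed
  \<comment> \<open>The closed subalgebras in question are \<open>P\<close> or the whole algebra, and the whole algebra is one of
    them, so their intersection is \<open>P\<close> as soon as it is proper.\<close>
  have dichotomy: "parabolic X n h = P" if "\<And>L. L \<in> \<L> \<Longrightarrow> L = P \<or> L = lie_alg X n" for P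
  proof -
    have "P \<subseteq> lie_alg X n \<or> P \<notin> \<L>" by (auto simp: \<L>_def closed_subalgebra_def subalgebra_def)
    moreover have "\<Inter>\<L> \<noteq> lie_alg X n" using assms(3) par by simp
    ultimately show ?thesis unfolding par using that top by blast
  qed
  show ?thesis
  proof (cases "pos_roots X n h \<inter> deg_roots X n (- 1) = {}")
    case True
    have "L = P_max X n \<or> L = lie_alg X n" if L: "L \<in> \<L>" for L
    proof -
      obtain \<Psi> where \<Psi>: "closed_roots X n \<Psi>" "L = root_sum X n \<Psi>" "deg_roots X n 0 \<subseteq> \<Psi>" "pos_roots X n h \<subseteq> \<Psi>"
        using member[OF L] by blast
      have pos: "deg_roots X n d \<subseteq> \<Psi>" if "0 \<le> d" for d
      proof (cases "d = 0 \<or> deg_roots X n d = {}")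
        case False
        hence "pos_roots X n h \<inter> deg_roots X n d \<noteq> {}"
          using pos_roots_each_degree[OF m reg True, of d] that by simp
        thus ?thesis using deg_roots_connected[OF m \<Psi>(1,3), of d] \<Psi>(4) False by blast
      qed (use \<Psi>(3) in auto)
      have sub: "\<Psi> \<subseteq> roots X n" using \<Psi> by (simp add: closed_roots_def)
      have deg: "\<exists>d. (d = - 1 \<or> 0 \<le> d) \<and> \<alpha> \<in> deg_roots X n d" if r: "\<alpha> \<in> roots X n" for \<alpha>
      proof -
        obtain d where "d \<ge> - 1" "\<alpha> \<in> deg_roots X n d" using root_degree[OF m r] .
        moreover have "d = - 1 \<or> 0 \<le> d" using \<open>d \<ge> - 1\<close> by linarith
        ultimately show ?thesis by blast
      qed
      show ?thesis
      proof (cases "\<Psi> \<inter> deg_roots X n (- 1) = {}")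
        case True
        have "\<Psi> = (\<Union>d\<in>{0..}. deg_roots X n d)"
        proof
          show "\<Psi> \<subseteq> (\<Union>d\<in>{0..}. deg_roots X n d)"
          proof
            fix \<alpha> assume a: "\<alpha> \<in> \<Psi>"
            then obtain d where "d = - 1 \<or> 0 \<le> d" "\<alpha> \<in> deg_roots X n d" using deg[of \<alpha>] sub by auto
            moreover have "\<alpha> \<notin> deg_roots X n (- 1)" using True a by auto
            ultimately show "\<alpha> \<in> (\<Union>d\<in>{0..}. deg_roots X n d)" by auto
          qed
        qed (use pos in auto)
        thus ?thesis using \<Psi>(2) Pmax by simp
      next
        case False
        hence neg: "deg_roots X n (- 1) \<subseteq> \<Psi>" using deg_roots_connected[OF m \<Psi>(1,3), of "- 1"] by simp
        have "roots X n \<subseteq> \<Psi>"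
        proof
          fix \<alpha> assume "\<alpha> \<in> roots X n"
          then obtain d where "d = - 1 \<or> 0 \<le> d" "\<alpha> \<in> deg_roots X n d" using deg[of \<alpha>] by auto
          thus "\<alpha> \<in> \<Psi>" using neg pos[of d] by auto
        qed
        hence "\<Psi> = roots X n" using sub by simp
        thus ?thesis using \<Psi>(2) root_sum_roots[OF m] by simp
      qed
    qed
    thus ?thesis using dichotomy by blast
  next
    case False
    have "L = P_min X n \<or> L = lie_alg X n" if L: "L \<in> \<L>" for L
    proof -
      obtain \<Psi> where \<Psi>: "closed_roots X n \<Psi>" "L = root_sum X n \<Psi>" "deg_roots X n 0 \<subseteq> \<Psi>" "pos_roots X n h \<subseteq> \<Psi>"
        using member[OF L] by blast
      have neg: "deg_roots X n (- 1) \<subseteq> \<Psi>"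
        using deg_roots_connected[OF m \<Psi>(1,3), of "- 1"] False \<Psi>(4) by auto
      have sub: "\<Psi> \<subseteq> roots X n" using \<Psi> by (simp add: closed_roots_def)
      show ?thesis
      proof (cases "\<exists>d\<ge>1. \<Psi> \<inter> deg_roots X n d \<noteq> {}")
        case True
        then obtain d where "1 \<le> d" "\<Psi> \<inter> deg_roots X n d \<noteq> {}" by blast
        hence "\<Psi> = roots X n" by (rule closed_roots_full[OF m \<Psi>(1,3) neg])
        thus ?thesis using \<Psi>(2) root_sum_roots[OF m] by simp
      next
        case False
        have "\<alpha> \<in> deg_roots X n 0 \<or> \<alpha> \<in> deg_roots X n (- 1)" if a: "\<alpha> \<in> \<Psi>" for \<alpha>
        proof -
          have "\<alpha> \<in> roots X n" using sub a by auto
          then obtain d where d: "d \<ge> - 1" "\<alpha> \<in> deg_roots X n d" by (rule root_degree[OF m])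
          hence "\<not> 1 \<le> d" using False a by auto
          hence "d = 0 \<or> d = - 1" using d(1) by linarith
          thus ?thesis using d(2) by auto
        qed
        hence "\<Psi> = (\<Union>d\<in>{0, - 1}. deg_roots X n d)" using neg \<Psi>(3) by auto
        thus ?thesis using \<Psi>(2) Pmin by simp
      qed
    qed
    thus ?thesis using dichotomy by blast
  qed
qed

end
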